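(* Let $\mathcal T$ be a triangulated category and $\mathcal S\subseteq\mathcal T$ a triangulated subcategory. Let $\operatorname{Ab}(\mathcal T)$ and $\operatorname{Ab}(\mathcal T/\mathcal S)$ denote the abelianisations of $\mathcal T$ and of the triangulated (Verdier) quotient $\mathcal T/\mathcal S$, and let $\operatorname{Ab}_{\mathcal S}(\mathcal T)$ denote the Serre subcategory of $\operatorname{Ab}(\mathcal T)$ generated by the image of the composite $\mathcal S\to\mathcal T\to\operatorname{Ab}(\mathcal T)$. Then the canonical exact functor $\operatorname{Ab}(\mathcal T)\to\operatorname{Ab}(\mathcal T/\mathcal S)$ induced by the quotient functor $\mathcal T\to\mathcal T/\mathcal S$ induces an equivalence \[\operatorname{Ab}(\mathcal T)/\operatorname{Ab}_{\mathcal S}(\mathcal T)\xrightarrow{\ \sim\ }\operatorname{Ab}(\mathcal T/\mathcal S).\]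
   Context: Size conventions: a Grothendieck universe $\mathfrak U$ containing the set of integers is fixed, and categories are assumed to be $\mathfrak U$-categories (for all objects $X,Y$ the set $\operatorname{Hom}(X,Y)$ belongs to $\mathfrak U$) unless they arise as localisations. The quotient categories $\mathcal T/\mathcal S$ and $\operatorname{Ab}(\mathcal T)/\operatorname{Ab}_{\mathcal S}(\mathcal T)$, and $\operatorname{Ab}(\mathcal T/\mathcal S)$, need not be $\mathfrak U$-categories; they are formed in a sufficiently large universe, and universal properties are understood there. Triangulated quotient: for a triangulated subcategory $\mathcal S\subseteq\mathcal T$ (full, closed under shifts and cones), $\mathcal T/\mathcal S$ is the Verdier quotient, i.e. the localisation of $\mathcal T$ with respect to the morphisms whose cone lies in $\mathcal S$. Abelianisation: for a triangulated category $\mathcal T$, the abelianisation is a fully faithful cohomological functor $\mathcal T\to\operatorname{Ab}(\mathcal T)$ into an abelian category such that for every abelian category $\mathcal A$ composition with it induces an equivalence from the category of exact functors $\operatorname{Ab}(\mathcal T)\to\mathcal A$ to the category of cohomological functors $\mathcal T\to\mathcal A$ (both full subcategories of functor categories, with natural transformations as morphisms). It is unique up to equivalence and can be realised as the category of coherent functors on $\mathcal T$, i.e. additive functors $F\colon\mathcal T^{\mathrm{op}}\to\mathrm{Ab}$ admitting an exact presentation $\operatorname{Hom}(-,X)\to\operatorname{Hom}(-,Y)\to F\to 0$ with $X,Y\in\mathcal T$, together with the Yoneda embedding. Canonical functor: the composite $\mathcal T\to\mathcal T/\mathcal S\to\operatorname{Ab}(\mathcal T/\mathcal S)$ is cohomological,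 so it extends, uniquely up to isomorphism, to an exact functor $\operatorname{Ab}(\mathcal T)\to\operatorname{Ab}(\mathcal T/\mathcal S)$. Abelian quotient: for an abelian category $\mathcal A$ and a Serre subcategory $\mathcal C$ (full, closed under subobjects, quotients and extensions), $\mathcal A/\mathcal C$ is the localisation $\mathcal A[\Sigma^{-1}]$ with respect to the class $\Sigma$ of morphisms whose kernel and cokernel both lie in $\mathcal C$. The Serre subcategory generated by a class of objects is the smallest Serre subcategory containing it. *)

theory Defs
  imports "HOL-Library.FuncSet"
begin

section \<open>Categories, functors, equivalences\<close>

record ('o, 'm) cat =
  Obj :: "'o set"
  Arr :: "'m set"
  Dom :: "'m \<Rightarrow> 'o"
  Cod :: "'m \<Rightarrow> 'o"
  Ident :: "'o \<Rightarrow> 'm"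
  Comp :: "'m \<Rightarrow> 'm \<Rightarrow> 'm"  (infixl \<open>\<cdot>\<index>\<close> 70)

definition hom :: "('o, 'm, 'z) cat_scheme \<Rightarrow> 'o \<Rightarrow> 'o \<Rightarrow> 'm set" where
  "hom C X Y = {f \<in> Arr C. Dom C f = X \<and> Cod C f = Y}"

locale category =
  fixes C :: "('o, 'm, 'z) cat_scheme" (structure)
  assumes Dom_Obj: "f \<in> Arr C \<Longrightarrow> Dom C f \<in> Obj C"
    and Cod_Obj: "f \<in> Arr C \<Longrightarrow> Cod C f \<in> Obj C"
    and Ident_hom: "X \<in> Obj C \<Longrightarrow> Ident C X \<in> hom C X X"
    and Comp_hom: "\<lbrakk>f \<in> hom C X Y; g \<in> hom C Y Z\<rbrakk> \<Longrightarrow> g \<cdot> f \<in> hom C X Z"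
    and Comp_Ident: "f \<in> hom C X Y \<Longrightarrow> f \<cdot> Ident C X = f"
    and Ident_Comp: "f \<in> hom C X Y \<Longrightarrow> Ident C Y \<cdot> f = f"
    and Comp_assoc: "\<lbrakk>f \<in> hom C W X; g \<in> hom C X Y; k \<in> hom C Y Z\<rbrakk>
      \<Longrightarrow> (k \<cdot> g) \<cdot> f = k \<cdot> (g \<cdot> f)"

definition is_inverse :: "('o, 'm, 'z) cat_scheme \<Rightarrow> 'm \<Rightarrow> 'm \<Rightarrow> bool" where
  "is_inverse C f g \<longleftrightarrow> f \<in> Arr C \<and> g \<in> hom C (Cod C f) (Dom C f) \<and>
     g \<cdot>\<^bsub>C\<^esub> f = Ident C (Dom C f) \<and> f \<cdot>\<^bsub>C\<^esub> g = Ident C (Cod C f)"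

definition iso :: "('o, 'm, 'z) cat_scheme \<Rightarrow> 'm \<Rightarrow> bool" where
  "iso C f \<longleftrightarrow> (\<exists>g. is_inverse C f g)"

definition mono_arr :: "('o, 'm, 'z) cat_scheme \<Rightarrow> 'm \<Rightarrow> bool" where
  "mono_arr C f \<longleftrightarrow> f \<in> Arr C \<and>
     (\<forall>X. \<forall>g \<in> hom C X (Dom C f). \<forall>k \<in> hom C X (Dom C f). f \<cdot>\<^bsub>C\<^esub> g = f \<cdot>\<^bsub>C\<^esub> k \<longrightarrow> g = k)"

definition epi_arr :: "('o, 'm, 'z) cat_scheme \<Rightarrow> 'm \<Rightarrow> bool" where
  "epi_arr C f \<longleftrightarrow> f \<in> Arr C \<and>
     (\<forall>X. \<forall>g \<in> hom C (Cod C f) X. \<forall>k \<in> hom C (Cod C f) X. g \<cdot>\<^bsub>C\<^esub> f = k \<cdot>\<^bsub>C\<^esub> f \<longrightarrow> g = k)"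

record ('o, 'm, 'p, 'q) fctr =
  fobj :: "'o \<Rightarrow> 'p"
  fmor :: "'m \<Rightarrow> 'q"

definition is_functor ::
  "('o, 'm, 'a) cat_scheme \<Rightarrow> ('p, 'q, 'b) cat_scheme \<Rightarrow> ('o, 'm, 'p, 'q) fctr \<Rightarrow> bool" where
  "is_functor C D F \<longleftrightarrow> category C \<and> category D \<and>
     (\<forall>X \<in> Obj C. fobj F X \<in> Obj D) \<and>
     (\<forall>f \<in> Arr C. fmor F f \<in> hom D (fobj F (Dom C f)) (fobj F (Cod C f))) \<and>
     (\<forall>X \<in> Obj C. fmor F (Ident C X) = Ident D (fobj F X)) \<and>
     (\<forall>f \<in> Arr C. \<forall>g \<in> Arr C. Cod C f = Dom C g \<longrightarrow>
        fmor F (g \<cdot>\<^bsub>C\<^esub> f) = fmor F g \<cdot>\<^bsub>D\<^esub> fmor F f)"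

definition id_fctr :: "('o, 'm, 'o, 'm) fctr" where
  "id_fctr = \<lparr>fobj = id, fmor = id\<rparr>"

definition fcomp ::
  "('p, 'q, 'r, 's) fctr \<Rightarrow> ('o, 'm, 'p, 'q) fctr \<Rightarrow> ('o, 'm, 'r, 's) fctr"
  (infixl \<open>\<circ>\<^sub>F\<close> 55) where
  "G \<circ>\<^sub>F F = \<lparr>fobj = fobj G \<circ> fobj F, fmor = fmor G \<circ> fmor F\<rparr>"

definition nat_trans ::
  "('o, 'm, 'a) cat_scheme \<Rightarrow> ('p, 'q, 'b) cat_scheme \<Rightarrow>
   ('o, 'm, 'p, 'q) fctr \<Rightarrow> ('o, 'm, 'p, 'q) fctr \<Rightarrow> ('o \<Rightarrow> 'q) \<Rightarrow> bool" where
  "nat_trans C D F G \<eta> \<longleftrightarrow>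
     (\<forall>X \<in> Obj C. \<eta> X \<in> hom D (fobj F X) (fobj G X)) \<and>
     (\<forall>f \<in> Arr C. \<eta> (Cod C f) \<cdot>\<^bsub>D\<^esub> fmor F f = fmor G f \<cdot>\<^bsub>D\<^esub> \<eta> (Dom C f))"

definition nat_isomorphic ::
  "('o, 'm, 'a) cat_scheme \<Rightarrow> ('p, 'q, 'b) cat_scheme \<Rightarrow>
   ('o, 'm, 'p, 'q) fctr \<Rightarrow> ('o, 'm, 'p, 'q) fctr \<Rightarrow> bool" where
  "nat_isomorphic C D F G \<longleftrightarrow>
     (\<exists>\<eta>. nat_trans C D F G \<eta> \<and> (\<forall>X \<in> Obj C. iso D (\<eta> X)))"

definition is_equivalence ::
  "('o, 'm, 'a) cat_scheme \<Rightarrow> ('p, 'q, 'b) cat_scheme \<Rightarrow> ('o, 'm, 'p, 'q) fctr \<Rightarrow> bool" where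
  "is_equivalence C D F \<longleftrightarrow> is_functor C D F \<and>
     (\<exists>G. is_functor D C G \<and> nat_isomorphic C C (G \<circ>\<^sub>F F) id_fctr \<and>
          nat_isomorphic D D (F \<circ>\<^sub>F G) id_fctr)"

definition fully_faithful ::
  "('o, 'm, 'a) cat_scheme \<Rightarrow> ('p, 'q, 'b) cat_scheme \<Rightarrow> ('o, 'm, 'p, 'q) fctr \<Rightarrow> bool" where
  "fully_faithful C D F \<longleftrightarrow> (\<forall>X \<in> Obj C. \<forall>Y \<in> Obj C.
     bij_betw (fmor F) (hom C X Y) (hom D (fobj F X) (fobj F Y)))"

text \<open>
  Natural transformations are made extensional, so that arrows of the functor category are equal
  as soon as their components are. Functors are not: two functors that differ only outside
  the carriers of \<open>C\<close> are distinct but isomorphic objects.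
\<close>

definition functor_cat ::
  "('o, 'm, 'a) cat_scheme \<Rightarrow> ('p, 'q, 'b) cat_scheme \<Rightarrow>
   (('o, 'm, 'p, 'q) fctr,
    ('o, 'm, 'p, 'q) fctr \<times> ('o \<Rightarrow> 'q) \<times> ('o, 'm, 'p, 'q) fctr) cat" where
  "functor_cat C D =
    \<lparr>Obj = {F. is_functor C D F},
     Arr = {(F, \<eta>, G). is_functor C D F \<and> is_functor C D G \<and> nat_trans C D F G \<eta> \<and>
                       \<eta> \<in> extensional (Obj C)},
     Dom = (\<lambda>(F, \<eta>, G). F),
     Cod = (\<lambda>(F, \<eta>, G). G),
     Ident = (\<lambda>F. (F, \<lambda>X \<in> Obj C. Ident D (fobj F X), F)),
     Comp = (\<lambda>(G, \<theta>, H) (F, \<eta>, G'). (F, \<lambda>X \<in> Obj C. \<theta> X \<cdot>\<^bsub>D\<^esub> \<eta> X, H))\<rparr>"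

definition full_subcat :: "('o, 'm, 'a) cat_scheme \<Rightarrow> ('o \<Rightarrow> bool) \<Rightarrow> ('o, 'm, 'a) cat_scheme" where
  "full_subcat C P = C\<lparr>Obj := {X \<in> Obj C. P X}, Arr := {f \<in> Arr C. P (Dom C f) \<and> P (Cod C f)}\<rparr>"

definition precomp ::
  "('o, 'm, 'a) cat_scheme \<Rightarrow> ('o, 'm, 'p, 'q) fctr \<Rightarrow>
   (('p, 'q, 'r, 's) fctr,
    ('p, 'q, 'r, 's) fctr \<times> ('p \<Rightarrow> 's) \<times> ('p, 'q, 'r, 's) fctr,
    ('o, 'm, 'r, 's) fctr,
    ('o, 'm, 'r, 's) fctr \<times> ('o \<Rightarrow> 's) \<times> ('o, 'm, 'r, 's) fctr) fctr" where
  "precomp C h =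
    \<lparr>fobj = (\<lambda>F. F \<circ>\<^sub>F h),
     fmor = (\<lambda>(F, \<eta>, G). (F \<circ>\<^sub>F h, \<lambda>X \<in> Obj C. \<eta> (fobj h X), G \<circ>\<^sub>F h))\<rparr>"


section \<open>Localisation of a category\<close>

text \<open>
  \<open>C[W\<inverse>]\<close> is the Gabriel--Zisman construction: same objects, and as arrows the equivalence
  classes of zigzags \<open>X \<rightarrow> \<bullet> \<leftarrow> \<bullet> \<rightarrow> \<dots> Y\<close> whose backward arrows lie in \<open>W\<close>. Zigzags are lists
  of steps read from left to right, so that composition is concatenation in reverse order.
\<close>

datatype 'm step = Fwd 'm | Bwd 'm

type_synonym ('o, 'm) zigzag_class = "'o \<times> 'm step list set \<times> 'o"

fun zigzag :: "('o, 'm, 'z) cat_scheme \<Rightarrow> 'm set \<Rightarrow> 'o \<Rightarrow> 'm step list \<Rightarrow> 'o \<Rightarrow> bool" where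
  "zigzag C W X [] Y \<longleftrightarrow> X \<in> Obj C \<and> X = Y"
| "zigzag C W X (Fwd f # p) Y \<longleftrightarrow> f \<in> Arr C \<and> Dom C f = X \<and> zigzag C W (Cod C f) p Y"
| "zigzag C W X (Bwd w # p) Y \<longleftrightarrow> w \<in> Arr C \<and> w \<in> W \<and> Cod C w = X \<and> zigzag C W (Dom C w) p Y"

inductive zz_red ::
  "('o, 'm, 'z) cat_scheme \<Rightarrow> 'm set \<Rightarrow> 'm step list \<Rightarrow> 'm step list \<Rightarrow> bool"
  for C :: "('o, 'm, 'z) cat_scheme" and W :: "'m set" where
  "\<lbrakk>f \<in> Arr C; g \<in> Arr C; Cod C f = Dom C g\<rbrakk> \<Longrightarrow> zz_red C W [Fwd f, Fwd g] [Fwd (g \<cdot>\<^bsub>C\<^esub> f)]"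
| "X \<in> Obj C \<Longrightarrow> zz_red C W [Fwd (Ident C X)] []"
| "\<lbrakk>w \<in> Arr C; w \<in> W\<rbrakk> \<Longrightarrow> zz_red C W [Fwd w, Bwd w] []"
| "\<lbrakk>w \<in> Arr C; w \<in> W\<rbrakk> \<Longrightarrow> zz_red C W [Bwd w, Fwd w] []"

definition zz_step ::
  "('o, 'm, 'z) cat_scheme \<Rightarrow> 'm set \<Rightarrow> 'o \<Rightarrow> 'o \<Rightarrow> ('m step list \<times> 'm step list) set" where
  "zz_step C W X Y = {(p, q). zigzag C W X p Y \<and> zigzag C W X q Y \<and>
     (\<exists>a b l r. zz_red C W l r \<and> p = a @ l @ b \<and> q = a @ r @ b)}"

definition zz_equiv ::
  "('o, 'm, 'z) cat_scheme \<Rightarrow> 'm set \<Rightarrow> 'o \<Rightarrow> 'o \<Rightarrow> ('m step list \<times> 'm step list) set" where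
  "zz_equiv C W X Y = {(p, q). zigzag C W X p Y \<and> zigzag C W X q Y \<and>
     (p, q) \<in> (zz_step C W X Y \<union> (zz_step C W X Y)\<inverse>)\<^sup>*}"

definition zz_class ::
  "('o, 'm, 'z) cat_scheme \<Rightarrow> 'm set \<Rightarrow> 'o \<Rightarrow> 'm step list \<Rightarrow> 'o \<Rightarrow> ('o, 'm) zigzag_class" where
  "zz_class C W X p Y = (X, zz_equiv C W X Y `` {p}, Y)"

definition localisation ::
  "('o, 'm, 'z) cat_scheme \<Rightarrow> 'm set \<Rightarrow> ('o, ('o, 'm) zigzag_class) cat" where
  "localisation C W =
    \<lparr>Obj = Obj C,
     Arr = {zz_class C W X p Y | X p Y. zigzag C W X p Y},
     Dom = (\<lambda>(X, c, Y). X),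
     Cod = (\<lambda>(X, c, Y). Y),
     Ident = (\<lambda>X. zz_class C W X [] X),
     Comp = (\<lambda>(Y, d, Z) (X, c, Y'). (X, \<Union>p \<in> c. \<Union>q \<in> d. zz_equiv C W X Z `` {p @ q}, Z))\<rparr>"

definition loc_functor ::
  "('o, 'm, 'z) cat_scheme \<Rightarrow> 'm set \<Rightarrow> ('o, 'm, 'o, ('o, 'm) zigzag_class) fctr" where
  "loc_functor C W = \<lparr>fobj = id, fmor = (\<lambda>f. zz_class C W (Dom C f) [Fwd f] (Cod C f))\<rparr>"


section \<open>Additive and abelian categories\<close>

text \<open>
  Being additive is treated as a property of a category: the sum of two parallel
  arrows \<open>f\<close>, \<open>g\<close> is the composite \<open>X \<rightarrow> Y \<oplus> Y \<rightarrow> Y\<close> of \<open>(f, g)\<close> with the codiagonal. This makes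
  every hom-set a commutative monoid, and additivity requires in addition that it be a group.
\<close>

definition zero_obj :: "('o, 'm, 'z) cat_scheme \<Rightarrow> 'o \<Rightarrow> bool" where
  "zero_obj C Z \<longleftrightarrow> Z \<in> Obj C \<and> (\<forall>X \<in> Obj C. (\<exists>!f. f \<in> hom C X Z) \<and> (\<exists>!f. f \<in> hom C Z X))"

definition zero_arr :: "('o, 'm, 'z) cat_scheme \<Rightarrow> 'm \<Rightarrow> bool" where
  "zero_arr C f \<longleftrightarrow> f \<in> Arr C \<and> (\<exists>Z. zero_obj C Z \<and>
     (\<exists>a \<in> hom C (Dom C f) Z. \<exists>b \<in> hom C Z (Cod C f). f = b \<cdot>\<^bsub>C\<^esub> a))"

definition biproduct ::
  "('o, 'm, 'z) cat_scheme \<Rightarrow> 'o \<Rightarrow> 'o \<Rightarrow> 'o \<Rightarrow> 'm \<Rightarrow> 'm \<Rightarrow> 'm \<Rightarrow> 'm \<Rightarrow> bool" where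
  "biproduct C X Y P i j p q \<longleftrightarrow> X \<in> Obj C \<and> Y \<in> Obj C \<and> P \<in> Obj C \<and>
     i \<in> hom C X P \<and> j \<in> hom C Y P \<and> p \<in> hom C P X \<and> q \<in> hom C P Y \<and>
     p \<cdot>\<^bsub>C\<^esub> i = Ident C X \<and> q \<cdot>\<^bsub>C\<^esub> j = Ident C Y \<and>
     zero_arr C (q \<cdot>\<^bsub>C\<^esub> i) \<and> zero_arr C (p \<cdot>\<^bsub>C\<^esub> j) \<and>
     (\<forall>V \<in> Obj C. \<forall>f \<in> hom C V X. \<forall>g \<in> hom C V Y.
        \<exists>!u. u \<in> hom C V P \<and> p \<cdot>\<^bsub>C\<^esub> u = f \<and> q \<cdot>\<^bsub>C\<^esub> u = g) \<and>
     (\<forall>V \<in> Obj C. \<forall>f \<in> hom C X V. \<forall>g \<in> hom C Y V.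
        \<exists>!u. u \<in> hom C P V \<and> u \<cdot>\<^bsub>C\<^esub> i = f \<and> u \<cdot>\<^bsub>C\<^esub> j = g)"

definition is_sum :: "('o, 'm, 'z) cat_scheme \<Rightarrow> 'm \<Rightarrow> 'm \<Rightarrow> 'm \<Rightarrow> bool" where
  "is_sum C f g s \<longleftrightarrow> f \<in> Arr C \<and> g \<in> hom C (Dom C f) (Cod C f) \<and>
     (\<exists>P i j p q u v. biproduct C (Cod C f) (Cod C f) P i j p q \<and>
        u \<in> hom C (Dom C f) P \<and> p \<cdot>\<^bsub>C\<^esub> u = f \<and> q \<cdot>\<^bsub>C\<^esub> u = g \<and>
        v \<in> hom C P (Cod C f) \<and> v \<cdot>\<^bsub>C\<^esub> i = Ident C (Cod C f) \<and> v \<cdot>\<^bsub>C\<^esub> j = Ident C (Cod C f) \<and>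
        s = v \<cdot>\<^bsub>C\<^esub> u)"

definition is_neg :: "('o, 'm, 'z) cat_scheme \<Rightarrow> 'm \<Rightarrow> 'm \<Rightarrow> bool" where
  "is_neg C f g \<longleftrightarrow> (\<exists>z. zero_arr C z \<and> is_sum C f g z)"

definition additive :: "('o, 'm, 'z) cat_scheme \<Rightarrow> bool" where
  "additive C \<longleftrightarrow> category C \<and> (\<exists>Z. zero_obj C Z) \<and>
     (\<forall>X \<in> Obj C. \<forall>Y \<in> Obj C. \<exists>P i j p q. biproduct C X Y P i j p q) \<and>
     (\<forall>f \<in> Arr C. \<exists>g. is_neg C f g)"

definition is_kernel :: "('o, 'm, 'z) cat_scheme \<Rightarrow> 'm \<Rightarrow> 'm \<Rightarrow> bool" where
  "is_kernel C f k \<longleftrightarrow> f \<in> Arr C \<and> k \<in> Arr C \<and> Cod C k = Dom C f \<and> zero_arr C (f \<cdot>\<^bsub>C\<^esub> k) \<and>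
     (\<forall>g \<in> Arr C. Cod C g = Dom C f \<and> zero_arr C (f \<cdot>\<^bsub>C\<^esub> g) \<longrightarrow>
        (\<exists>!u. u \<in> hom C (Dom C g) (Dom C k) \<and> k \<cdot>\<^bsub>C\<^esub> u = g))"

definition is_cokernel :: "('o, 'm, 'z) cat_scheme \<Rightarrow> 'm \<Rightarrow> 'm \<Rightarrow> bool" where
  "is_cokernel C f c \<longleftrightarrow> f \<in> Arr C \<and> c \<in> Arr C \<and> Dom C c = Cod C f \<and> zero_arr C (c \<cdot>\<^bsub>C\<^esub> f) \<and>
     (\<forall>g \<in> Arr C. Dom C g = Cod C f \<and> zero_arr C (g \<cdot>\<^bsub>C\<^esub> f) \<longrightarrow>
        (\<exists>!u. u \<in> hom C (Cod C c) (Cod C g) \<and> u \<cdot>\<^bsub>C\<^esub> c = g))"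

definition abelian :: "('o, 'm, 'z) cat_scheme \<Rightarrow> bool" where
  "abelian C \<longleftrightarrow> additive C \<and>
     (\<forall>f \<in> Arr C. (\<exists>k. is_kernel C f k) \<and> (\<exists>c. is_cokernel C f c)) \<and>
     (\<forall>f. mono_arr C f \<longrightarrow> (\<exists>g. is_kernel C g f)) \<and>
     (\<forall>f. epi_arr C f \<longrightarrow> (\<exists>g. is_cokernel C g f))"

text \<open>
  Exactness of \<open>X \<rightarrow> Y \<rightarrow> Z\<close> at \<open>Y\<close>: the image of \<open>f\<close>, that is the kernel of its cokernel, is
  the kernel of \<open>g\<close>.
\<close>

definition exact_at :: "('o, 'm, 'z) cat_scheme \<Rightarrow> 'm \<Rightarrow> 'm \<Rightarrow> bool" where
  "exact_at C f g \<longleftrightarrow> (\<exists>c k. is_cokernel C f c \<and> is_kernel C c k \<and> is_kernel C g k)"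

definition short_exact :: "('o, 'm, 'z) cat_scheme \<Rightarrow> 'm \<Rightarrow> 'm \<Rightarrow> bool" where
  "short_exact C f g \<longleftrightarrow> is_kernel C g f \<and> is_cokernel C f g"

text \<open>
  A functor preserving exact sequences preserves zero objects (\<open>0 = 0 = 0\<close> is exact) and split
  short exact sequences, hence is automatically additive.
\<close>

definition exact_functor ::
  "('o, 'm, 'a) cat_scheme \<Rightarrow> ('p, 'q, 'b) cat_scheme \<Rightarrow> ('o, 'm, 'p, 'q) fctr \<Rightarrow> bool" where
  "exact_functor A B F \<longleftrightarrow> is_functor A B F \<and>
     (\<forall>f g. exact_at A f g \<longrightarrow> exact_at B (fmor F f) (fmor F g))"


section \<open>Serre subcategories and abelian quotients\<close>

text \<open>Full subcategories are represented by their sets of objects.\<close>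

definition serre_subcategory :: "('o, 'm, 'z) cat_scheme \<Rightarrow> 'o set \<Rightarrow> bool" where
  "serre_subcategory A K \<longleftrightarrow> K \<subseteq> Obj A \<and> K \<noteq> {} \<and>
     (\<forall>f. mono_arr A f \<and> Cod A f \<in> K \<longrightarrow> Dom A f \<in> K) \<and>
     (\<forall>f. epi_arr A f \<and> Dom A f \<in> K \<longrightarrow> Cod A f \<in> K) \<and>
     (\<forall>f g. short_exact A f g \<and> Dom A f \<in> K \<and> Cod A g \<in> K \<longrightarrow> Cod A f \<in> K)"

definition serre_generated :: "('o, 'm, 'z) cat_scheme \<Rightarrow> 'o set \<Rightarrow> 'o set" where
  "serre_generated A U = \<Inter>{K. serre_subcategory A K \<and> U \<subseteq> K}"

definition serre_arrows :: "('o, 'm, 'z) cat_scheme \<Rightarrow> 'o set \<Rightarrow> 'm set" where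
  "serre_arrows A K =
     {f \<in> Arr A. \<exists>k c. is_kernel A f k \<and> is_cokernel A f c \<and> Dom A k \<in> K \<and> Cod A c \<in> K}"

definition serre_quotient ::
  "('o, 'm, 'z) cat_scheme \<Rightarrow> 'o set \<Rightarrow> ('o, ('o, 'm) zigzag_class) cat" where
  "serre_quotient A K = localisation A (serre_arrows A K)"

definition serre_quotient_functor ::
  "('o, 'm, 'z) cat_scheme \<Rightarrow> 'o set \<Rightarrow> ('o, 'm, 'o, ('o, 'm) zigzag_class) fctr" where
  "serre_quotient_functor A K = loc_functor A (serre_arrows A K)"


section \<open>Triangulated categories and Verdier quotients\<close>

record ('o, 'm) tcat = "('o, 'm) cat" +
  Shift :: "('o, 'm, 'o, 'm) fctr"
  Tri :: "('m \<times> 'm \<times> 'm) set"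

definition candidate :: "('o, 'm, 'z) tcat_scheme \<Rightarrow> 'm \<Rightarrow> 'm \<Rightarrow> 'm \<Rightarrow> bool" where
  "candidate T u v w \<longleftrightarrow> u \<in> Arr T \<and> v \<in> Arr T \<and> w \<in> Arr T \<and>
     Cod T u = Dom T v \<and> Cod T v = Dom T w \<and> Cod T w = fobj (Shift T) (Dom T u)"

definition tri_iso ::
  "('o, 'm, 'z) tcat_scheme \<Rightarrow> 'm \<times> 'm \<times> 'm \<Rightarrow> 'm \<times> 'm \<times> 'm \<Rightarrow> bool" where
  "tri_iso T = (\<lambda>(u, v, w) (u', v', w').
     candidate T u v w \<and> candidate T u' v' w' \<and>
     (\<exists>a \<in> hom T (Dom T u) (Dom T u'). \<exists>b \<in> hom T (Dom T v) (Dom T v').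
      \<exists>c \<in> hom T (Dom T w) (Dom T w').
        iso T a \<and> iso T b \<and> iso T c \<and>
        b \<cdot>\<^bsub>T\<^esub> u = u' \<cdot>\<^bsub>T\<^esub> a \<and> c \<cdot>\<^bsub>T\<^esub> v = v' \<cdot>\<^bsub>T\<^esub> b \<and> fmor (Shift T) a \<cdot>\<^bsub>T\<^esub> w = w' \<cdot>\<^bsub>T\<^esub> c))"

locale triangulated =
  fixes T :: "('o, 'm, 'z) tcat_scheme" (structure)
  assumes additive: "additive T"
    and Shift_equivalence: "is_equivalence T T (Shift T)"
    and Tri_candidate: "(u, v, w) \<in> Tri T \<Longrightarrow> candidate T u v w"
    and Tri_iso: "\<lbrakk>t \<in> Tri T; tri_iso T t t'\<rbrakk> \<Longrightarrow> t' \<in> Tri T"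
    and Tri_Ident: "\<lbrakk>X \<in> Obj T; zero_obj T Z; v \<in> hom T X Z; w \<in> hom T Z (fobj (Shift T) X)\<rbrakk>
      \<Longrightarrow> (Ident T X, v, w) \<in> Tri T"
    and Tri_cone: "u \<in> Arr T \<Longrightarrow> \<exists>v w. (u, v, w) \<in> Tri T"
    and Tri_rotate: "\<lbrakk>candidate T u v w; is_neg T (fmor (Shift T) u) n\<rbrakk>
      \<Longrightarrow> (u, v, w) \<in> Tri T \<longleftrightarrow> (v, w, n) \<in> Tri T"
    and Tri_fill: "\<lbrakk>(u, v, w) \<in> Tri T; (u', v', w') \<in> Tri T;
        a \<in> hom T (Dom T u) (Dom T u'); b \<in> hom T (Dom T v) (Dom T v'); b \<cdot> u = u' \<cdot> a\<rbrakk>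
      \<Longrightarrow> \<exists>c \<in> hom T (Dom T w) (Dom T w'). c \<cdot> v = v' \<cdot> b \<and> fmor (Shift T) a \<cdot> w = w' \<cdot> c"
    and Tri_octahedron: "\<lbrakk>(u, i, i') \<in> Tri T; (v, j, j') \<in> Tri T; (v \<cdot> u, k, k') \<in> Tri T;
        Cod T u = Dom T v\<rbrakk>
      \<Longrightarrow> \<exists>f g. (f, g, fmor (Shift T) i \<cdot> j') \<in> Tri T \<and>
            f \<in> hom T (Cod T i) (Cod T k) \<and> g \<in> hom T (Cod T k) (Cod T j) \<and>
            f \<cdot> i = k \<cdot> v \<and> k' \<cdot> f = i' \<and> g \<cdot> k = j \<and> j' \<cdot> g = fmor (Shift T) u \<cdot> k'"

definition triangulated_subcategory :: "('o, 'm, 'z) tcat_scheme \<Rightarrow> 'o set \<Rightarrow> bool" where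
  "triangulated_subcategory T S \<longleftrightarrow> S \<subseteq> Obj T \<and> S \<noteq> {} \<and>
     (\<forall>X \<in> Obj T. fobj (Shift T) X \<in> S \<longleftrightarrow> X \<in> S) \<and>
     (\<forall>(u, v, w) \<in> Tri T. Dom T u \<in> S \<and> Dom T v \<in> S \<longrightarrow> Dom T w \<in> S)"

definition cone_arrows :: "('o, 'm, 'z) tcat_scheme \<Rightarrow> 'o set \<Rightarrow> 'm set" where
  "cone_arrows T S = {u \<in> Arr T. \<exists>v w. (u, v, w) \<in> Tri T \<and> Cod T v \<in> S}"

definition verdier_quotient_functor ::
  "('o, 'm, 'z) tcat_scheme \<Rightarrow> 'o set \<Rightarrow> ('o, 'm, 'o, ('o, 'm) zigzag_class) fctr" where
  "verdier_quotient_functor T S = loc_functor T (cone_arrows T S)"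

definition loc_shift ::
  "('o, 'm, 'z) tcat_scheme \<Rightarrow> 'm set \<Rightarrow>
   ('o, ('o, 'm) zigzag_class, 'o, ('o, 'm) zigzag_class) fctr" where
  "loc_shift T W =
    \<lparr>fobj = fobj (Shift T),
     fmor = (\<lambda>(X, c, Y). (fobj (Shift T) X,
       \<Union>p \<in> c. zz_equiv T W (fobj (Shift T) X) (fobj (Shift T) Y) ``
                 {map (map_step (fmor (Shift T))) p},
       fobj (Shift T) Y))\<rparr>"

text \<open>
  The exact triangles of the quotient are the candidate triangles isomorphic to the image of an
  exact triangle. The category \<open>V\<close> below carries no triangles yet; being isomorphic as candidate
  triangles only involves the shift.
\<close>

definition verdier_quotient ::
  "('o, 'm, 'z) tcat_scheme \<Rightarrow> 'o set \<Rightarrow> ('o, ('o, 'm) zigzag_class) tcat" where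
  "verdier_quotient T S =
    (let W = cone_arrows T S;
         q = fmor (verdier_quotient_functor T S);
         V = cat.extend (localisation T W) (tcat.fields (loc_shift T W) {})
     in V\<lparr>Tri := {t. \<exists>(u, v, w) \<in> Tri T. tri_iso V (q u, q v, q w) t}\<rparr>)"


section \<open>Abelianisation\<close>

text \<open>As for exact functors, additivity of a cohomological functor is automatic.\<close>

definition cohomological ::
  "('o, 'm, 'a) tcat_scheme \<Rightarrow> ('p, 'q, 'b) cat_scheme \<Rightarrow> ('o, 'm, 'p, 'q) fctr \<Rightarrow> bool" where
  "cohomological T A H \<longleftrightarrow> is_functor T A H \<and>
     (\<forall>(u, v, w) \<in> Tri T. exact_at A (fmor H u) (fmor H v))"

definition exact_functors ::
  "('o, 'm, 'a) cat_scheme \<Rightarrow> ('p, 'q, 'b) cat_scheme \<Rightarrow>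
   (('o, 'm, 'p, 'q) fctr,
    ('o, 'm, 'p, 'q) fctr \<times> ('o \<Rightarrow> 'q) \<times> ('o, 'm, 'p, 'q) fctr) cat" where
  "exact_functors A D = full_subcat (functor_cat A D) (exact_functor A D)"

definition cohomological_functors ::
  "('o, 'm, 'a) tcat_scheme \<Rightarrow> ('p, 'q, 'b) cat_scheme \<Rightarrow>
   (('o, 'm, 'p, 'q) fctr,
    ('o, 'm, 'p, 'q) fctr \<times> ('o \<Rightarrow> 'q) \<times> ('o, 'm, 'p, 'q) fctr) cat" where
  "cohomological_functors T D = full_subcat (functor_cat T D) (cohomological T D)"

text \<open>
  \<open>h : T \<rightarrow> A\<close> is an abelianisation of \<open>T\<close>. A formula cannot quantify over types, so the
  types of the objects and arrows of the test categories \<open>D\<close> are a parameter;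
  a fully faithful functor that is universal among all abelian categories satisfies
  \<open>abelianisation TYPE('r) TYPE('s) T A h\<close> for every choice of \<open>'r\<close> and \<open>'s\<close>.
\<close>

definition abelianisation ::
  "'r itself \<Rightarrow> 's itself \<Rightarrow> ('o, 'm, 'a) tcat_scheme \<Rightarrow> ('p, 'q) cat \<Rightarrow>
   ('o, 'm, 'p, 'q) fctr \<Rightarrow> bool" where
  "abelianisation _ _ T A h \<longleftrightarrow> abelian A \<and> cohomological T A h \<and> fully_faithful T A h \<and>
     (\<forall>D :: ('r, 's) cat. abelian D \<longrightarrow>
        is_equivalence (exact_functors A D) (cohomological_functors T D) (precomp T h))"

end

theory Submission
  imports Defs
begin

text \<open>
  Put \<open>K = Ab\<^sub>S(T)\<close> and \<open>L = A/K\<close>, with quotient functor \<open>Q : A \<rightarrow> L\<close>. The arrows with kernel and cokernel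
  in \<open>K\<close> admit a calculus of left and right fractions, so \<open>L\<close> is abelian and \<open>Q\<close> is exact. The
  objects of \<open>S\<close> vanish in \<open>T/S\<close>, hence the exact functor \<open>F\<close> kills \<open>K\<close> and factors as \<open>F = G \<circ> Q\<close>
  with \<open>G\<close> exact. Conversely \<open>Q \<circ> h\<close> is cohomological and kills \<open>S\<close>, so it factors through a
  cohomological functor \<open>H : T/S \<rightarrow> L\<close>, which extends along \<open>h'\<close> to an exact functor \<open>E : B \<rightarrow> L\<close>.
  Now \<open>G \<circ> E\<close> and \<open>E \<circ> G\<close> are isomorphic to the identities, because they are so after
  restriction to \<open>T/S\<close> and to \<open>T\<close>, respectively, where the universal properties apply.
\<close>

section \<open>Categories and duality\<close>

text \<open>No description of the abelianisation by coherent functors enters: \<open>A\<close> and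
  \<open>B\<close> are known only through their universal properties. Fullness or faithfulness of
  \<open>G\<close> therefore cannot be tested on presentations, and a quasi-inverse has to come from
  extending a functor, with \<open>L\<close> itself as a test category. The obstacle is that an
  arrow of \<open>L\<close> is a class of zigzags, with equality an equivalence closure; fractions
  turn such an equality into an equation in \<open>A\<close> that holds after composing with one
  inverted arrow. Two further points shape the development. A cohomological functor is exact at one
  place of a triangle, so inverting an arrow \<open>u\<close> with cone in \<open>S\<close> takes
  two triangles: the cone makes the image of \<open>u\<close> epic, and a fibre, found by rotating
  backwards, makes it monic. And nearly every statement is needed together with its dual. The
  notions are therefore arranged to be stable under \<open>op_cat\<close>, which for sums and for
  fractions needs an argument of its own. Functors are compared up to natural isomorphism
  throughout.\<close>

lemma hom_iff: "f \<in> hom C X Y \<longleftrightarrow> f \<in> Arr C \<and> Dom C f = X \<and> Cod C f = Y"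
  by (auto simp: hom_def)

text \<open>Only \<open>Dom\<close>, \<open>Cod\<close> and the order of composition change, so the
  notions below rewrite to their duals in \<open>C\<close>, and a dual statement is obtained by
  instantiating at \<open>op_cat C\<close>.\<close>

definition op_cat :: "('o, 'm, 'z) cat_scheme \<Rightarrow> ('o, 'm) cat" where
  "op_cat C = \<lparr>Obj = Obj C, Arr = Arr C, Dom = Cod C, Cod = Dom C, Ident = Ident C,
     Comp = (\<lambda>g f. f \<cdot>\<^bsub>C\<^esub> g)\<rparr>"

lemma op_cat_simps [simp]:
  "Obj (op_cat C) = Obj C" "Arr (op_cat C) = Arr C" "Dom (op_cat C) = Cod C"
  "Cod (op_cat C) = Dom C" "Ident (op_cat C) = Ident C" "g \<cdot>\<^bsub>op_cat C\<^esub> f = f \<cdot>\<^bsub>C\<^esub> g"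
  "hom (op_cat C) X Y = hom C Y X"
  by (auto simp: op_cat_def hom_def)

context category
begin

lemma comp_arr [simp]:
  assumes "f \<in> Arr C" "g \<in> Arr C" "Dom C g = Cod C f"
  shows "g \<cdot> f \<in> Arr C" "Dom C (g \<cdot> f) = Dom C f" "Cod C (g \<cdot> f) = Cod C g"
  using Comp_hom[of f "Dom C f" "Cod C f" g "Cod C g"] assms by (simp_all add: hom_iff)

lemma ident_arr [simp]:
  assumes "X \<in> Obj C"
  shows "Ident C X \<in> Arr C" "Dom C (Ident C X) = X" "Cod C (Ident C X) = X"
  using Ident_hom[OF assms] by (simp_all add: hom_iff)

lemma arr_obj [simp]: "f \<in> Arr C \<Longrightarrow> Dom C f \<in> Obj C" "f \<in> Arr C \<Longrightarrow> Cod C f \<in> Obj C"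
  by (auto intro: Dom_Obj Cod_Obj)

lemma hom_obj: "f \<in> hom C X Y \<Longrightarrow> X \<in> Obj C" "f \<in> hom C X Y \<Longrightarrow> Y \<in> Obj C"
  by (auto simp: hom_iff)

lemma comp_id [simp]: "f \<in> Arr C \<Longrightarrow> Dom C f = X \<Longrightarrow> f \<cdot> Ident C X = f"
  "f \<in> Arr C \<Longrightarrow> Cod C f = X \<Longrightarrow> Ident C X \<cdot> f = f"
  by (auto intro: Comp_Ident Ident_Comp simp: hom_iff)

lemma assoc [simp]:
  "\<lbrakk>f \<in> Arr C; g \<in> Arr C; k \<in> Arr C; Dom C g = Cod C f; Dom C k = Cod C g\<rbrakk>
    \<Longrightarrow> (k \<cdot> g) \<cdot> f = k \<cdot> (g \<cdot> f)"
  by (rule Comp_assoc) (simp_all add: hom_iff)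

text \<open>Composites are normalised to the right, so an equation for \<open>g \<cdot> f\<close> no
  longer matches inside \<open>g \<cdot> (f \<cdot> x)\<close>. Used as
  \<open>assoc_eq[OF eq]\<close>, this supplies the rewrite rule for that position.\<close>

lemma assoc_eq:
  "\<lbrakk>g \<cdot> f = k; x \<in> Arr C; f \<in> Arr C; g \<in> Arr C; Dom C f = Cod C x; Dom C g = Cod C f\<rbrakk>
    \<Longrightarrow> g \<cdot> (f \<cdot> x) = k \<cdot> x"
  using assoc by metis

lemma category_op [simp]: "category (op_cat C)"
  by unfold_locales (simp_all add: hom_iff)

end

section \<open>Basic notions in the opposite category\<close>

lemma category_op_iff: assumes "category C" shows "category (op_cat C)"
  using assms by (rule category.category_op)

lemma iso_op [simp]: "iso (op_cat C) f \<longleftrightarrow> iso C f"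
  unfolding iso_def is_inverse_def by auto

lemma mono_arr_op [simp]: "mono_arr (op_cat C) f \<longleftrightarrow> epi_arr C f"
  and epi_arr_op [simp]: "epi_arr (op_cat C) f \<longleftrightarrow> mono_arr C f"
  by (auto simp: mono_arr_def epi_arr_def)

lemma zero_obj_op [simp]: "zero_obj (op_cat C) Z \<longleftrightarrow> zero_obj C Z"
  unfolding zero_obj_def by auto

lemma zero_arr_op [simp]: "zero_arr (op_cat C) f \<longleftrightarrow> zero_arr C f"
  unfolding zero_arr_def by auto

lemma is_kernel_op [simp]: "is_kernel (op_cat C) = is_cokernel C"
  and is_cokernel_op [simp]: "is_cokernel (op_cat C) = is_kernel C"
  by (auto simp: is_kernel_def is_cokernel_def fun_eq_iff)

lemma biproduct_op [simp]:
  "biproduct (op_cat C) X Y P i j p q \<longleftrightarrow> biproduct C X Y P p q i j"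
  unfolding biproduct_def by auto

context category
begin

section \<open>Isomorphisms, monomorphisms and epimorphisms\<close>

lemma isoI: "f \<in> hom C X Y \<Longrightarrow> g \<in> hom C Y X \<Longrightarrow> g \<cdot> f = Ident C X \<Longrightarrow> f \<cdot> g = Ident C Y \<Longrightarrow> iso C f"
  unfolding iso_def is_inverse_def by (auto simp: hom_iff)

lemma isoE:
  assumes "iso C f" "f \<in> hom C X Y"
  obtains g where "g \<in> hom C Y X" "g \<cdot> f = Ident C X" "f \<cdot> g = Ident C Y" "iso C g"
proof -
  obtain g where "g \<in> hom C Y X" "g \<cdot> f = Ident C X" "f \<cdot> g = Ident C Y"
    using assms unfolding iso_def is_inverse_def by (auto simp: hom_iff)
  moreover from this have "iso C g"
    using assms(2) isoI by blast
  ultimately show ?thesis using that by blast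
qed

lemma iso_arr: "iso C f \<Longrightarrow> f \<in> Arr C"
  unfolding iso_def is_inverse_def by auto

lemma iso_ident [simp]: "X \<in> Obj C \<Longrightarrow> iso C (Ident C X)"
  by (rule isoI[of _ X X "Ident C X"]) (simp_all add: hom_iff)

lemma iso_comp:
  assumes "iso C f" "iso C g" "Dom C g = Cod C f"
  shows "iso C (g \<cdot> f)"
proof -
  have ar: "f \<in> hom C (Dom C f) (Cod C f)" "g \<in> hom C (Cod C f) (Cod C g)"
    using assms iso_arr by (simp_all add: hom_iff)
  obtain f' where f': "f' \<in> hom C (Cod C f) (Dom C f)" "f' \<cdot> f = Ident C (Dom C f)"
      "f \<cdot> f' = Ident C (Cod C f)"
    using isoE[OF assms(1) ar(1)] by metis
  obtain g' where g': "g' \<in> hom C (Cod C g) (Cod C f)" "g' \<cdot> g = Ident C (Cod C f)"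
      "g \<cdot> g' = Ident C (Cod C g)"
    using isoE[OF assms(2) ar(2)] by metis
  show ?thesis
    by (rule isoI[of _ "Dom C f" "Cod C g" "f' \<cdot> g'"])
      (use ar f' g' in \<open>simp_all add: hom_iff assoc_eq[OF g'(2)] assoc_eq[OF f'(3)]\<close>)
qed

lemma iso_mono:
  assumes "iso C f" shows "mono_arr C f"
proof -
  have f: "f \<in> hom C (Dom C f) (Cod C f)" using assms iso_arr by (simp_all add: hom_iff)
  obtain f' where f': "f' \<in> hom C (Cod C f) (Dom C f)" "f' \<cdot> f = Ident C (Dom C f)"
    using isoE[OF assms f] by metis
  show ?thesis
    unfolding mono_arr_def
  proof (intro conjI allI ballI impI)
    fix X g k assume "g \<in> hom C X (Dom C f)" "k \<in> hom C X (Dom C f)" "f \<cdot> g = f \<cdot> k"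
    then have "f' \<cdot> (f \<cdot> g) = f' \<cdot> (f \<cdot> k)" "g \<in> hom C X (Dom C f)" "k \<in> hom C X (Dom C f)" by auto
    then show "g = k" using f f' by (simp add: hom_iff assoc_eq[OF f'(2)])
  qed (use f in \<open>simp_all add: hom_iff\<close>)
qed

lemma iso_epi: "iso C f \<Longrightarrow> epi_arr C f"
  using category.iso_mono[of "op_cat C" f] by simp

lemma monoD: "mono_arr C f \<Longrightarrow> f \<cdot> g = f \<cdot> k \<Longrightarrow> g \<in> hom C X (Dom C f) \<Longrightarrow> k \<in> hom C X (Dom C f) \<Longrightarrow> g = k"
  unfolding mono_arr_def by blast

lemma epiD: "epi_arr C f \<Longrightarrow> g \<cdot> f = k \<cdot> f \<Longrightarrow> g \<in> hom C (Cod C f) X \<Longrightarrow> k \<in> hom C (Cod C f) X \<Longrightarrow> g = k"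
  unfolding epi_arr_def by blast

lemma mono_of_comp:
  assumes "mono_arr C (g \<cdot> f)" "f \<in> hom C X Y" "g \<in> hom C Y Z"
  shows "mono_arr C f"
  unfolding mono_arr_def
proof (intro conjI allI ballI impI)
  fix V a b assume ab: "a \<in> hom C V (Dom C f)" "b \<in> hom C V (Dom C f)" "f \<cdot> a = f \<cdot> b"
  then have "(g \<cdot> f) \<cdot> a = (g \<cdot> f) \<cdot> b"
    using assms(2,3) by (simp add: hom_iff)
  then show "a = b" by (rule monoD[OF assms(1)]) (use ab assms in \<open>simp_all add: hom_iff\<close>)
qed (use assms in \<open>simp_all add: hom_iff\<close>)

lemma mono_comp:
  assumes "mono_arr C f" "mono_arr C g" "Dom C g = Cod C f"
  shows "mono_arr C (g \<cdot> f)"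
proof -
  have fg: "f \<in> Arr C" "g \<in> Arr C" using assms by (auto simp: mono_arr_def)
  show ?thesis
    unfolding mono_arr_def
  proof (intro conjI allI ballI impI)
    fix V a b assume ab: "a \<in> hom C V (Dom C (g \<cdot> f))" "b \<in> hom C V (Dom C (g \<cdot> f))"
      "(g \<cdot> f) \<cdot> a = (g \<cdot> f) \<cdot> b"
    then have "g \<cdot> (f \<cdot> a) = g \<cdot> (f \<cdot> b)" using fg assms(3) by (simp add: hom_iff)
    then have "f \<cdot> a = f \<cdot> b"
      by (rule monoD[OF assms(2), of _ _ V]) (use ab fg assms in \<open>simp_all add: hom_iff\<close>)
    then show "a = b"
      by (rule monoD[OF assms(1), of _ _ V]) (use ab fg assms in \<open>simp_all add: hom_iff\<close>)
  qed (use fg assms in auto)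
qed

lemma epi_comp:
  assumes "epi_arr C f" "epi_arr C g" "Dom C g = Cod C f"
  shows "epi_arr C (g \<cdot> f)"
  using category.mono_comp[OF category_op, of g f] assms by simp

section \<open>Zero objects and zero arrows\<close>

lemma zero_obj_hom_ex:
  assumes "zero_obj C Z" "X \<in> Obj C"
  obtains a b where "a \<in> hom C X Z" "b \<in> hom C Z X"
  using assms unfolding zero_obj_def by blast

lemma zero_obj_unique:
  assumes "zero_obj C Z"
  shows "a \<in> hom C X Z \<Longrightarrow> a' \<in> hom C X Z \<Longrightarrow> a = a'"
    "b \<in> hom C Z X \<Longrightarrow> b' \<in> hom C Z X \<Longrightarrow> b = b'"
  using assms hom_obj unfolding zero_obj_def by blast+

lemma zero_arr_arr: "zero_arr C f \<Longrightarrow> f \<in> Arr C"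
  by (simp add: zero_arr_def)

lemma zero_arrI: "zero_obj C Z \<Longrightarrow> a \<in> hom C X Z \<Longrightarrow> b \<in> hom C Z Y \<Longrightarrow> zero_arr C (b \<cdot> a)"
  unfolding zero_arr_def by (fastforce simp: hom_iff)

lemma zero_arr_dom: "zero_obj C (Dom C f) \<Longrightarrow> f \<in> Arr C \<Longrightarrow> zero_arr C f"
  unfolding zero_arr_def
  by (intro conjI exI[of _ "Dom C f"] bexI[of _ "Ident C (Dom C f)"] bexI[of _ f])
   (simp_all add: hom_iff)

lemma zero_arr_cod: "zero_obj C (Cod C f) \<Longrightarrow> f \<in> Arr C \<Longrightarrow> zero_arr C f"
  using category.zero_arr_dom[OF category_op, of f] by simp

lemma zero_arr_comp1:
  assumes "zero_arr C f" "g \<in> Arr C" "Dom C g = Cod C f"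
  shows "zero_arr C (g \<cdot> f)"
proof -
  obtain Z a b where Z: "zero_obj C Z" "a \<in> hom C (Dom C f) Z" "b \<in> hom C Z (Cod C f)" "f = b \<cdot> a"
    using assms(1) unfolding zero_arr_def by blast
  have "zero_arr C ((g \<cdot> b) \<cdot> a)"
    by (rule zero_arrI[OF Z(1,2), of _ "Cod C g"]) (use Z(3) assms in \<open>simp_all add: hom_iff\<close>)
  moreover have "(g \<cdot> b) \<cdot> a = g \<cdot> (b \<cdot> a)"
    by (rule assoc) (use Z(2,3) assms(2,3) in \<open>simp_all add: hom_iff\<close>)
  ultimately show ?thesis using Z(4) by simp
qed

lemma zero_arr_comp2:
  assumes "zero_arr C f" "g \<in> Arr C" "Cod C g = Dom C f"
  shows "zero_arr C (f \<cdot> g)"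
  using category.zero_arr_comp1[OF category_op, of f g] assms by simp

text \<open>The two arrows may factor through different zero objects; the arrow \<open>t\<close>
  between these identifies the factorisations.\<close>

lemma zero_arr_unique:
  assumes "zero_arr C f" "zero_arr C g" "Dom C f = Dom C g" "Cod C f = Cod C g"
  shows "f = g"
proof -
  obtain Z a b where Z: "zero_obj C Z" "a \<in> hom C (Dom C f) Z" "b \<in> hom C Z (Cod C f)" "f = b \<cdot> a"
    using assms(1) unfolding zero_arr_def by blast
  obtain Z' a' b' where Z': "zero_obj C Z'" "a' \<in> hom C (Dom C f) Z'" "b' \<in> hom C Z' (Cod C f)" "g = b' \<cdot> a'"
    using assms(2-4) unfolding zero_arr_def by auto
  obtain t where t: "t \<in> hom C Z Z'" using Z(1) Z'(1) unfolding zero_obj_def[of _ Z] by (meson zero_obj_hom_ex)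
  have "t \<cdot> a = a'" by (rule zero_obj_unique(1)[OF Z'(1)]) (use Z(2) Z'(2) t in \<open>simp_all add: hom_iff\<close>)
  moreover have "b' \<cdot> t = b" by (rule zero_obj_unique(2)[OF Z(1)]) (use Z(3) Z'(3) t in \<open>simp_all add: hom_iff\<close>)
  moreover have "(b' \<cdot> t) \<cdot> a = b' \<cdot> (t \<cdot> a)"
    by (rule assoc) (use Z(2,3) Z'(2,3) t in \<open>simp_all add: hom_iff\<close>)
  ultimately show ?thesis using Z(4) Z'(4) by simp
qed

text \<open>If the identity of \<open>X\<close> factors through a zero object, then so does every
  arrow into or out of \<open>X\<close>. This turns vanishing of an object into vanishing of an
  arrow, where monomorphisms and epimorphisms can be cancelled.\<close>

lemma zero_obj_ident: "zero_obj C X \<longleftrightarrow> X \<in> Obj C \<and> zero_arr C (Ident C X)"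
proof
  assume "zero_obj C X"
  then show "X \<in> Obj C \<and> zero_arr C (Ident C X)"
    using zero_arr_dom by (auto simp: zero_obj_def)
next
  assume X: "X \<in> Obj C \<and> zero_arr C (Ident C X)"
  then obtain Z a b where Z: "zero_obj C Z" "a \<in> hom C X Z" "b \<in> hom C Z X" "Ident C X = b \<cdot> a"
    unfolding zero_arr_def by (metis ident_arr(2,3))
  show "zero_obj C X"
    unfolding zero_obj_def
  proof (intro conjI ballI)
    fix Y assume Y: "Y \<in> Obj C"
    obtain r s where rs: "r \<in> hom C Y Z" "s \<in> hom C Z Y" using zero_obj_hom_ex[OF Z(1) Y] .
    show "\<exists>!f. f \<in> hom C Y X"
    proof (rule ex1I[of _ "b \<cdot> r"])
      show "b \<cdot> r \<in> hom C Y X" using Z rs Comp_hom by blast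
      fix f assume f: "f \<in> hom C Y X"
      then have "a \<cdot> f = r" using zero_obj_unique(1)[OF Z(1)] rs Z(2) Comp_hom by blast
      then show "f = b \<cdot> r" using f Z X by (metis Comp_assoc Ident_Comp)
    qed
    show "\<exists>!f. f \<in> hom C X Y"
    proof (rule ex1I[of _ "s \<cdot> a"])
      show "s \<cdot> a \<in> hom C X Y" using Z rs Comp_hom by blast
      fix f assume f: "f \<in> hom C X Y"
      then have "f \<cdot> b = s" using zero_obj_unique(2)[OF Z(1)] rs Z(3) Comp_hom by blast
      then show "f = s \<cdot> a" using f Z X by (metis Comp_assoc Comp_Ident)
    qed
  qed (use X in blast)
qed

lemma zero_obj_iso:
  assumes "zero_obj C X" "f \<in> hom C X Y" "iso C f"
  shows "zero_obj C Y"
proof -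
  obtain g where g: "g \<in> hom C Y X" "f \<cdot> g = Ident C Y" using isoE[OF assms(3,2)] by metis
  have "zero_arr C (f \<cdot> g)" by (rule zero_arrI[OF assms(1) g(1) assms(2)])
  then show ?thesis using g hom_obj zero_obj_ident by metis
qed

text \<open>A bare category has no subtraction. Instead \<open>f\<close> is compared with a zero
  arrow \<open>b \<cdot> a\<close>: both become zero after \<open>m\<close>, hence equal there, and
  \<open>m\<close> cancels.\<close>

lemma zero_arr_cancel_mono:
  assumes "mono_arr C m" "f \<in> hom C X (Dom C m)" "zero_arr C (m \<cdot> f)"
  shows "zero_arr C f"
proof -
  have m: "m \<in> Arr C" using assms by (auto simp: mono_arr_def)
  obtain Z where Z: "zero_obj C Z" using assms(3) unfolding zero_arr_def by blast
  obtain a where a: "a \<in> hom C X Z" using zero_obj_hom_ex[OF Z] assms(2) hom_obj by metis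
  obtain b where b: "b \<in> hom C Z (Dom C m)" using zero_obj_hom_ex[OF Z] assms(2) hom_obj by metis
  have z: "zero_arr C (b \<cdot> a)" by (rule zero_arrI[OF Z a b])
  have "m \<cdot> f = m \<cdot> (b \<cdot> a)"
    by (rule zero_arr_unique[OF assms(3) zero_arr_comp1[OF z]]) (use m a b assms(2) in \<open>simp_all add: hom_iff\<close>)
  then have "f = b \<cdot> a" by (rule monoD[OF assms(1)]) (use assms a b in \<open>simp_all add: hom_iff\<close>)
  then show ?thesis using z by simp
qed

lemma zero_arr_cancel_epi:
  assumes "epi_arr C e" "f \<in> hom C (Cod C e) X" "zero_arr C (f \<cdot> e)"
  shows "zero_arr C f"
  using category.zero_arr_cancel_mono[OF category_op, of e f X] assms by simp

lemma zero_obj_mono: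
  assumes "mono_arr C f" "zero_obj C (Cod C f)"
  shows "zero_obj C (Dom C f)"
proof -
  have f: "f \<in> Arr C" using assms by (auto simp: mono_arr_def)
  have "zero_arr C (Ident C (Dom C f))"
    by (rule zero_arr_cancel_mono[OF assms(1), of _ "Dom C f"])
     (use f assms in \<open>auto simp: hom_iff zero_arr_cod\<close>)
  then show ?thesis using f by (simp add: zero_obj_ident)
qed

lemma zero_obj_epi: "epi_arr C f \<Longrightarrow> zero_obj C (Dom C f) \<Longrightarrow> zero_obj C (Cod C f)"
  using category.zero_obj_mono[OF category_op, of f] by simp

section \<open>Kernels and cokernels\<close>

lemma kernel_arr: "is_kernel C f k \<Longrightarrow> f \<in> Arr C" "is_kernel C f k \<Longrightarrow> k \<in> Arr C"
  "is_kernel C f k \<Longrightarrow> Cod C k = Dom C f" "is_kernel C f k \<Longrightarrow> zero_arr C (f \<cdot> k)"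
  by (auto simp: is_kernel_def)

lemma kernel_lift:
  assumes "is_kernel C f k" "g \<in> hom C X (Dom C f)" "zero_arr C (f \<cdot> g)"
  obtains u where "u \<in> hom C X (Dom C k)" "k \<cdot> u = g"
  using assms unfolding is_kernel_def hom_iff by metis

lemma kernel_mono:
  assumes "is_kernel C f k" shows "mono_arr C k"
  unfolding mono_arr_def
proof (intro conjI allI ballI impI)
  note k = kernel_arr[OF assms]
  fix V a b assume ab: "a \<in> hom C V (Dom C k)" "b \<in> hom C V (Dom C k)" "k \<cdot> a = k \<cdot> b"
  have "zero_arr C ((f \<cdot> k) \<cdot> a)" by (rule zero_arr_comp2) (use k ab in \<open>simp_all add: hom_iff\<close>)
  then have "zero_arr C (f \<cdot> (k \<cdot> a))" using k ab by (simp add: hom_iff)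
  moreover have "k \<cdot> a \<in> Arr C" "Dom C (k \<cdot> a) = V" "Cod C (k \<cdot> a) = Dom C f" 
    using k ab by (simp_all add: hom_iff)
  ultimately have "\<exists>!u. u \<in> hom C V (Dom C k) \<and> k \<cdot> u = k \<cdot> a"
    using assms unfolding is_kernel_def by blast
  then show "a = b" using ab by metis
qed (use kernel_arr[OF assms] in auto)

lemma cokernel_arr: "is_cokernel C f c \<Longrightarrow> f \<in> Arr C" "is_cokernel C f c \<Longrightarrow> c \<in> Arr C"
  "is_cokernel C f c \<Longrightarrow> Dom C c = Cod C f" "is_cokernel C f c \<Longrightarrow> zero_arr C (c \<cdot> f)"
  by (auto simp: is_cokernel_def)

lemma cokernel_lift:
  assumes "is_cokernel C f c" "g \<in> hom C (Cod C f) X" "zero_arr C (g \<cdot> f)"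
  obtains u where "u \<in> hom C (Cod C c) X" "u \<cdot> c = g"
  using assms unfolding is_cokernel_def hom_iff by metis

lemma cokernel_epi: "is_cokernel C f c \<Longrightarrow> epi_arr C c"
  using category.kernel_mono[OF category_op, of f c] by simp

lemma kernelI:
  assumes "f \<in> hom C Y Z" "k \<in> hom C X Y" "mono_arr C k" "zero_arr C (f \<cdot> k)"
    and "\<And>V g. g \<in> hom C V Y \<Longrightarrow> zero_arr C (f \<cdot> g) \<Longrightarrow> \<exists>u \<in> hom C V X. k \<cdot> u = g"
  shows "is_kernel C f k"
  unfolding is_kernel_def
proof (intro conjI ballI impI)
  fix g assume g: "g \<in> Arr C" "Cod C g = Dom C f \<and> zero_arr C (f \<cdot> g)"
  then obtain u where u: "u \<in> hom C (Dom C g) X" "k \<cdot> u = g"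
    using assms(5)[of g "Dom C g"] assms(1) by (auto simp: hom_iff)
  show "\<exists>!u. u \<in> hom C (Dom C g) (Dom C k) \<and> k \<cdot> u = g"
  proof (rule ex1I[of _ u])
    show "u \<in> hom C (Dom C g) (Dom C k) \<and> k \<cdot> u = g" using u assms(2) by (simp_all add: hom_iff)
    fix v assume "v \<in> hom C (Dom C g) (Dom C k) \<and> k \<cdot> v = g"
    then show "v = u" using monoD[OF assms(3), of v u "Dom C g"] u assms(2) by (simp_all add: hom_iff)
  qed
qed (use assms in \<open>simp_all add: hom_iff\<close>)

lemma kernel_iso:
  assumes k: "is_kernel C f k" and k': "is_kernel C f k'"
  obtains u where "u \<in> hom C (Dom C k') (Dom C k)" "k \<cdot> u = k'" "iso C u"
proof -
  note a = kernel_arr[OF k] and a' = kernel_arr[OF k']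
  obtain u where u: "u \<in> hom C (Dom C k') (Dom C k)" "k \<cdot> u = k'"
    using kernel_lift[OF k, of k' "Dom C k'"] a' by (auto simp: hom_iff)
  obtain v where v: "v \<in> hom C (Dom C k) (Dom C k')" "k' \<cdot> v = k"
    using kernel_lift[OF k', of k "Dom C k"] a by (auto simp: hom_iff)
  have "u \<cdot> v = Ident C (Dom C k)"
    by (rule monoD[OF kernel_mono[OF k], of _ _ "Dom C k"])
     (use a u v in \<open>simp_all add: hom_iff assoc_eq[OF u(2)]\<close>)
  moreover have "v \<cdot> u = Ident C (Dom C k')"
    by (rule monoD[OF kernel_mono[OF k'], of _ _ "Dom C k'"])
     (use a' u v in \<open>simp_all add: hom_iff assoc_eq[OF v(2)]\<close>)
  ultimately have "iso C u" using isoI[OF u(1) v(1)] by blast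
  then show ?thesis using u that by blast
qed

lemma kernel_comp_iso:
  assumes k: "is_kernel C f k" and "u \<in> hom C X (Dom C k)" "iso C u"
  shows "is_kernel C f (k \<cdot> u)"
proof -
  note a = kernel_arr[OF k]
  obtain v where v: "v \<in> hom C (Dom C k) X" "v \<cdot> u = Ident C X" "u \<cdot> v = Ident C (Dom C k)"
    using isoE[OF assms(3,2)] by metis
  show ?thesis
  proof (rule kernelI)
    show "f \<in> hom C (Dom C f) (Cod C f)" "k \<cdot> u \<in> hom C X (Dom C f)" using a assms by (simp_all add: hom_iff)
    show "mono_arr C (k \<cdot> u)"
      using mono_comp[OF iso_mono[OF assms(3)] kernel_mono[OF k]] assms(2) by (simp add: hom_iff)
    have "zero_arr C ((f \<cdot> k) \<cdot> u)" by (rule zero_arr_comp2) (use a assms in \<open>simp_all add: hom_iff\<close>)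
    then show "zero_arr C (f \<cdot> (k \<cdot> u))" using a assms by (simp_all add: hom_iff)
    fix V g assume g: "g \<in> hom C V (Dom C f)" "zero_arr C (f \<cdot> g)"
    obtain w where w: "w \<in> hom C V (Dom C k)" "k \<cdot> w = g" using kernel_lift[OF k g] by metis
    show "\<exists>u'\<in>hom C V X. k \<cdot> u \<cdot> u' = g"
      by (rule bexI[of _ "v \<cdot> w"]) (use v w a assms in \<open>simp_all add: hom_iff assoc_eq[OF v(3)]\<close>)
  qed
qed

lemma kernel_post_mono:
  assumes k: "is_kernel C f k" and m: "mono_arr C m" "Dom C m = Cod C f"
  shows "is_kernel C (m \<cdot> f) k"
proof -
  note a = kernel_arr[OF k]
  have ma: "m \<in> Arr C" using m by (auto simp: mono_arr_def)
  show ?thesis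
  proof (rule kernelI)
    show "m \<cdot> f \<in> hom C (Dom C f) (Cod C m)" "k \<in> hom C (Dom C k) (Dom C f)"
      using a ma m by (simp_all add: hom_iff)
    have "zero_arr C (m \<cdot> (f \<cdot> k))" by (rule zero_arr_comp1) (use a ma m in auto)
    then show "zero_arr C (m \<cdot> f \<cdot> k)" using a ma m by simp
    fix V g assume g: "g \<in> hom C V (Dom C f)" "zero_arr C (m \<cdot> f \<cdot> g)"
    have "zero_arr C (f \<cdot> g)"
      by (rule zero_arr_cancel_mono[OF m(1), of _ V]) (use a g ma m in \<open>simp_all add: hom_iff\<close>)
    then show "\<exists>u\<in>hom C V (Dom C k). k \<cdot> u = g" using kernel_lift[OF k g(1)] by metis
  qed (rule kernel_mono[OF k])
qed

text \<open>Typically applied to an image factorisation: the epic part has the same kernel as the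
  whole arrow.\<close>

lemma kernel_of_post_mono:
  assumes k: "is_kernel C (m \<cdot> f) k" and m: "mono_arr C m" "Dom C m = Cod C f" "f \<in> Arr C"
  shows "is_kernel C f k"
proof -
  note a = kernel_arr[OF k]
  have ma: "m \<in> Arr C" using m by (auto simp: mono_arr_def)
  have kf: "Cod C k = Dom C f" using a(3) ma m by simp
  show ?thesis
  proof (rule kernelI)
    show "f \<in> hom C (Dom C f) (Cod C f)" "k \<in> hom C (Dom C k) (Dom C f)"
      using a ma m by (simp_all add: hom_iff)
    show "zero_arr C (f \<cdot> k)"
      by (rule zero_arr_cancel_mono[OF m(1), of _ "Dom C k"]) (use a ma m kf in \<open>simp_all add: hom_iff\<close>)
    fix V g assume g: "g \<in> hom C V (Dom C f)" "zero_arr C (f \<cdot> g)"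
    have "zero_arr C (m \<cdot> (f \<cdot> g))"
      by (rule zero_arr_comp1) (use a g ma m in \<open>simp_all add: hom_iff\<close>)
    moreover have "g \<in> hom C V (Dom C (m \<cdot> f))" "(m \<cdot> f) \<cdot> g = m \<cdot> (f \<cdot> g)"
      using g m ma by (simp_all add: hom_iff)
    ultimately show "\<exists>u\<in>hom C V (Dom C k). k \<cdot> u = g"
      using kernel_lift[OF k, of g V] by metis
  qed (rule kernel_mono[OF k])
qed

lemma kernel_pre_iso:
  assumes k: "is_kernel C (f \<cdot> b) k" and b: "b \<in> hom C X (Dom C f)" "iso C b" "f \<in> Arr C"
  shows "is_kernel C f (b \<cdot> k)"
proof -
  note a = kernel_arr[OF k]
  obtain v where v: "v \<in> hom C (Dom C f) X" "v \<cdot> b = Ident C X" "b \<cdot> v = Ident C (Dom C f)"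
    using isoE[OF b(2,1)] by metis
  have kh: "k \<in> hom C (Dom C k) X" using a(2,3) b by (simp add: hom_iff)
  show ?thesis
  proof (rule kernelI)
    show "f \<in> hom C (Dom C f) (Cod C f)" "b \<cdot> k \<in> hom C (Dom C k) (Dom C f)"
      using b kh Comp_hom by (auto simp: hom_iff)
    show "mono_arr C (b \<cdot> k)"
      using mono_comp[OF kernel_mono[OF k] iso_mono[OF b(2)]] b kh by (simp add: hom_iff)
    show "zero_arr C (f \<cdot> (b \<cdot> k))" using a(4) b kh by (simp_all add: hom_iff)
    fix V g assume g: "g \<in> hom C V (Dom C f)" "zero_arr C (f \<cdot> g)"
    have "zero_arr C ((f \<cdot> b) \<cdot> (v \<cdot> g))"
      using g v b by (simp add: hom_iff assoc_eq[OF v(3)])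
    then obtain w where w: "w \<in> hom C V (Dom C k)" "k \<cdot> w = v \<cdot> g"
      using kernel_lift[OF k, of "v \<cdot> g" V] g v b by (auto simp: hom_iff)
    show "\<exists>u\<in>hom C V (Dom C k). b \<cdot> k \<cdot> u = g"
      by (rule bexI[of _ w]) (use v w b g kh in \<open>simp_all add: hom_iff assoc_eq[OF v(3)]\<close>)
  qed
qed

lemma kernel_transport:
  assumes k: "is_kernel C f k" and b: "b \<in> hom C (Dom C f) Y" "iso C b"
    and c: "c \<in> hom C (Cod C f) Z" "iso C c" and f': "f' \<in> hom C Y Z" "c \<cdot> f = f' \<cdot> b"
  shows "is_kernel C f' (b \<cdot> k)"
proof -
  have "is_kernel C (f' \<cdot> b) k"
    using kernel_post_mono[OF k iso_mono[OF c(2)]] c f' by (simp add: hom_iff)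
  then show ?thesis using kernel_pre_iso[of f' b k] b f' by (simp_all add: hom_iff)
qed

text \<open>The new cokernel is \<open>c\<close> after the inverse of \<open>b\<close>. The equation
  \<open>u \<cdot> b = c\<close> is returned in place of this formula because it is the form in
  which exactness is transported later.\<close>

lemma cokernel_transport:
  assumes k: "is_cokernel C f c" and b: "b \<in> hom C (Cod C f) Y" "iso C b"
    and a: "a \<in> hom C (Dom C f) Z" "iso C a" and f': "f' \<in> hom C Z Y" "b \<cdot> f = f' \<cdot> a"
  obtains u where "is_cokernel C f' u" "u \<cdot> b = c"
proof -
  obtain v where v: "v \<in> hom C Y (Cod C f)" "v \<cdot> b = Ident C (Cod C f)" "b \<cdot> v = Ident C Y" "iso C v"
    using isoE[OF b(2,1)] by metis
  obtain d where d: "d \<in> hom C Z (Dom C f)" "d \<cdot> a = Ident C (Dom C f)" "a \<cdot> d = Ident C Z" "iso C d"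
    using isoE[OF a(2,1)] by metis
  note ca = cokernel_arr[OF k]
  have fh: "f \<in> hom C (Dom C f) (Cod C f)" using ca by (simp add: hom_iff)
  have "v \<cdot> f' = v \<cdot> ((f' \<cdot> a) \<cdot> d)"
    using f'(1) a(1) d(1,3) v(1) by (simp add: hom_iff)
  also have "\<dots> = v \<cdot> ((b \<cdot> f) \<cdot> d)" by (simp add: f'(2))
  also have "\<dots> = f \<cdot> d"
    using fh b(1) d(1) v(1) by (simp add: hom_iff assoc_eq[OF v(2)])
  finally have "f \<cdot> d = v \<cdot> f'" by simp
  then have "is_kernel (op_cat C) f' (v \<cdot>\<^bsub>op_cat C\<^esub> c)"
    using category.kernel_transport[OF category_op, of f c v Y d Z f'] k v d f' by simp
  then have "is_cokernel C f' (c \<cdot> v)" by simp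
  moreover have "(c \<cdot> v) \<cdot> b = c" using v b ca by (simp_all add: hom_iff)
  ultimately show ?thesis using that by blast
qed

lemma kernel_zero_dom_mono_trivial:
  assumes "mono_arr C f" "zero_obj C Z" "z \<in> hom C Z (Dom C f)"
  shows "is_kernel C f z"
proof (rule kernelI)
  have f: "f \<in> Arr C" using assms by (simp add: mono_arr_def)
  show "f \<in> hom C (Dom C f) (Cod C f)" using f by (simp add: hom_iff)
  show "mono_arr C z" unfolding mono_arr_def
    using assms zero_obj_unique(1)[OF assms(2)] by (simp_all add: hom_iff)
  show "zero_arr C (f \<cdot> z)"
    using zero_arr_dom[of "f \<cdot> z"] f assms by (simp_all add: hom_iff)
  fix V g assume g: "g \<in> hom C V (Dom C f)" "zero_arr C (f \<cdot> g)"
  have zg: "zero_arr C g" using zero_arr_cancel_mono[OF assms(1) g] .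
  obtain t where t: "t \<in> hom C V Z" using zero_obj_hom_ex[OF assms(2)] hom_obj[OF g(1)] by metis
  have "z \<cdot> t = g" by (rule zero_arr_unique[OF zero_arrI[OF assms(2) t assms(3)] zg])
     (use g t assms in \<open>simp_all add: hom_iff\<close>)
  then show "\<exists>u\<in>hom C V Z. z \<cdot> u = g" using t by blast
qed (use assms in auto)

lemma kernel_zero_arr:
  assumes "zero_arr C f" shows "is_kernel C f (Ident C (Dom C f))"
proof (rule kernelI)
  have f: "f \<in> Arr C" using assms zero_arr_arr by auto
  show "f \<in> hom C (Dom C f) (Cod C f)" "Ident C (Dom C f) \<in> hom C (Dom C f) (Dom C f)"
    "mono_arr C (Ident C (Dom C f))" "zero_arr C (f \<cdot> Ident C (Dom C f))"
    using f assms by (auto simp: hom_iff intro: iso_mono)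
  show "\<exists>u\<in>hom C V (Dom C f). Ident C (Dom C f) \<cdot> u = g" if "g \<in> hom C V (Dom C f)" for V g
    using that by (simp_all add: hom_iff)
qed

lemma cokernel_zero_arr: "zero_arr C f \<Longrightarrow> is_cokernel C f (Ident C (Cod C f))"
  using category.kernel_zero_arr[OF category_op, of f] by simp

lemma kernel_of_zero_iso:
  assumes "is_kernel C f k" "zero_arr C f"
  shows "iso C k"
  using kernel_iso[OF kernel_zero_arr[OF assms(2)] assms(1)] kernel_arr[OF assms(1)]
  by (metis Ident_Comp hom_iff ident_arr(2) arr_obj(1))

lemma cokernel_of_zero_iso: "is_cokernel C f c \<Longrightarrow> zero_arr C f \<Longrightarrow> iso C c"
  using category.kernel_of_zero_iso[OF category_op, of f c] by simp

end

section \<open>The additive structure\<close>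

lemma biproduct_arr:
  assumes "biproduct C X Y P i j p q"
  shows "i \<in> hom C X P" "j \<in> hom C Y P" "p \<in> hom C P X" "q \<in> hom C P Y"
    "p \<cdot>\<^bsub>C\<^esub> i = Ident C X" "q \<cdot>\<^bsub>C\<^esub> j = Ident C Y" "zero_arr C (q \<cdot>\<^bsub>C\<^esub> i)" "zero_arr C (p \<cdot>\<^bsub>C\<^esub> j)"
  using assms unfolding biproduct_def by blast+

lemma biproduct_sym: "biproduct C X Y P i j p q \<Longrightarrow> biproduct C Y X P j i q p"
  unfolding biproduct_def by blast

context category
begin

lemma biproduct_pair:
  assumes "biproduct C X Y P i j p q" "f \<in> hom C V X" "g \<in> hom C V Y"
  obtains u where "u \<in> hom C V P" "p \<cdot> u = f" "q \<cdot> u = g"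
  using assms hom_obj(1)[OF assms(2)] unfolding biproduct_def by metis

lemma biproduct_pair_eq:
  assumes b: "biproduct C X Y P i j p q" and u: "u \<in> hom C V P" "u' \<in> hom C V P"
    "p \<cdot> u = p \<cdot> u'" "q \<cdot> u = q \<cdot> u'"
  shows "u = u'"
proof -
  have "p \<cdot> u \<in> hom C V X" "q \<cdot> u \<in> hom C V Y" using biproduct_arr[OF b] u Comp_hom by blast+
  then have "\<exists>!w. w \<in> hom C V P \<and> p \<cdot> w = p \<cdot> u \<and> q \<cdot> w = q \<cdot> u"
    using b hom_obj(1)[OF u(1)] unfolding biproduct_def by blast
  then show ?thesis using u by metis
qed

lemma biproduct_copair:
  assumes "biproduct C X Y P i j p q" "f \<in> hom C X V" "g \<in> hom C Y V"
  obtains u where "u \<in> hom C P V" "u \<cdot> i = f" "u \<cdot> j = g"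
  using category.biproduct_pair[OF category_op, of X Y P p q i j f V g] assms by auto

lemma biproduct_copair_eq:
  assumes "biproduct C X Y P i j p q" "u \<in> hom C P V" "u' \<in> hom C P V"
    "u \<cdot> i = u' \<cdot> i" "u \<cdot> j = u' \<cdot> j"
  shows "u = u'"
  using category.biproduct_pair_eq[OF category_op, of X Y P p q i j u V u'] assms by auto

section \<open>Sums of parallel arrows\<close>

lemma is_sum_hom:
  assumes "is_sum C f g s" "f \<in> hom C X Y"
  shows "g \<in> hom C X Y" "s \<in> hom C X Y"
  using assms unfolding is_sum_def by (auto simp: hom_iff)

lemma is_sumI:
  assumes "biproduct C Y Y P i j p q" "u \<in> hom C X P" "v \<in> hom C P Y"
    "v \<cdot> i = Ident C Y" "v \<cdot> j = Ident C Y"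
  shows "is_sum C (p \<cdot> u) (q \<cdot> u) (v \<cdot> u)"
proof -
  have "p \<cdot> u \<in> hom C X Y" "q \<cdot> u \<in> hom C X Y"
    using biproduct_arr[OF assms(1)] assms(2) Comp_hom by blast+
  moreover from this have "Dom C (p \<cdot> u) = X" "Cod C (p \<cdot> u) = Y" "p \<cdot> u \<in> Arr C"
    by (simp_all add: hom_iff)
  ultimately show ?thesis
    unfolding is_sum_def using assms by metis
qed

lemma is_sumE:
  assumes "is_sum C f g s" "f \<in> hom C X Y"
  obtains P i j p q u v where "biproduct C Y Y P i j p q" "u \<in> hom C X P" "p \<cdot> u = f" "q \<cdot> u = g"
    "v \<in> hom C P Y" "v \<cdot> i = Ident C Y" "v \<cdot> j = Ident C Y" "s = v \<cdot> u"
proof -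
  have "Cod C f = Y" "Dom C f = X" using assms(2) by (simp_all add: hom_iff)
  then show ?thesis using assms(1) that unfolding is_sum_def by metis
qed

text \<open>Independence of the chosen biproduct, and additivity of composition with \<open>k\<close>, are both
  obtained from the arrow of biproducts \<open>P \<rightarrow> P'\<close> induced by \<open>k\<close>.\<close>

lemma is_sum_post_unique:
  assumes s: "is_sum C f g s" "f \<in> hom C X Y" and k: "k \<in> hom C Y Z"
    and s': "is_sum C (k \<cdot> f) (k \<cdot> g) s'"
  shows "s' = k \<cdot> s"
proof -
  obtain P i j p q u v where P: "biproduct C Y Y P i j p q" "u \<in> hom C X P" "p \<cdot> u = f" "q \<cdot> u = g"
    "v \<in> hom C P Y" "v \<cdot> i = Ident C Y" "v \<cdot> j = Ident C Y" "s = v \<cdot> u"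
    using is_sumE[OF s] .
  have kf: "k \<cdot> f \<in> hom C X Z" "k \<cdot> g \<in> hom C X Z" using is_sum_hom[OF s] s k Comp_hom by blast+
  obtain P' i' j' p' q' u' v' where P': "biproduct C Z Z P' i' j' p' q'" "u' \<in> hom C X P'"
    "p' \<cdot> u' = k \<cdot> f" "q' \<cdot> u' = k \<cdot> g" "v' \<in> hom C P' Z" "v' \<cdot> i' = Ident C Z" "v' \<cdot> j' = Ident C Z"
    "s' = v' \<cdot> u'"
    using is_sumE[OF s' kf(1)] .
  note a = biproduct_arr[OF P(1)] and a' = biproduct_arr[OF P'(1)]
  obtain w where w: "w \<in> hom C P P'" "p' \<cdot> w = k \<cdot> p" "q' \<cdot> w = k \<cdot> q"
    using biproduct_pair[OF P'(1), of "k \<cdot> p" P "k \<cdot> q"] a k Comp_hom by metis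
  have wu: "w \<cdot> u = u'"
  proof (rule biproduct_pair_eq[OF P'(1) Comp_hom[OF P(2) w(1)] P'(2)])
    show "p' \<cdot> (w \<cdot> u) = p' \<cdot> u'" unfolding P'(3) P(3)[symmetric]
      using a a' w(1) P(2) k by (simp add: hom_iff assoc_eq[OF w(2)])
    show "q' \<cdot> (w \<cdot> u) = q' \<cdot> u'" unfolding P'(4) P(4)[symmetric]
      using a a' w(1) P(2) k by (simp add: hom_iff assoc_eq[OF w(3)])
  qed
  \<comment> \<open>The mixed components of \<open>w \<cdot> i\<close> and
    \<open>i' \<cdot> k\<close>, and of \<open>w \<cdot> j\<close> and \<open>j' \<cdot> k\<close>,
    agree only because all of them are zero.\<close>
  have z: "zero_arr C (k \<cdot> (q \<cdot> i))" "zero_arr C (k \<cdot> (p \<cdot> j))" "zero_arr C ((q' \<cdot> i') \<cdot> k)"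
      "zero_arr C ((p' \<cdot> j') \<cdot> k)"
    by (intro zero_arr_comp1 zero_arr_comp2 a(7,8) a'(7,8); use a(1-4) a'(1-4) k in \<open>simp add: hom_iff\<close>)+
  have wi: "w \<cdot> i = i' \<cdot> k"
  proof (rule biproduct_pair_eq[OF P'(1) Comp_hom[OF a(1) w(1)] Comp_hom[OF k a'(1)]])
    show "p' \<cdot> (w \<cdot> i) = p' \<cdot> (i' \<cdot> k)"
      using a(1-4) a' w(1) k by (simp add: hom_iff assoc_eq[OF w(2)] a(5) assoc_eq[OF a'(5)])
    have "q' \<cdot> (w \<cdot> i) = k \<cdot> (q \<cdot> i)"
      using a(1-4) a'(1-4) w(1) k by (simp add: hom_iff assoc_eq[OF w(3)])
    also have "\<dots> = (q' \<cdot> i') \<cdot> k"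
      by (rule zero_arr_unique[OF z(1,3)]) (use a(1-4) a'(1-4) k in \<open>simp_all add: hom_iff\<close>)
    finally show "q' \<cdot> (w \<cdot> i) = q' \<cdot> (i' \<cdot> k)"
      using a'(1-4) k by (simp add: hom_iff)
  qed
  have wj: "w \<cdot> j = j' \<cdot> k"
  proof (rule biproduct_pair_eq[OF P'(1) Comp_hom[OF a(2) w(1)] Comp_hom[OF k a'(2)]])
    show "q' \<cdot> (w \<cdot> j) = q' \<cdot> (j' \<cdot> k)"
      using a(1-4) a' w(1) k by (simp add: hom_iff assoc_eq[OF w(3)] a(6) assoc_eq[OF a'(6)])
    have "p' \<cdot> (w \<cdot> j) = k \<cdot> (p \<cdot> j)"
      using a(1-4) a'(1-4) w(1) k by (simp add: hom_iff assoc_eq[OF w(2)])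
    also have "\<dots> = (p' \<cdot> j') \<cdot> k"
      by (rule zero_arr_unique[OF z(2,4)]) (use a(1-4) a'(1-4) k in \<open>simp_all add: hom_iff\<close>)
    finally show "p' \<cdot> (w \<cdot> j) = p' \<cdot> (j' \<cdot> k)"
      using a'(1-4) k by (simp add: hom_iff)
  qed
  have "v' \<cdot> w = k \<cdot> v"
  proof (rule biproduct_copair_eq[OF P(1) Comp_hom[OF w(1) P'(5)] Comp_hom[OF P(5) k]])
    show "v' \<cdot> w \<cdot> i = k \<cdot> v \<cdot> i"
      using a(1-4) a'(1-4) w(1) k P(5) P'(5) by (simp add: hom_iff wi P(6) assoc_eq[OF P'(6)])
    show "v' \<cdot> w \<cdot> j = k \<cdot> v \<cdot> j"
      using a(1-4) a'(1-4) w(1) k P(5) P'(5) by (simp add: hom_iff wj P(7) assoc_eq[OF P'(7)])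
  qed
  then have "v' \<cdot> w \<cdot> u = k \<cdot> v \<cdot> u" by simp
  then show ?thesis unfolding P(8) P'(8) wu[symmetric]
    using w(1) k P(2,5) P'(5) by (simp add: hom_iff)
qed

text \<open>The previous lemma with \<open>k\<close> an identity; the two sums may come from
  different biproducts.\<close>

lemma is_sum_unique:
  assumes "is_sum C f g s" "is_sum C f g s'"
  shows "s' = s"
proof -
  have f: "f \<in> hom C (Dom C f) (Cod C f)" using assms by (simp add: is_sum_def hom_iff)
  note h = is_sum_hom[OF assms(1) f]
  then show ?thesis
    using is_sum_post_unique[OF assms(1) f, of "Ident C (Cod C f)" "Cod C f" s'] assms(2) f
    by (simp add: hom_iff)
qed

lemma is_sum_commute: "is_sum C f g s \<Longrightarrow> is_sum C g f s"
  unfolding is_sum_def using biproduct_sym[of C] by (clarsimp simp: hom_iff) metis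

text \<open>Biproduct and codiagonal belong to the codomain and survive precomposition; only the
  pairing \<open>u\<close> changes.\<close>

lemma is_sum_pre:
  assumes "is_sum C f g s" "f \<in> hom C X Y" "t \<in> hom C W X"
  shows "is_sum C (f \<cdot> t) (g \<cdot> t) (s \<cdot> t)"
proof -
  obtain P i j p q u v where P: "biproduct C Y Y P i j p q" "u \<in> hom C X P" "p \<cdot> u = f" "q \<cdot> u = g"
    "v \<in> hom C P Y" "v \<cdot> i = Ident C Y" "v \<cdot> j = Ident C Y" "s = v \<cdot> u"
    using is_sumE[OF assms(1,2)] .
  have "is_sum C (p \<cdot> (u \<cdot> t)) (q \<cdot> (u \<cdot> t)) (v \<cdot> (u \<cdot> t))"
    by (rule is_sumI[OF P(1) Comp_hom[OF assms(3) P(2)] P(5-7)])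
  moreover have "f \<cdot> t = p \<cdot> (u \<cdot> t)" "g \<cdot> t = q \<cdot> (u \<cdot> t)" "s \<cdot> t = v \<cdot> (u \<cdot> t)"
    unfolding P(3)[symmetric] P(4)[symmetric] P(8)
    using biproduct_arr[OF P(1)] P(2,5) assms(3) by (simp_all add: hom_iff)
  ultimately show ?thesis by simp
qed

end

section \<open>Hom-sets as commutative groups\<close>

locale additive_cat = category C for C :: "('o, 'm, 'z) cat_scheme" (structure) +
  assumes additive: "additive C"
begin

lemma zero_obj_ex: obtains Z where "zero_obj C Z"
  using additive unfolding additive_def by blast

lemma biproduct_ex:
  assumes "X \<in> Obj C" "Y \<in> Obj C"
  obtains P i j p q where "biproduct C X Y P i j p q"
  using additive assms unfolding additive_def by blast

lemma zero_arr_ex: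
  assumes "X \<in> Obj C" "Y \<in> Obj C"
  obtains z where "z \<in> hom C X Y" "zero_arr C z"
proof -
  obtain Z where Z: "zero_obj C Z" using zero_obj_ex .
  obtain a where a: "a \<in> hom C X Z" using zero_obj_hom_ex[OF Z assms(1)] .
  obtain b where b: "b \<in> hom C Z Y" using zero_obj_hom_ex[OF Z assms(2)] .
  show ?thesis using that[OF Comp_hom[OF a b] zero_arrI[OF Z a b]] .
qed

text \<open>The description is definite because \<open>is_sum_unique\<close> removes the dependence
  on the chosen biproduct.\<close>

definition add :: "'m \<Rightarrow> 'm \<Rightarrow> 'm" (infixl \<open>\<oplus>\<close> 65) where
  "f \<oplus> g = (THE s. is_sum C f g s)"

lemma add_eqI: "is_sum C f g s \<Longrightarrow> f \<oplus> g = s"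
  unfolding add_def using is_sum_unique by blast

lemma is_sum_add:
  assumes "f \<in> hom C X Y" "g \<in> hom C X Y"
  shows "is_sum C f g (f \<oplus> g)"
proof -
  have Y: "Y \<in> Obj C" using hom_obj assms by blast
  obtain P i j p q where P: "biproduct C Y Y P i j p q" using biproduct_ex[OF Y Y] .
  obtain u where u: "u \<in> hom C X P" "p \<cdot> u = f" "q \<cdot> u = g" using biproduct_pair[OF P assms] .
  obtain v where v: "v \<in> hom C P Y" "v \<cdot> i = Ident C Y" "v \<cdot> j = Ident C Y"
    using biproduct_copair[OF P Ident_hom[OF Y] Ident_hom[OF Y]] .
  have "is_sum C f g (v \<cdot> u)" using is_sumI[OF P u(1) v] u by simp
  then show ?thesis using add_eqI by metis
qed

lemma add_hom: "f \<in> hom C X Y \<Longrightarrow> g \<in> hom C X Y \<Longrightarrow> f \<oplus> g \<in> hom C X Y"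
  using is_sum_add is_sum_hom by blast

lemma add_commute: "f \<in> hom C X Y \<Longrightarrow> g \<in> hom C X Y \<Longrightarrow> f \<oplus> g = g \<oplus> f"
  using is_sum_commute[OF is_sum_add] add_eqI by metis

lemma add_pre:
  "f \<in> hom C X Y \<Longrightarrow> g \<in> hom C X Y \<Longrightarrow> t \<in> hom C W X \<Longrightarrow> (f \<oplus> g) \<cdot> t = f \<cdot> t \<oplus> g \<cdot> t"
  using is_sum_pre[OF is_sum_add] add_eqI by metis

lemma add_post:
  assumes "f \<in> hom C X Y" "g \<in> hom C X Y" "k \<in> hom C Y Z"
  shows "k \<cdot> (f \<oplus> g) = k \<cdot> f \<oplus> k \<cdot> g"
  using is_sum_post_unique[OF is_sum_add[OF assms(1,2)] assms(1,3)] is_sum_add Comp_hom assms by metis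

lemma add_zero_right:
  assumes "f \<in> hom C X Y" "z \<in> hom C X Y" "zero_arr C z"
  shows "f \<oplus> z = f"
proof -
  have Y: "Y \<in> Obj C" using hom_obj assms by blast
  obtain P i j p q where P: "biproduct C Y Y P i j p q" using biproduct_ex[OF Y Y] .
  obtain v where v: "v \<in> hom C P Y" "v \<cdot> i = Ident C Y" "v \<cdot> j = Ident C Y"
    using biproduct_copair[OF P Ident_hom[OF Y] Ident_hom[OF Y]] .
  note a = biproduct_arr[OF P]
  \<comment> \<open>The arrow \<open>i \<cdot> f\<close> is the pairing of \<open>f\<close> with
    zero.\<close>
  have "p \<cdot> (i \<cdot> f) = f" "v \<cdot> (i \<cdot> f) = f"
    using a(1-4) assms(1) v(1) by (simp_all add: hom_iff assoc_eq[OF a(5)] assoc_eq[OF v(2)])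
  moreover have "q \<cdot> (i \<cdot> f) = z"
  proof -
    have "zero_arr C ((q \<cdot> i) \<cdot> f)" by (rule zero_arr_comp2[OF a(7)]) (use a assms(1) in \<open>simp_all add: hom_iff\<close>)
    then have "(q \<cdot> i) \<cdot> f = z"
      by (rule zero_arr_unique[OF _ assms(3)]) (use a(1-4) assms in \<open>simp_all add: hom_iff\<close>)
    then show ?thesis using a(1-4) assms(1) by (simp add: hom_iff)
  qed
  ultimately have "is_sum C f z f"
    using is_sumI[OF P Comp_hom[OF assms(1) a(1)] v] by simp
  then show ?thesis by (rule add_eqI)
qed

lemma add_zero_left: "f \<in> hom C X Y \<Longrightarrow> z \<in> hom C X Y \<Longrightarrow> zero_arr C z \<Longrightarrow> z \<oplus> f = f"
  using add_zero_right add_commute by metis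

text \<open>The Eckmann-Hilton argument: the codiagonal \<open>v\<close> sends \<open>t\<close> to
  \<open>p \<cdot> t \<oplus> q \<cdot> t\<close>, and composition with \<open>v\<close>,
  \<open>p\<close> and \<open>q\<close> is additive, so evaluating \<open>v\<close> on a sum of two
  pairings in two ways gives both sides.\<close>

lemma add_interchange:
  assumes "a \<in> hom C X Y" "b \<in> hom C X Y" "c \<in> hom C X Y" "d \<in> hom C X Y"
  shows "(a \<oplus> b) \<oplus> (c \<oplus> d) = (a \<oplus> c) \<oplus> (b \<oplus> d)"
proof -
  have Y: "Y \<in> Obj C" using hom_obj assms by blast
  obtain P i j p q where P: "biproduct C Y Y P i j p q" using biproduct_ex[OF Y Y] .
  obtain v where v: "v \<in> hom C P Y" "v \<cdot> i = Ident C Y" "v \<cdot> j = Ident C Y"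
    using biproduct_copair[OF P Ident_hom[OF Y] Ident_hom[OF Y]] .
  obtain u where u: "u \<in> hom C X P" "p \<cdot> u = a" "q \<cdot> u = b" using biproduct_pair[OF P assms(1,2)] .
  obtain w where w: "w \<in> hom C X P" "p \<cdot> w = c" "q \<cdot> w = d" using biproduct_pair[OF P assms(3,4)] .
  note pq = biproduct_arr(3,4)[OF P]
  have vs: "v \<cdot> t = p \<cdot> t \<oplus> q \<cdot> t" if "t \<in> hom C X P" for t
    using add_eqI[OF is_sumI[OF P that v]] by simp
  have "v \<cdot> (u \<oplus> w) = (a \<oplus> b) \<oplus> (c \<oplus> d)"
    using add_post[OF u(1) w(1) v(1)] vs u w by simp
  moreover have "v \<cdot> (u \<oplus> w) = (a \<oplus> c) \<oplus> (b \<oplus> d)"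
    using vs[OF add_hom[OF u(1) w(1)]] add_post[OF u(1) w(1) pq(1)] add_post[OF u(1) w(1) pq(2)] u w
    by simp
  ultimately show ?thesis by simp
qed

text \<open>Interchange with a zero arrow as one of the four terms.\<close>

lemma add_assoc:
  assumes "a \<in> hom C X Y" "b \<in> hom C X Y" "c \<in> hom C X Y"
  shows "(a \<oplus> b) \<oplus> c = a \<oplus> (b \<oplus> c)"
proof -
  obtain z where z: "z \<in> hom C X Y" "zero_arr C z" using zero_arr_ex hom_obj assms by metis
  have "a \<oplus> (b \<oplus> c) = (a \<oplus> z) \<oplus> (b \<oplus> c)" using add_zero_right assms z by simp
  also have "\<dots> = (a \<oplus> b) \<oplus> (z \<oplus> c)" using add_interchange assms z by simp
  also have "\<dots> = (a \<oplus> b) \<oplus> c" using add_zero_left assms z by simp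
  finally show ?thesis by simp
qed

lemma neg_ex:
  assumes "f \<in> hom C X Y"
  obtains n where "n \<in> hom C X Y" "zero_arr C (f \<oplus> n)" "is_neg C f n"
proof -
  obtain n where "is_neg C f n" using additive assms unfolding additive_def hom_iff by blast
  moreover from this obtain z where "zero_arr C z" "is_sum C f n z" unfolding is_neg_def by blast
  ultimately show ?thesis using that is_sum_hom[OF _ assms] add_eqI by metis
qed

text \<open>The arrow \<open>d\<close> is the difference of \<open>a\<close> and \<open>b\<close>.
  Its property is stated for composites with arbitrary \<open>s\<close> and \<open>t\<close>, so
  that later arguments can subtract without handling negatives.\<close>

lemma diff_ex:
  assumes "a \<in> hom C X Y" "b \<in> hom C X Y"
  obtains d where "d \<in> hom C X Y"
    "\<And>V W s t. t \<in> hom C V X \<Longrightarrow> s \<in> hom C Y W \<Longrightarrow> s \<cdot> (a \<cdot> t) = s \<cdot> (b \<cdot> t) \<longleftrightarrow> zero_arr C (s \<cdot> (d \<cdot> t))"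
proof -
  obtain n where n: "n \<in> hom C X Y" "zero_arr C (b \<oplus> n)" using neg_ex[OF assms(2)] by metis
  show ?thesis
  proof (rule that[OF add_hom[OF assms(1) n(1)]])
    fix V W s t assume t: "t \<in> hom C V X" and s: "s \<in> hom C Y W"
    let ?a = "s \<cdot> (a \<cdot> t)" and ?b = "s \<cdot> (b \<cdot> t)" and ?n = "s \<cdot> (n \<cdot> t)"
    have h: "?a \<in> hom C V W" "?b \<in> hom C V W" "?n \<in> hom C V W" using assms n s t Comp_hom by blast+
    have d: "s \<cdot> ((a \<oplus> n) \<cdot> t) = ?a \<oplus> ?n" "s \<cdot> ((b \<oplus> n) \<cdot> t) = ?b \<oplus> ?n"
      using add_post[OF Comp_hom[OF t assms(1)] Comp_hom[OF t n(1)] s]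
        add_post[OF Comp_hom[OF t assms(2)] Comp_hom[OF t n(1)] s]
      by (simp_all add: add_pre[OF assms(1) n(1) t] add_pre[OF assms(2) n(1) t])
    have zb: "zero_arr C (?b \<oplus> ?n)" unfolding d(2)[symmetric]
      using n s t add_hom[OF assms(2) n(1)] by (intro zero_arr_comp1 zero_arr_comp2) (simp_all add: hom_iff)
    show "?a = ?b \<longleftrightarrow> zero_arr C (s \<cdot> ((a \<oplus> n) \<cdot> t))"
    proof
      assume "?a = ?b" then show "zero_arr C (s \<cdot> ((a \<oplus> n) \<cdot> t))" using zb d by simp
    next
      assume "zero_arr C (s \<cdot> ((a \<oplus> n) \<cdot> t))"
      then have za: "zero_arr C (?a \<oplus> ?n)" using d by simp
      have "?a = ?a \<oplus> (?n \<oplus> ?b)"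
        using add_zero_right[OF h(1) add_hom[OF h(2,3)] zb] add_commute[OF h(2,3)] by simp
      also have "\<dots> = (?a \<oplus> ?n) \<oplus> ?b" using add_assoc[OF h(1,3,2)] by simp
      also have "\<dots> = ?b" using add_zero_left[OF h(2) add_hom[OF h(1,3)] za] .
      finally show "?a = ?b" .
    qed
  qed
qed

text \<open>The definition of a sum is not visibly self-dual: it doubles the codomain, whereas its
  dual doubles the domain. The two versions meet in the arrow
  \<open>f \<cdot> p \<oplus> g \<cdot> q\<close> out of the double of \<open>X\<close>: along the
  inclusions it gives \<open>f\<close> and \<open>g\<close>, along the diagonal \<open>v\<close>
  their sum.\<close>

lemma is_sum_op:
  assumes "f \<in> hom C X Y" "g \<in> hom C X Y"
  shows "is_sum (op_cat C) f g (f \<oplus> g)"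
proof -
  have X: "X \<in> Obj C" using hom_obj assms by blast
  obtain P i j p q where P: "biproduct C X X P i j p q" using biproduct_ex[OF X X] .
  note a = biproduct_arr[OF P]
  obtain v where v: "v \<in> hom C X P" "p \<cdot> v = Ident C X" "q \<cdot> v = Ident C X"
    using biproduct_pair[OF P Ident_hom[OF X] Ident_hom[OF X]] .
  let ?u = "f \<cdot> p \<oplus> g \<cdot> q"
  have h: "f \<cdot> p \<in> hom C P Y" "g \<cdot> q \<in> hom C P Y" using assms a Comp_hom by blast+
  have "?u \<cdot> i = f \<oplus> g \<cdot> (q \<cdot> i)" "?u \<cdot> j = f \<cdot> (p \<cdot> j) \<oplus> g"
    using assms a(1-4) by (simp_all add: add_pre[OF h a(1)] add_pre[OF h a(2)] hom_iff a(5,6))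
  moreover have "zero_arr C (g \<cdot> (q \<cdot> i))" "zero_arr C (f \<cdot> (p \<cdot> j))"
    by (rule zero_arr_comp1; use a assms in \<open>simp add: hom_iff\<close>)+
  ultimately have u: "?u \<cdot> i = f" "?u \<cdot> j = g"
    using add_zero_right[OF assms(1), of "g \<cdot> (q \<cdot> i)"] add_zero_left[OF assms(2), of "f \<cdot> (p \<cdot> j)"]
      assms a Comp_hom by metis+
  have uv: "?u \<cdot> v = f \<oplus> g"
    using assms a(1-4) v(1) by (simp add: add_pre[OF h v(1)] hom_iff v(2,3))
  have "is_sum (op_cat C) (i \<cdot>\<^bsub>op_cat C\<^esub> ?u) (j \<cdot>\<^bsub>op_cat C\<^esub> ?u) (v \<cdot>\<^bsub>op_cat C\<^esub> ?u)"
    by (rule category.is_sumI[OF category_op, of X P p q i j ?u Y v]) (use P v add_hom[OF h] in simp_all)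
  then show ?thesis using u uv by simp
qed

lemma additive_op: "additive (op_cat C)"
  unfolding additive_def
proof (intro conjI ballI)
  show "\<exists>Z. zero_obj (op_cat C) Z" using zero_obj_ex by auto
  show "\<exists>P i j p q. biproduct (op_cat C) X Y P i j p q"
    if "X \<in> Obj (op_cat C)" "Y \<in> Obj (op_cat C)" for X Y
    using biproduct_ex that by (metis biproduct_op op_cat_simps(1))
  fix f assume "f \<in> Arr (op_cat C)"
  then have f: "f \<in> hom C (Dom C f) (Cod C f)" by (simp add: hom_iff)
  obtain n where "n \<in> hom C (Dom C f) (Cod C f)" "zero_arr C (f \<oplus> n)" using neg_ex[OF f] by metis
  then show "\<exists>n. is_neg (op_cat C) f n" using is_sum_op[OF f] unfolding is_neg_def by (metis zero_arr_op)
qed (rule category_op)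

text \<open>Cancellation is tested on the difference of the two arrows.\<close>

lemma monoI:
  assumes "f \<in> hom C X Y" "\<And>V g. g \<in> hom C V X \<Longrightarrow> zero_arr C (f \<cdot> g) \<Longrightarrow> zero_arr C g"
  shows "mono_arr C f"
  unfolding mono_arr_def
proof (intro conjI allI ballI impI)
  fix V a b assume ab: "a \<in> hom C V (Dom C f)" "b \<in> hom C V (Dom C f)" "f \<cdot> a = f \<cdot> b"
  have fX: "Dom C f = X" using assms(1) by (simp add: hom_iff)
  have V: "V \<in> Obj C" "X \<in> Obj C" using ab hom_obj fX by blast+
  obtain d where d: "d \<in> hom C V X"
    "\<And>U W s t. t \<in> hom C U V \<Longrightarrow> s \<in> hom C X W \<Longrightarrow> s \<cdot> (a \<cdot> t) = s \<cdot> (b \<cdot> t) \<longleftrightarrow> zero_arr C (s \<cdot> (d \<cdot> t))"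
    using diff_ex ab fX by metis
  have "zero_arr C (f \<cdot> d)"
    using d(2)[OF Ident_hom[OF V(1)] assms(1)] ab d(1) V by (simp add: hom_iff)
  then have "zero_arr C d" using assms(2) d(1) by blast
  then show "a = b"
    using d(2)[OF Ident_hom[OF V(1)] Ident_hom[OF V(2)]] ab d(1) V fX by (simp add: hom_iff)
qed (use assms in \<open>auto simp: hom_iff\<close>)

lemma kernel_zero_mono:
  assumes k: "is_kernel C f k" and "zero_arr C k"
  shows "mono_arr C f"
proof (rule monoI)
  note a = kernel_arr[OF k]
  show "f \<in> hom C (Dom C f) (Cod C f)" using a by (simp add: hom_iff)
  fix V g assume g: "g \<in> hom C V (Dom C f)" "zero_arr C (f \<cdot> g)"
  obtain u where "u \<in> hom C V (Dom C k)" "k \<cdot> u = g" using kernel_lift[OF k g] .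
  then show "zero_arr C g" using zero_arr_comp2[OF assms(2)] by (auto simp: hom_iff)
qed

end

section \<open>Abelian categories\<close>

locale abelian_cat = additive_cat C for C :: "('o, 'm, 'z) cat_scheme" (structure) +
  assumes abelian: "abelian C"

lemma abelian_catI: "abelian C \<Longrightarrow> abelian_cat C"
  by (simp add: abelian_cat_def additive_cat_def additive_cat_axioms_def abelian_cat_axioms_def
      abelian_def additive_def)

context abelian_cat
begin

lemma kernel_ex:
  assumes "f \<in> Arr C" obtains k where "is_kernel C f k"
  using abelian assms unfolding abelian_def by blast

lemma abelian_op: "abelian_cat (op_cat C)"
proof (rule abelian_catI)
  show "abelian (op_cat C)"
    using abelian additive_op unfolding abelian_def by simp
qed

lemma cokernel_ex:
  assumes "f \<in> Arr C" obtains k where "is_cokernel C f k"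
  using abelian assms unfolding abelian_def by blast

text \<open>By the axiom \<open>m\<close> is a kernel of some \<open>g\<close>. Since
  \<open>g\<close> kills \<open>m\<close> it factors through \<open>c\<close>, so whatever
  \<open>c\<close> kills is killed by \<open>g\<close> and lifts along \<open>m\<close>.\<close>

lemma mono_kernel_of_cokernel:
  assumes m: "mono_arr C m" and c: "is_cokernel C m c"
  shows "is_kernel C c m"
proof -
  obtain g where g: "is_kernel C g m" using abelian m unfolding abelian_def by blast
  note a = kernel_arr[OF g] and ca = cokernel_arr[OF c]
  obtain t where t: "t \<in> hom C (Cod C c) (Cod C g)" "t \<cdot> c = g"
    using cokernel_lift[OF c, of g "Cod C g"] a by (auto simp: hom_iff)
  show ?thesis
  proof (rule kernelI[OF _ _ m ca(4)])
    show "c \<in> hom C (Cod C m) (Cod C c)" "m \<in> hom C (Dom C m) (Cod C m)"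
      using ca by (simp_all add: hom_iff)
    fix V x assume x: "x \<in> hom C V (Cod C m)" "zero_arr C (c \<cdot> x)"
    have "zero_arr C (t \<cdot> (c \<cdot> x))"
      by (rule zero_arr_comp1[OF x(2)]) (use t x ca in \<open>simp_all add: hom_iff\<close>)
    moreover have "t \<cdot> (c \<cdot> x) = g \<cdot> x" using assoc_eq[OF t(2)] t(1) x(1) ca by (simp add: hom_iff)
    ultimately show "\<exists>u\<in>hom C V (Dom C m). m \<cdot> u = x"
      using kernel_lift[OF g, of x V] x a by (metis hom_iff)
  qed
qed

lemma epi_cokernel_of_kernel:
  assumes "epi_arr C e" "is_kernel C e k"
  shows "is_cokernel C k e"
  using abelian_cat.mono_kernel_of_cokernel[OF abelian_op, of e k] assms by simp

lemma epiI:
  assumes "f \<in> hom C X Y" "\<And>V g. g \<in> hom C Y V \<Longrightarrow> zero_arr C (g \<cdot> f) \<Longrightarrow> zero_arr C g"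
  shows "epi_arr C f"
proof -
  interpret op: abelian_cat "op_cat C" by (rule abelian_op)
  show ?thesis using op.monoI[of f Y X] assms by simp
qed

lemma mono_kernel_zero:
  assumes "mono_arr C f" "is_kernel C f k"
  shows "zero_obj C (Dom C k)"
proof -
  note a = kernel_arr[OF assms(2)]
  have zk: "zero_arr C k"
    by (rule zero_arr_cancel_mono[OF assms(1) _ a(4)]) (use a in \<open>simp add: hom_iff\<close>)
  have "zero_arr C (Ident C (Dom C k))"
    by (rule zero_arr_cancel_mono[OF kernel_mono[OF assms(2)], of _ "Dom C k"])
      (use zk a in \<open>simp_all add: hom_iff\<close>)
  then show ?thesis using a by (simp add: zero_obj_ident)
qed

lemma cokernel_zero_epi: "is_cokernel C f c \<Longrightarrow> zero_arr C c \<Longrightarrow> epi_arr C f"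
  using additive_cat.kernel_zero_mono[of "op_cat C" f c] abelian_op
  by (simp add: abelian_cat_def)

lemma epi_cokernel_zero: "epi_arr C f \<Longrightarrow> is_cokernel C f c \<Longrightarrow> zero_obj C (Cod C c)"
  using abelian_cat.mono_kernel_zero[OF abelian_op, of f c] by simp

lemma mono_epi_iso:
  assumes "mono_arr C f" "epi_arr C f"
  shows "iso C f"
proof -
  have f: "f \<in> Arr C" using assms by (simp add: mono_arr_def)
  obtain c where c: "is_cokernel C f c" using cokernel_ex[OF f] .
  have "zero_arr C c" using zero_arr_cod epi_cokernel_zero[OF assms(2) c] cokernel_arr[OF c] by blast
  then show ?thesis using kernel_of_zero_iso mono_kernel_of_cokernel[OF assms(1) c] by blast
qed

text \<open>Here \<open>e\<close> is the coimage of \<open>f\<close>, and the point is that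
  \<open>m\<close> is monic. If \<open>m\<close> kills \<open>t\<close>, then \<open>m\<close>
  factors through the cokernel \<open>c\<close> of \<open>t\<close>, so the kernel \<open>g\<close>
  of the epimorphism \<open>c \<cdot> e\<close> is killed by \<open>f\<close>, hence factors through
  \<open>k\<close> and is killed by \<open>e\<close>. As \<open>c \<cdot> e\<close> is the cokernel
  of \<open>g\<close>, it divides \<open>e\<close>; this makes \<open>c\<close> split monic, and
  \<open>c\<close> kills \<open>t\<close>.\<close>

lemma factorisation:
  assumes "f \<in> hom C X Y"
  obtains I e m where "e \<in> hom C X I" "m \<in> hom C I Y" "m \<cdot> e = f" "epi_arr C e" "mono_arr C m"
proof -
  have fa: "f \<in> Arr C" "Dom C f = X" "Cod C f = Y" using assms by (simp_all add: hom_iff)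
  obtain k where k: "is_kernel C f k" using kernel_ex fa by blast
  note ka = kernel_arr[OF k]
  obtain e where e: "is_cokernel C k e" using cokernel_ex ka by blast
  note ea = cokernel_arr[OF e]
  have eh: "e \<in> hom C X (Cod C e)" using ea ka fa by (simp add: hom_iff)
  obtain m where m: "m \<in> hom C (Cod C e) Y" "m \<cdot> e = f"
    using cokernel_lift[OF e, of f Y] ka(4) ka fa by (auto simp: hom_iff)
  have "mono_arr C m"
  proof (rule monoI[OF m(1)])
    fix V t assume t: "t \<in> hom C V (Cod C e)" "zero_arr C (m \<cdot> t)"
    obtain c where c: "is_cokernel C t c" using cokernel_ex t by (auto simp: hom_iff)
    note ca = cokernel_arr[OF c]
    have ch: "c \<in> hom C (Cod C e) (Cod C c)" using ca t by (simp add: hom_iff)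
    obtain n where n: "n \<in> hom C (Cod C c) Y" "n \<cdot> c = m"
      using cokernel_lift[OF c, of m Y] t m(1) by (auto simp: hom_iff)
    have ce: "epi_arr C (c \<cdot> e)"
      by (rule epi_comp[OF cokernel_epi[OF e] cokernel_epi[OF c]]) (use ch in \<open>simp add: hom_iff\<close>)
    obtain g where g: "is_kernel C (c \<cdot> e) g" using kernel_ex[OF _] ce by (auto simp: epi_arr_def)
    note ga = kernel_arr[OF g]
    have gh: "g \<in> hom C (Dom C g) X" using ga eh ch by (simp add: hom_iff)
    have "zero_arr C (n \<cdot> ((c \<cdot> e) \<cdot> g))"
      by (rule zero_arr_comp1[OF ga(4)]) (use n(1) gh eh ch in \<open>simp_all add: hom_iff\<close>)
    also have "n \<cdot> ((c \<cdot> e) \<cdot> g) = f \<cdot> g"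
      unfolding m(2)[symmetric] n(2)[symmetric] using n(1) gh eh ch by (simp add: hom_iff)
    finally obtain w where w: "w \<in> hom C (Dom C g) (Dom C k)" "k \<cdot> w = g"
      using kernel_lift[OF k, of g "Dom C g"] gh fa by auto
    have "zero_arr C ((e \<cdot> k) \<cdot> w)"
      by (rule zero_arr_comp2[OF ea(4)]) (use w(1) eh ka fa in \<open>simp_all add: hom_iff\<close>)
    also have "(e \<cdot> k) \<cdot> w = e \<cdot> g"
      unfolding w(2)[symmetric] using w(1) eh ka fa by (simp add: hom_iff)
    finally obtain y where y: "y \<in> hom C (Cod C c) (Cod C e)" "y \<cdot> (c \<cdot> e) = e"
      using cokernel_lift[OF epi_cokernel_of_kernel[OF ce g], of e "Cod C e"] gh eh ch
      by (auto simp: hom_iff)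
    have "y \<cdot> c = Ident C (Cod C e)"
      by (rule epiD[OF cokernel_epi[OF e], of _ _ "Cod C e"]) (use y eh ch in \<open>simp_all add: hom_iff\<close>)
    then have "mono_arr C c"
      using mono_of_comp[OF _ ch y(1)] iso_mono[OF iso_ident] eh hom_obj by metis
    then show "zero_arr C t" using zero_arr_cancel_mono ca(4) ch t(1) by (metis hom_iff)
  qed
  then show ?thesis using that[OF eh m cokernel_epi[OF e]] by blast
qed

text \<open>The jointly monic pair below is the pullback of \<open>e\<close> and \<open>f\<close>.\<close>

lemma epi_pullback:
  assumes e: "e \<in> hom C Y' Y" "epi_arr C e" and f: "f \<in> hom C X Y"
  obtains P e' f' where "e' \<in> hom C P X" "f' \<in> hom C P Y'" "f \<cdot> e' = e \<cdot> f'" "epi_arr C e'"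
    "\<And>V n. n \<in> hom C V P \<Longrightarrow> zero_arr C (e' \<cdot> n) \<Longrightarrow> zero_arr C (f' \<cdot> n) \<Longrightarrow> zero_arr C n"
proof -
  have ob: "X \<in> Obj C" "Y' \<in> Obj C" "Y \<in> Obj C" using e f hom_obj by blast+
  obtain B i j p q where B: "biproduct C X Y' B i j p q" using biproduct_ex[OF ob(1,2)] .
  note a = biproduct_arr[OF B]
  have Bo: "B \<in> Obj C" using a hom_obj by blast
  obtain d where d: "d \<in> hom C B Y" "\<And>V W s t. t \<in> hom C V B \<Longrightarrow> s \<in> hom C Y W \<Longrightarrow>
      s \<cdot> ((f \<cdot> p) \<cdot> t) = s \<cdot> ((e \<cdot> q) \<cdot> t) \<longleftrightarrow> zero_arr C (s \<cdot> (d \<cdot> t))"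
    using diff_ex[OF Comp_hom[OF a(3) f] Comp_hom[OF a(4) e(1)]] by metis
  \<comment> \<open>The arrow \<open>d\<close> is \<open>f \<cdot> p\<close> minus
    \<open>e \<cdot> q\<close>, so its kernel is the part of the biproduct on which the two
    agree.\<close>
  obtain k where k: "is_kernel C d k" using kernel_ex d by (auto simp: hom_iff)
  note ka = kernel_arr[OF k]
  have kh: "k \<in> hom C (Dom C k) B" using ka d by (simp add: hom_iff)
  have zpj: "zero_arr C (h \<cdot> (f \<cdot> p \<cdot> j))" if "h \<in> hom C Y W" for h W
  proof -
    have "zero_arr C ((h \<cdot> f) \<cdot> (p \<cdot> j))"
      by (rule zero_arr_comp1[OF a(8)]) (use a(1-4) f that in \<open>simp_all add: hom_iff\<close>)
    then show ?thesis using a(1-4) f that by (simp add: hom_iff)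
  qed
  \<comment> \<open>Up to sign \<open>d \<cdot> j\<close> is \<open>e\<close>, because
    \<open>p \<cdot> j\<close> is zero.\<close>
  have hdj: "zero_arr C (h \<cdot> e)" if h: "h \<in> hom C Y W" and z: "zero_arr C (h \<cdot> (d \<cdot> j))" for h W
  proof -
    have "h \<cdot> ((f \<cdot> p) \<cdot> j) = h \<cdot> ((e \<cdot> q) \<cdot> j)" using d(2)[OF a(2) h] z by simp
    moreover have "h \<cdot> ((e \<cdot> q) \<cdot> j) = h \<cdot> e" using a(1-4) e(1) h by (simp add: hom_iff a(6))
    ultimately show ?thesis using zpj[OF h] by simp
  qed
  have "epi_arr C d"
  proof (rule epiI[OF d(1)])
    fix V y assume y: "y \<in> hom C Y V" "zero_arr C (y \<cdot> d)"
    have "zero_arr C ((y \<cdot> d) \<cdot> j)"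
      by (rule zero_arr_comp2[OF y(2)]) (use a d(1) y(1) in \<open>simp_all add: hom_iff\<close>)
    then have "zero_arr C (y \<cdot> (d \<cdot> j))" using a(1-4) d(1) y(1) by (simp add: hom_iff)
    then show "zero_arr C y" using hdj[OF y(1)] zero_arr_cancel_epi[OF e(2)] y(1) e(1) by (metis hom_iff)
  qed
  then have cok: "is_cokernel C k d" using epi_cokernel_of_kernel k by blast
  have pk: "p \<cdot> k \<in> hom C (Dom C k) X" "q \<cdot> k \<in> hom C (Dom C k) Y'" using a kh Comp_hom by blast+
  show ?thesis
  proof (rule that[OF pk])
    show "f \<cdot> (p \<cdot> k) = e \<cdot> (q \<cdot> k)"
      using d(2)[OF kh Ident_hom[OF ob(3)]] ka(4) a(1-4) d(1) kh f e(1) by (simp add: hom_iff)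
    show "epi_arr C (p \<cdot> k)"
    proof (rule epiI[OF pk(1)])
      fix V g assume g: "g \<in> hom C X V" "zero_arr C (g \<cdot> (p \<cdot> k))"
      have "zero_arr C ((g \<cdot> p) \<cdot> k)" using g a(1-4) kh by (simp add: hom_iff)
      then obtain h where h: "h \<in> hom C Y V" "h \<cdot> d = g \<cdot> p"
        using cokernel_lift[OF cok, of "g \<cdot> p" V] g(1) a(1-4) kh d(1) by (auto simp: hom_iff)
      \<comment> \<open>Along \<open>j\<close> the arrow \<open>g \<cdot> p\<close> vanishes while
        \<open>h \<cdot> d\<close> becomes \<open>h \<cdot> e\<close> up to sign. So
        \<open>h\<close> is zero because \<open>e\<close> is epic, and restricting along
        \<open>i\<close> recovers \<open>g\<close>.\<close>
      have "zero_arr C (g \<cdot> (p \<cdot> j))"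
        by (rule zero_arr_comp1[OF a(8)]) (use a(1-4) g(1) in \<open>simp_all add: hom_iff\<close>)
      moreover have "g \<cdot> (p \<cdot> j) = h \<cdot> (d \<cdot> j)"
        using a(1-4) g(1) h(1) d(1) by (simp add: hom_iff assoc_eq[OF h(2)])
      ultimately have "zero_arr C (h \<cdot> (d \<cdot> j))" by simp
      then have "zero_arr C h" using hdj[OF h(1)] zero_arr_cancel_epi[OF e(2)] h(1) e(1) by (metis hom_iff)
      then have "zero_arr C (g \<cdot> p)" unfolding h(2)[symmetric]
        using h(1) d(1) by (intro zero_arr_comp2) (simp_all add: hom_iff)
      then have "zero_arr C ((g \<cdot> p) \<cdot> i)" 
        by (rule zero_arr_comp2) (use a g(1) in \<open>simp_all add: hom_iff\<close>)
      then show "zero_arr C g" using a(1-5) g(1) by (simp add: hom_iff a(5))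
    qed
    fix V n assume n: "n \<in> hom C V (Dom C k)" "zero_arr C (p \<cdot> k \<cdot> n)" "zero_arr C (q \<cdot> k \<cdot> n)"
    have kn: "k \<cdot> n \<in> hom C V B" using kh n Comp_hom by blast
    obtain z where z: "z \<in> hom C V B" "zero_arr C z" using zero_arr_ex hom_obj kn by metis
    have "k \<cdot> n = z"
    proof (rule biproduct_pair_eq[OF B kn z(1)])
      show "p \<cdot> (k \<cdot> n) = p \<cdot> z"
        by (rule zero_arr_unique[OF _ zero_arr_comp1[OF z(2)]])
          (use n a(1-4) kh z(1) in \<open>simp_all add: hom_iff\<close>)
      show "q \<cdot> (k \<cdot> n) = q \<cdot> z"
        by (rule zero_arr_unique[OF _ zero_arr_comp1[OF z(2)]])
          (use n a(1-4) kh z(1) in \<open>simp_all add: hom_iff\<close>)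
    qed
    then show "zero_arr C n" using zero_arr_cancel_mono[OF kernel_mono[OF k] n(1)] z by simp
  qed
qed

text \<open>The cokernel of \<open>f\<close> is the coimage of \<open>g\<close>.\<close>

lemma exact_at_op [simp]: "exact_at (op_cat C) g f \<longleftrightarrow> exact_at C f g"
proof
  assume "exact_at C f g"
  then obtain c k where ck: "is_cokernel C f c" "is_kernel C c k" "is_kernel C g k"
    unfolding exact_at_def by blast
  then show "exact_at (op_cat C) g f"
    unfolding exact_at_def using epi_cokernel_of_kernel[OF cokernel_epi[OF ck(1)] ck(2)] by auto
next
  assume "exact_at (op_cat C) g f"
  then obtain c k where ck: "is_kernel C g c" "is_cokernel C c k" "is_cokernel C f k"
    unfolding exact_at_def by auto
  then show "exact_at C f g"
    unfolding exact_at_def using mono_kernel_of_cokernel[OF kernel_mono[OF ck(1)] ck(2)] by auto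
qed

text \<open>Both \<open>f\<close> and its image \<open>k\<close> are kernels of the cokernel of
  \<open>f\<close>, so they differ by an isomorphism.\<close>

lemma exact_at_mono_iff:
  assumes "mono_arr C f"
  shows "exact_at C f g \<longleftrightarrow> is_kernel C g f"
proof
  assume "exact_at C f g"
  then obtain c k where ck: "is_cokernel C f c" "is_kernel C c k" "is_kernel C g k"
    unfolding exact_at_def by blast
  obtain u where u: "u \<in> hom C (Dom C f) (Dom C k)" "k \<cdot> u = f" "iso C u"
    using kernel_iso[OF ck(2) mono_kernel_of_cokernel[OF assms ck(1)]] .
  show "is_kernel C g f" using kernel_comp_iso[OF ck(3) u(1,3)] u(2) by simp
next
  assume g: "is_kernel C g f"
  obtain c where "is_cokernel C f c" using cokernel_ex kernel_arr(2)[OF g] .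
  then show "exact_at C f g" using g mono_kernel_of_cokernel[OF assms] unfolding exact_at_def by blast
qed

text \<open>The cokernel of a zero arrow is invertible, so its kernel, which is also the kernel of
  \<open>g\<close>, is zero.\<close>

lemma exact_at_zero_left:
  assumes "exact_at C f g" "zero_arr C f"
  shows "mono_arr C g"
proof -
  obtain c k where ck: "is_cokernel C f c" "is_kernel C c k" "is_kernel C g k"
    using assms(1) unfolding exact_at_def by blast
  have "mono_arr C c" using cokernel_of_zero_iso[OF ck(1) assms(2)] iso_mono by blast
  then have "zero_obj C (Dom C k)" using mono_kernel_zero ck(2) by blast
  then show ?thesis using kernel_zero_mono[OF ck(3)] zero_arr_dom kernel_arr[OF ck(3)] by blast
qed

lemma exact_at_zero_right:
  assumes "exact_at C f g" "zero_arr C g"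
  shows "epi_arr C f"
  using abelian_cat.exact_at_zero_left[OF abelian_op, of g f] assms by simp

lemma exact_at_zero_leftI:
  assumes "mono_arr C g" "zero_arr C f" "Cod C f = Dom C g"
  shows "exact_at C f g"
proof -
  have g: "g \<in> Arr C" using assms by (simp add: mono_arr_def)
  obtain Z where Z: "zero_obj C Z" using zero_obj_ex .
  obtain z where z: "z \<in> hom C Z (Dom C g)" using zero_obj_hom_ex[OF Z] g arr_obj by metis
  show ?thesis unfolding exact_at_def
    using cokernel_zero_arr[OF assms(2)] assms(3) g kernel_zero_dom_mono_trivial[OF assms(1) Z z]
      kernel_zero_dom_mono_trivial[OF iso_mono[OF iso_ident], of "Dom C g" Z z] Z z by auto
qed

end

text \<open>Needed because exact triangles of the Verdier quotient are only isomorphic to images of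
  exact triangles. The cokernel of \<open>f\<close> is transported along the first square, and the
  shared kernel moves along \<open>b\<close>.\<close>

lemma (in category) exact_at_iso:
  assumes e: "exact_at C f g" and b: "b \<in> hom C (Cod C f) Y" "iso C b"
    and a: "a \<in> hom C (Dom C f) X" "iso C a" and c: "c \<in> hom C (Cod C g) Z" "iso C c"
    and f': "f' \<in> hom C X Y" "b \<cdot> f = f' \<cdot> a" and g': "g' \<in> hom C Y Z" "c \<cdot> g = g' \<cdot> b"
  shows "exact_at C f' g'"
proof -
  obtain d k where dk: "is_cokernel C f d" "is_kernel C d k" "is_kernel C g k"
    using e unfolding exact_at_def by blast
  obtain u where u: "is_cokernel C f' u" "u \<cdot> b = d"
    using cokernel_transport[OF dk(1) b a f'] .
  have d: "Dom C d = Cod C f" "Cod C k = Dom C d" "Cod C k = Dom C g"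
    using cokernel_arr[OF dk(1)] kernel_arr[OF dk(2)] kernel_arr[OF dk(3)] by simp_all
  have "is_kernel C u (b \<cdot> k)"
  proof (rule kernel_pre_iso)
    show "is_kernel C (u \<cdot> b) k" using u dk by simp
    show "b \<in> hom C (Cod C f) (Dom C u)" "iso C b" "u \<in> Arr C"
      using b cokernel_arr[OF u(1)] f' by (simp_all add: hom_iff)
  qed
  moreover have "is_kernel C g' (b \<cdot> k)"
    by (rule kernel_transport[OF dk(3) _ b(2) c g']) (use b d in simp)
  ultimately show ?thesis using u unfolding exact_at_def by blast
qed

section \<open>Functors and natural isomorphisms\<close>

lemma functorD:
  assumes "is_functor C D F"
  shows "category C" "category D"
    "X \<in> Obj C \<Longrightarrow> fobj F X \<in> Obj D"
    "f \<in> hom C X Y \<Longrightarrow> fmor F f \<in> hom D (fobj F X) (fobj F Y)"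
    "X \<in> Obj C \<Longrightarrow> fmor F (Ident C X) = Ident D (fobj F X)"
    "f \<in> hom C X Y \<Longrightarrow> g \<in> hom C Y Z \<Longrightarrow> fmor F (g \<cdot>\<^bsub>C\<^esub> f) = fmor F g \<cdot>\<^bsub>D\<^esub> fmor F f"
  using assms unfolding is_functor_def by (auto simp: hom_iff)

lemma functor_arr:
  assumes "is_functor C D F" "f \<in> Arr C"
  shows "fmor F f \<in> Arr D" "Dom D (fmor F f) = fobj F (Dom C f)" "Cod D (fmor F f) = fobj F (Cod C f)"
  using functorD(4)[OF assms(1), of f "Dom C f" "Cod C f"] assms(2) by (simp_all add: hom_iff)

lemma functor_op: "is_functor C D F \<Longrightarrow> is_functor (op_cat C) (op_cat D) F"
  unfolding is_functor_def by (auto intro: category_op_iff)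

lemma functor_iso:
  assumes F: "is_functor C D F" and f: "f \<in> hom C X Y" "iso C f"
  shows "iso D (fmor F f)"
proof -
  interpret C: category C by (rule functorD(1)[OF F])
  interpret D: category D by (rule functorD(2)[OF F])
  obtain g where g: "g \<in> hom C Y X" "g \<cdot>\<^bsub>C\<^esub> f = Ident C X" "f \<cdot>\<^bsub>C\<^esub> g = Ident C Y"
    using C.isoE[OF f(2,1)] by metis
  show ?thesis
    using D.isoI[OF functorD(4)[OF F f(1)] functorD(4)[OF F g(1)]] functorD(5,6)[OF F] f g
      C.hom_obj[OF f(1)] by metis
qed

lemma fcomp_simps [simp]: "fobj (G \<circ>\<^sub>F F) X = fobj G (fobj F X)" "fmor (G \<circ>\<^sub>F F) f = fmor G (fmor F f)"
  by (simp_all add: fcomp_def)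

lemma id_fctr_simps [simp]: "fobj id_fctr X = X" "fmor id_fctr f = f"
  by (simp_all add: id_fctr_def)

lemma is_functor_comp:
  assumes F: "is_functor C D F" and G: "is_functor D E G"
  shows "is_functor C E (G \<circ>\<^sub>F F)"
  unfolding is_functor_def
proof (intro conjI ballI impI)
  fix f g assume "f \<in> Arr C" "g \<in> Arr C" "Cod C f = Dom C g"
  then have fg: "f \<in> hom C (Dom C f) (Cod C f)" "g \<in> hom C (Cod C f) (Cod C g)" by (simp_all add: hom_iff)
  then show "fmor (G \<circ>\<^sub>F F) (g \<cdot>\<^bsub>C\<^esub> f) = fmor (G \<circ>\<^sub>F F) g \<cdot>\<^bsub>E\<^esub> fmor (G \<circ>\<^sub>F F) f"
    using functorD(6)[OF F fg] functorD(6)[OF G functorD(4)[OF F fg(1)] functorD(4)[OF F fg(2)]] by simp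
next
  fix f assume "f \<in> Arr C"
  then have "f \<in> hom C (Dom C f) (Cod C f)" by (simp add: hom_iff)
  then show "fmor (G \<circ>\<^sub>F F) f \<in> hom E (fobj (G \<circ>\<^sub>F F) (Dom C f)) (fobj (G \<circ>\<^sub>F F) (Cod C f))"
    using functorD(4)[OF F] functorD(4)[OF G] by simp
qed (use functorD[OF F] functorD[OF G] in simp_all)

lemma is_functor_id: "category C \<Longrightarrow> is_functor C C id_fctr"
  unfolding is_functor_def by (auto simp: hom_iff)

section \<open>Natural isomorphisms\<close>

lemma nat_isomorphicE:
  assumes "nat_isomorphic C D F G"
  obtains \<eta> where "nat_trans C D F G \<eta>" "\<And>X. X \<in> Obj C \<Longrightarrow> iso D (\<eta> X)"
    "\<And>X. X \<in> Obj C \<Longrightarrow> \<eta> X \<in> hom D (fobj F X) (fobj G X)"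
    "\<And>f X Y. f \<in> hom C X Y \<Longrightarrow> \<eta> Y \<cdot>\<^bsub>D\<^esub> fmor F f = fmor G f \<cdot>\<^bsub>D\<^esub> \<eta> X"
  using assms unfolding nat_isomorphic_def nat_trans_def by (auto simp: hom_iff)

lemma nat_isomorphicI:
  assumes "\<And>X. X \<in> Obj C \<Longrightarrow> iso D (\<eta> X)"
    "\<And>X. X \<in> Obj C \<Longrightarrow> \<eta> X \<in> hom D (fobj F X) (fobj G X)"
    "\<And>f X Y. f \<in> hom C X Y \<Longrightarrow> \<eta> Y \<cdot>\<^bsub>D\<^esub> fmor F f = fmor G f \<cdot>\<^bsub>D\<^esub> \<eta> X"
  shows "nat_isomorphic C D F G"
  unfolding nat_isomorphic_def nat_trans_def using assms by (intro exI[of _ \<eta>]) (auto simp: hom_iff)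

text \<open>Functors carry arbitrary values outside the carriers, so agreement on the carriers gives
  an isomorphism with identity components rather than an equation.\<close>

lemma nat_isomorphic_agree:
  assumes F: "is_functor C D F"
    and "\<And>X. X \<in> Obj C \<Longrightarrow> fobj F X = fobj G X" "\<And>f. f \<in> Arr C \<Longrightarrow> fmor F f = fmor G f"
  shows "nat_isomorphic C D F G"
proof -
  interpret C: category C by (rule functorD(1)[OF F])
  interpret D: category D by (rule functorD(2)[OF F])
  show ?thesis
  proof (rule nat_isomorphicI[of _ _ "\<lambda>X. Ident D (fobj F X)"])
    fix f X Y assume f: "f \<in> hom C X Y"
    show "Ident D (fobj F Y) \<cdot>\<^bsub>D\<^esub> fmor F f = fmor G f \<cdot>\<^bsub>D\<^esub> Ident D (fobj F X)"
      using functorD(4)[OF F f] assms(3)[of f] f by (simp add: hom_iff)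
  qed (use functorD(3)[OF F] assms(2) D.Ident_hom in auto)
qed

lemma nat_isomorphic_trans:
  assumes F: "is_functor C D F" and G: "is_functor C D G" and H: "is_functor C D H"
    and n: "nat_isomorphic C D F G" "nat_isomorphic C D G H"
  shows "nat_isomorphic C D F H"
proof -
  interpret C: category C by (rule functorD(1)[OF F])
  interpret D: category D by (rule functorD(2)[OF F])
  obtain \<eta> where e: "\<And>X. X \<in> Obj C \<Longrightarrow> iso D (\<eta> X)"
    "\<And>X. X \<in> Obj C \<Longrightarrow> \<eta> X \<in> hom D (fobj F X) (fobj G X)"
    "\<And>f X Y. f \<in> hom C X Y \<Longrightarrow> \<eta> Y \<cdot>\<^bsub>D\<^esub> fmor F f = fmor G f \<cdot>\<^bsub>D\<^esub> \<eta> X"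
    using nat_isomorphicE[OF n(1)] by metis
  obtain \<theta> where t: "\<And>X. X \<in> Obj C \<Longrightarrow> iso D (\<theta> X)"
    "\<And>X. X \<in> Obj C \<Longrightarrow> \<theta> X \<in> hom D (fobj G X) (fobj H X)"
    "\<And>f X Y. f \<in> hom C X Y \<Longrightarrow> \<theta> Y \<cdot>\<^bsub>D\<^esub> fmor G f = fmor H f \<cdot>\<^bsub>D\<^esub> \<theta> X"
    using nat_isomorphicE[OF n(2)] by metis
  show ?thesis
  proof (rule nat_isomorphicI[of _ _ "\<lambda>X. \<theta> X \<cdot>\<^bsub>D\<^esub> \<eta> X"])
    fix X assume X: "X \<in> Obj C"
    show "iso D (\<theta> X \<cdot>\<^bsub>D\<^esub> \<eta> X)"
      by (rule D.iso_comp[OF e(1)[OF X] t(1)[OF X]]) (use e(2)[OF X] t(2)[OF X] in \<open>simp add: hom_iff\<close>)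
    show "\<theta> X \<cdot>\<^bsub>D\<^esub> \<eta> X \<in> hom D (fobj F X) (fobj H X)"
      by (rule D.Comp_hom[OF e(2)[OF X] t(2)[OF X]])
  next
    fix f X Y assume f: "f \<in> hom C X Y"
    note X = C.hom_obj(1)[OF f] and Y = C.hom_obj(2)[OF f]
    note h = functorD(4)[OF F f] functorD(4)[OF G f] functorD(4)[OF H f] e(2)[OF X] e(2)[OF Y]
      t(2)[OF X] t(2)[OF Y]
    show "\<theta> Y \<cdot>\<^bsub>D\<^esub> \<eta> Y \<cdot>\<^bsub>D\<^esub> fmor F f = fmor H f \<cdot>\<^bsub>D\<^esub> (\<theta> X \<cdot>\<^bsub>D\<^esub> \<eta> X)"
      using h by (simp add: hom_iff e(3)[OF f] D.assoc_eq[OF t(3)[OF f]])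
  qed
qed

lemma nat_isomorphic_post:
  assumes F: "is_functor C D F" and G: "is_functor C D G" and n: "nat_isomorphic C D F G"
    and K: "is_functor D E K"
  shows "nat_isomorphic C E (K \<circ>\<^sub>F F) (K \<circ>\<^sub>F G)"
proof -
  interpret C: category C by (rule functorD(1)[OF F])
  obtain \<eta> where e: "\<And>X. X \<in> Obj C \<Longrightarrow> iso D (\<eta> X)"
    "\<And>X. X \<in> Obj C \<Longrightarrow> \<eta> X \<in> hom D (fobj F X) (fobj G X)"
    "\<And>f X Y. f \<in> hom C X Y \<Longrightarrow> \<eta> Y \<cdot>\<^bsub>D\<^esub> fmor F f = fmor G f \<cdot>\<^bsub>D\<^esub> \<eta> X"
    using nat_isomorphicE[OF n] by metis
  show ?thesis
  proof (rule nat_isomorphicI[of _ _ "\<lambda>X. fmor K (\<eta> X)"])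
    fix f X Y assume f: "f \<in> hom C X Y"
    note X = C.hom_obj(1)[OF f] and Y = C.hom_obj(2)[OF f]
    show "fmor K (\<eta> Y) \<cdot>\<^bsub>E\<^esub> fmor (K \<circ>\<^sub>F F) f = fmor (K \<circ>\<^sub>F G) f \<cdot>\<^bsub>E\<^esub> fmor K (\<eta> X)"
      using functorD(6)[OF K functorD(4)[OF F f] e(2)[OF Y]]
        functorD(6)[OF K e(2)[OF X] functorD(4)[OF G f]] e(3)[OF f] by simp
  qed (use functor_iso[OF K e(2,1)] functorD(4)[OF K e(2)] in simp_all)
qed

lemma nat_isomorphic_pre:
  assumes n: "nat_isomorphic D E F G" and K: "is_functor C D K"
  shows "nat_isomorphic C E (F \<circ>\<^sub>F K) (G \<circ>\<^sub>F K)"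
proof -
  obtain \<eta> where e: "\<And>X. X \<in> Obj D \<Longrightarrow> iso E (\<eta> X)"
    "\<And>X. X \<in> Obj D \<Longrightarrow> \<eta> X \<in> hom E (fobj F X) (fobj G X)"
    "\<And>f X Y. f \<in> hom D X Y \<Longrightarrow> \<eta> Y \<cdot>\<^bsub>E\<^esub> fmor F f = fmor G f \<cdot>\<^bsub>E\<^esub> \<eta> X"
    using nat_isomorphicE[OF n] by metis
  show ?thesis
    by (rule nat_isomorphicI[of _ _ "\<lambda>X. \<eta> (fobj K X)"]) (use e functorD(3,4)[OF K] in auto)
qed

section \<open>Equivalences of categories\<close>

lemma equivalence_ess_surj:
  assumes "is_equivalence C D P" "Y \<in> Obj D"
  obtains X \<phi> where "X \<in> Obj C" "\<phi> \<in> hom D (fobj P X) Y" "iso D \<phi>"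
proof -
  obtain G where G: "is_functor D C G" "nat_isomorphic D D (P \<circ>\<^sub>F G) id_fctr"
    using assms(1) unfolding is_equivalence_def by blast
  then show ?thesis
    using that functorD(3)[OF G(1) assms(2)] nat_isomorphicE[OF G(2)] assms(2)
    by (metis fcomp_simps(1) id_fctr_simps(1))
qed

text \<open>The preimage is \<open>G\<close> applied to \<open>g\<close>, conjugated by
  \<open>\<eta>\<close>. By naturality of \<open>\<eta>\<close> its image under \<open>P\<close> and
  \<open>g\<close> itself become equal under \<open>G\<close>; naturality of \<open>\<theta>\<close>
  then removes \<open>G\<close>, since \<open>\<theta>\<close> is invertible.\<close>

lemma equivalence_full:
  assumes P: "is_equivalence C D P" and "X \<in> Obj C" "Y \<in> Obj C" "g \<in> hom D (fobj P X) (fobj P Y)"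
  obtains f where "f \<in> hom C X Y" "fmor P f = g"
proof -
  have PF: "is_functor C D P" using P unfolding is_equivalence_def by blast
  obtain G where G: "is_functor D C G" "nat_isomorphic C C (G \<circ>\<^sub>F P) id_fctr"
      "nat_isomorphic D D (P \<circ>\<^sub>F G) id_fctr"
    using P unfolding is_equivalence_def by blast
  interpret C: category C by (rule functorD(1)[OF PF])
  interpret D: category D by (rule functorD(2)[OF PF])
  obtain \<eta> where e: "\<And>X. X \<in> Obj C \<Longrightarrow> iso C (\<eta> X)"
    "\<And>X. X \<in> Obj C \<Longrightarrow> \<eta> X \<in> hom C (fobj G (fobj P X)) X"
    "\<And>f X Y. f \<in> hom C X Y \<Longrightarrow> \<eta> Y \<cdot>\<^bsub>C\<^esub> fmor G (fmor P f) = f \<cdot>\<^bsub>C\<^esub> \<eta> X"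
    using nat_isomorphicE[OF G(2)] unfolding fcomp_simps id_fctr_simps by metis
  obtain \<theta> where t: "\<And>X. X \<in> Obj D \<Longrightarrow> iso D (\<theta> X)"
    "\<And>X. X \<in> Obj D \<Longrightarrow> \<theta> X \<in> hom D (fobj P (fobj G X)) X"
    "\<And>f X Y. f \<in> hom D X Y \<Longrightarrow> \<theta> Y \<cdot>\<^bsub>D\<^esub> fmor P (fmor G f) = f \<cdot>\<^bsub>D\<^esub> \<theta> X"
    using nat_isomorphicE[OF G(3)] unfolding fcomp_simps id_fctr_simps by metis
  obtain i where i: "i \<in> hom C X (fobj G (fobj P X))" "i \<cdot>\<^bsub>C\<^esub> \<eta> X = Ident C (fobj G (fobj P X))"
    using C.isoE[OF e(1)[OF assms(2)] e(2)[OF assms(2)]] by metis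
  note gg = functorD(4)[OF G(1) assms(4)]
  let ?f = "\<eta> Y \<cdot>\<^bsub>C\<^esub> (fmor G g \<cdot>\<^bsub>C\<^esub> i)"
  have f: "?f \<in> hom C X Y" using C.Comp_hom[OF C.Comp_hom[OF i(1) gg] e(2)[OF assms(3)]] .
  note pf = functorD(4)[OF PF f] and gpf = functorD(4)[OF G(1) functorD(4)[OF PF f]]
  have "\<eta> Y \<cdot>\<^bsub>C\<^esub> fmor G (fmor P ?f) = \<eta> Y \<cdot>\<^bsub>C\<^esub> fmor G g"
    unfolding e(3)[OF f] using e(2)[OF assms(2)] e(2)[OF assms(3)] gg i(1) by (simp add: hom_iff i(2))
  then have eq: "fmor G (fmor P ?f) = fmor G g"
    by (rule C.monoD[OF C.iso_mono[OF e(1)[OF assms(3)]], of _ _ "fobj G (fobj P X)"])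
      (use gg gpf e(2)[OF assms(3)] in \<open>simp_all add: hom_iff\<close>)
  have PX: "fobj P X \<in> Obj D" using functorD(3)[OF PF assms(2)] .
  have "fmor P ?f = g"
    by (rule D.epiD[OF D.iso_epi[OF t(1)[OF PX]], of _ _ "fobj P Y"])
      (use pf assms(4) t(2)[OF PX] t(3)[OF pf] t(3)[OF assms(4)] eq in \<open>simp_all add: hom_iff\<close>)
  then show ?thesis using that f by blast
qed

text \<open>Only the existence of an isomorphism matters, so the image of \<open>g\<close> under the
  quasi-inverse \<open>G\<close>, conjugated by \<open>\<eta>\<close>, is enough.\<close>

lemma equivalence_reflects_iso_objects:
  assumes P: "is_equivalence C D P" and X: "X \<in> Obj C" "Y \<in> Obj C"
    and g: "g \<in> hom D (fobj P X) (fobj P Y)" "iso D g"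
  obtains f where "f \<in> hom C X Y" "iso C f"
proof -
  have PF: "is_functor C D P" using P unfolding is_equivalence_def by blast
  obtain G where G: "is_functor D C G" "nat_isomorphic C C (G \<circ>\<^sub>F P) id_fctr"
    using P unfolding is_equivalence_def by blast
  interpret C: category C by (rule functorD(1)[OF PF])
  obtain \<eta> where e: "\<And>X. X \<in> Obj C \<Longrightarrow> iso C (\<eta> X)"
    "\<And>X. X \<in> Obj C \<Longrightarrow> \<eta> X \<in> hom C (fobj G (fobj P X)) X"
    using nat_isomorphicE[OF G(2)] by (metis fcomp_simps id_fctr_simps)
  obtain i where i: "i \<in> hom C X (fobj G (fobj P X))" "iso C i"
    using C.isoE[OF e(1)[OF X(1)] e(2)[OF X(1)]] by metis
  note gg = functorD(4)[OF G(1) g(1)]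
  show ?thesis
  proof (rule that[of "\<eta> Y \<cdot>\<^bsub>C\<^esub> (fmor G g \<cdot>\<^bsub>C\<^esub> i)"])
    show "\<eta> Y \<cdot>\<^bsub>C\<^esub> (fmor G g \<cdot>\<^bsub>C\<^esub> i) \<in> hom C X Y" using e(2)[OF X(2)] gg i(1) C.Comp_hom by blast
    show "iso C (\<eta> Y \<cdot>\<^bsub>C\<^esub> (fmor G g \<cdot>\<^bsub>C\<^esub> i))"
      using e[OF X(2)] gg i functor_iso[OF G(1) g] by (intro C.iso_comp) (simp_all add: hom_iff)
  qed
qed

section \<open>Isomorphisms in functor categories\<close>

lemma functor_cat_arr_iff:
  "(F, \<eta>, G) \<in> hom (full_subcat (functor_cat C D) P) F' G' \<longleftrightarrow> F = F' \<and> G = G' \<and>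
    is_functor C D F \<and> is_functor C D G \<and> P F \<and> P G \<and> nat_trans C D F G \<eta> \<and> \<eta> \<in> extensional (Obj C)"
  by (auto simp: hom_iff full_subcat_def functor_cat_def)

text \<open>The universal property of the abelianisation speaks of isomorphisms in a full
  subcategory of a functor category, the rest of the argument of invertible natural families; this
  translates between the two.\<close>

lemma functor_cat_iso_iff:
  assumes "is_functor C D F" "is_functor C D G" "P F" "P G"
  shows "(\<exists>\<phi>. \<phi> \<in> hom (full_subcat (functor_cat C D) P) F G \<and> iso (full_subcat (functor_cat C D) P) \<phi>)
    \<longleftrightarrow> nat_isomorphic C D F G"
proof -
  let ?E = "full_subcat (functor_cat C D) P"
  interpret C: category C by (rule functorD(1)[OF assms(1)])
  interpret D: category D by (rule functorD(2)[OF assms(1)])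
  have comp: "(G, \<theta>, H) \<cdot>\<^bsub>?E\<^esub> (F, \<eta>, G) = (F, \<lambda>X \<in> Obj C. \<theta> X \<cdot>\<^bsub>D\<^esub> \<eta> X, H)" for F G H \<theta> \<eta>
    by (simp add: full_subcat_def functor_cat_def)
  have idn: "Ident ?E F = (F, \<lambda>X \<in> Obj C. Ident D (fobj F X), F)" for F
    by (simp add: full_subcat_def functor_cat_def)
  show ?thesis
  proof
    assume "\<exists>\<phi>. \<phi> \<in> hom ?E F G \<and> iso ?E \<phi>"
    then obtain F' \<eta> G' where "(F', \<eta>, G') \<in> hom ?E F G" "iso ?E (F', \<eta>, G')" by auto
    then have e: "(F, \<eta>, G) \<in> hom ?E F G" "iso ?E (F, \<eta>, G)" by (auto simp: functor_cat_arr_iff)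
    then have n: "nat_trans C D F G \<eta>" by (auto simp: functor_cat_arr_iff)
    obtain \<psi> where psi: "\<psi> \<in> hom ?E G F" "\<psi> \<cdot>\<^bsub>?E\<^esub> (F, \<eta>, G) = Ident ?E F" "(F, \<eta>, G) \<cdot>\<^bsub>?E\<^esub> \<psi> = Ident ?E G"
      using e(2) e(1)[unfolded hom_iff] unfolding iso_def is_inverse_def by metis
    obtain G' \<theta> F' where "\<psi> = (G', \<theta>, F')" by (cases \<psi>)
    with psi(1) have psi': "\<psi> = (G, \<theta>, F)" "nat_trans C D G F \<theta>" by (auto simp: functor_cat_arr_iff)
    have r: "(\<lambda>X \<in> Obj C. \<theta> X \<cdot>\<^bsub>D\<^esub> \<eta> X) = (\<lambda>X \<in> Obj C. Ident D (fobj F X))"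
      "(\<lambda>X \<in> Obj C. \<eta> X \<cdot>\<^bsub>D\<^esub> \<theta> X) = (\<lambda>X \<in> Obj C. Ident D (fobj G X))"
      using psi(2,3) unfolding psi'(1) comp idn by simp_all
    have "\<theta> X \<cdot>\<^bsub>D\<^esub> \<eta> X = Ident D (fobj F X)" "\<eta> X \<cdot>\<^bsub>D\<^esub> \<theta> X = Ident D (fobj G X)"
      if "X \<in> Obj C" for X
      using fun_cong[OF r(1), of X] fun_cong[OF r(2), of X] that by simp_all
    then have "iso D (\<eta> X)" if "X \<in> Obj C" for X
      using D.isoI[of "\<eta> X" "fobj F X" "fobj G X" "\<theta> X"] n psi'(2) that unfolding nat_trans_def by simp
    then show "nat_isomorphic C D F G" using n unfolding nat_isomorphic_def by blast
  next
    assume "nat_isomorphic C D F G"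
    then obtain \<eta> where e: "\<And>X. X \<in> Obj C \<Longrightarrow> iso D (\<eta> X)"
      "\<And>X. X \<in> Obj C \<Longrightarrow> \<eta> X \<in> hom D (fobj F X) (fobj G X)"
      "\<And>f X Y. f \<in> hom C X Y \<Longrightarrow> \<eta> Y \<cdot>\<^bsub>D\<^esub> fmor F f = fmor G f \<cdot>\<^bsub>D\<^esub> \<eta> X"
      using nat_isomorphicE by metis
    \<comment> \<open>Inverses are chosen componentwise; their naturality comes from conjugating
      that of \<open>\<eta>\<close>.\<close>
    define \<theta> where "\<theta> X = (SOME g. g \<in> hom D (fobj G X) (fobj F X) \<and>
      g \<cdot>\<^bsub>D\<^esub> \<eta> X = Ident D (fobj F X) \<and> \<eta> X \<cdot>\<^bsub>D\<^esub> g = Ident D (fobj G X))" for X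
    have t: "\<theta> X \<in> hom D (fobj G X) (fobj F X)" "\<theta> X \<cdot>\<^bsub>D\<^esub> \<eta> X = Ident D (fobj F X)"
       "\<eta> X \<cdot>\<^bsub>D\<^esub> \<theta> X = Ident D (fobj G X)" if "X \<in> Obj C" for X
    proof -
      have "\<exists>g. g \<in> hom D (fobj G X) (fobj F X) \<and>
        g \<cdot>\<^bsub>D\<^esub> \<eta> X = Ident D (fobj F X) \<and> \<eta> X \<cdot>\<^bsub>D\<^esub> g = Ident D (fobj G X)"
        using D.isoE[OF e(1)[OF that] e(2)[OF that]] by metis
      from someI_ex[OF this] show "\<theta> X \<in> hom D (fobj G X) (fobj F X)"
         "\<theta> X \<cdot>\<^bsub>D\<^esub> \<eta> X = Ident D (fobj F X)" "\<eta> X \<cdot>\<^bsub>D\<^esub> \<theta> X = Ident D (fobj G X)"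
        unfolding \<theta>_def by blast+
    qed
    have nat: "\<theta> Y \<cdot>\<^bsub>D\<^esub> fmor G f = fmor F f \<cdot>\<^bsub>D\<^esub> \<theta> X" if f: "f \<in> hom C X Y" for f X Y
    proof -
      note X = C.hom_obj(1)[OF f] and Y = C.hom_obj(2)[OF f]
      note h = functorD(4)[OF assms(1) f] functorD(4)[OF assms(2) f] e(2)[OF X] e(2)[OF Y]
        t(1)[OF X] t(1)[OF Y]
      have "\<theta> Y \<cdot>\<^bsub>D\<^esub> fmor G f = \<theta> Y \<cdot>\<^bsub>D\<^esub> (fmor G f \<cdot>\<^bsub>D\<^esub> \<eta> X) \<cdot>\<^bsub>D\<^esub> \<theta> X"
        using h by (simp add: hom_iff t(3)[OF X])
      also have "\<dots> = fmor F f \<cdot>\<^bsub>D\<^esub> \<theta> X"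
        unfolding e(3)[OF f, symmetric] using h by (simp add: hom_iff D.assoc_eq[OF t(2)[OF Y]])
      finally show ?thesis .
    qed
    \<comment> \<open>Arrows of the functor category have extensional components, so both families
      are cut down to the objects of \<open>C\<close>.\<close>
    let ?e = "restrict \<eta> (Obj C)" and ?t = "restrict \<theta> (Obj C)"
    have "nat_trans C D F G ?e" "nat_trans C D G F ?t"
      unfolding nat_trans_def using e(2,3) t(1) nat C.arr_obj by (auto simp: hom_iff)
    then have "(F, ?e, G) \<in> hom ?E F G" "(G, ?t, F) \<in> hom ?E G F"
      using assms by (auto simp: functor_cat_arr_iff)
    moreover have "(G, ?t, F) \<cdot>\<^bsub>?E\<^esub> (F, ?e, G) = Ident ?E F" "(F, ?e, G) \<cdot>\<^bsub>?E\<^esub> (G, ?t, F) = Ident ?E G"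
      unfolding comp idn using t(2,3) by (auto simp: restrict_def)
    ultimately have "iso ?E (F, ?e, G)" unfolding iso_def is_inverse_def hom_iff by metis
    then show "\<exists>\<phi>. \<phi> \<in> hom ?E F G \<and> iso ?E \<phi>" using \<open>(F, ?e, G) \<in> hom ?E F G\<close> by blast
  qed
qed

section \<open>Exact functors\<close>

lemma exact_functorD: "exact_functor A B F \<Longrightarrow> is_functor A B F"
  "exact_functor A B F \<Longrightarrow> exact_at A f g \<Longrightarrow> exact_at B (fmor F f) (fmor F g)"
  by (simp_all add: exact_functor_def)

lemma exact_functor_comp:
  "exact_functor A B F \<Longrightarrow> exact_functor B D G \<Longrightarrow> exact_functor A D (G \<circ>\<^sub>F F)"
  unfolding exact_functor_def by (auto intro: is_functor_comp)

lemma exact_functor_id: "category A \<Longrightarrow> exact_functor A A id_fctr"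
  unfolding exact_functor_def by (auto intro: is_functor_id)

lemma exact_functor_op:
  assumes "abelian_cat A" "abelian_cat B" "exact_functor A B F"
  shows "exact_functor (op_cat A) (op_cat B) F"
  using assms(3) abelian_cat.exact_at_op[OF assms(1)] abelian_cat.exact_at_op[OF assms(2)]
  unfolding exact_functor_def by (auto intro: functor_op)

text \<open>Exactness makes the composite of the two identities zero. This expresses vanishing of an
  object by exactness alone, so that exact and cohomological functors preserve it without being
  known to be additive.\<close>

lemma (in abelian_cat) zero_obj_exact_ident:
  assumes "X \<in> Obj C" "exact_at C (Ident C X) (Ident C X)"
  shows "zero_obj C X"
proof -
  have "is_kernel C (Ident C X) (Ident C X)"
    using exact_at_mono_iff[OF iso_mono[OF iso_ident[OF assms(1)]]] assms(2) by blast
  from kernel_arr(4)[OF this] show ?thesis using assms(1) by (simp add: zero_obj_ident)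
qed

lemma exact_zero_obj:
  assumes A: "abelian_cat A" and B: "abelian_cat B" and F: "exact_functor A B F" and Z: "zero_obj A Z"
  shows "zero_obj B (fobj F Z)"
proof -
  interpret A: abelian_cat A by (rule A)
  interpret B: abelian_cat B by (rule B)
  have ZO: "Z \<in> Obj A" using Z by (simp add: zero_obj_def)
  have "exact_at A (Ident A Z) (Ident A Z)"
    by (rule A.exact_at_zero_leftI)
      (use ZO Z in \<open>simp_all add: A.iso_mono A.zero_obj_ident\<close>)
  then have "exact_at B (Ident B (fobj F Z)) (Ident B (fobj F Z))"
    using exact_functorD(2)[OF F] functorD(5)[OF exact_functorD(1)[OF F] ZO] by metis
  then show ?thesis
    using B.zero_obj_exact_ident functorD(3)[OF exact_functorD(1)[OF F] ZO] by blast
qed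

lemma exact_zero_arr:
  assumes A: "abelian_cat A" and B: "abelian_cat B" and F: "exact_functor A B F" and z: "zero_arr A z"
  shows "zero_arr B (fmor F z)"
proof -
  interpret A: abelian_cat A by (rule A)
  interpret B: abelian_cat B by (rule B)
  obtain Z a b where Z: "zero_obj A Z" "a \<in> hom A (Dom A z) Z" "b \<in> hom A Z (Cod A z)" "z = b \<cdot>\<^bsub>A\<^esub> a"
    using z unfolding zero_arr_def by blast
  note F' = exact_functorD(1)[OF F]
  show ?thesis
    using B.zero_arrI[OF exact_zero_obj[OF A B F Z(1)] functorD(4)[OF F' Z(2)] functorD(4)[OF F' Z(3)]]
      functorD(6)[OF F' Z(2,3)] Z(4) by metis
qed

text \<open>A kernel amounts to exactness at two places: of \<open>z\<close>, \<open>k\<close> with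
  \<open>z\<close> zero, which says that \<open>k\<close> is monic, and of \<open>k\<close>,
  \<open>f\<close>. Both are preserved.\<close>

lemma exact_kernel:
  assumes A: "abelian_cat A" and B: "abelian_cat B" and F: "exact_functor A B F" and k: "is_kernel A f k"
  shows "is_kernel B (fmor F f) (fmor F k)"
proof -
  interpret A: abelian_cat A by (rule A)
  interpret B: abelian_cat B by (rule B)
  note ka = A.kernel_arr[OF k]
  obtain Z where Z: "zero_obj A Z" using A.zero_obj_ex .
  obtain z where z: "z \<in> hom A Z (Dom A k)" using A.zero_obj_hom_ex[OF Z] ka(2) A.arr_obj by metis
  have "zero_arr A z" using A.zero_arr_dom Z z by (simp add: hom_iff)
  moreover have "exact_at A z k"
    by (rule A.exact_at_zero_leftI[OF A.kernel_mono[OF k]])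
      (use z Z A.zero_arr_dom in \<open>simp_all add: hom_iff\<close>)
  ultimately have "mono_arr B (fmor F k)"
    using B.exact_at_zero_left exact_zero_arr[OF A B F] exact_functorD(2)[OF F] by blast
  moreover have "exact_at A k f" using A.exact_at_mono_iff[OF A.kernel_mono[OF k]] k by blast
  ultimately show ?thesis using B.exact_at_mono_iff exact_functorD(2)[OF F] by blast
qed

lemma exact_cokernel:
  assumes A: "abelian_cat A" and B: "abelian_cat B" and F: "exact_functor A B F" and k: "is_cokernel A f c"
  shows "is_cokernel B (fmor F f) (fmor F c)"
  using exact_kernel[OF abelian_cat.abelian_op[OF A] abelian_cat.abelian_op[OF B]
    exact_functor_op[OF A B F], of f c] k by simp

lemma exact_functorI:
  assumes F: "is_functor A B F" and ker: "\<And>f k. is_kernel A f k \<Longrightarrow> is_kernel B (fmor F f) (fmor F k)"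
    and cok: "\<And>f c. is_cokernel A f c \<Longrightarrow> is_cokernel B (fmor F f) (fmor F c)"
  shows "exact_functor A B F"
  unfolding exact_functor_def exact_at_def using assms by blast

section \<open>Localisation\<close>

context category
begin

abbreviation (input) "loc W \<equiv> localisation C W"

section \<open>Zigzags and their equivalence\<close>

lemma zigzag_obj: "zigzag C W X p Y \<Longrightarrow> X \<in> Obj C \<and> Y \<in> Obj C"
proof (induction p arbitrary: X)
  case (Cons s p)
  then show ?case by (cases s) auto
qed auto

lemma zigzag_append: "zigzag C W X p Y \<Longrightarrow> zigzag C W Y q Z \<Longrightarrow> zigzag C W X (p @ q) Z"
proof (induction p arbitrary: X)
  case (Cons s p)
  then show ?case by (cases s) auto
qed auto

lemma zigzag_appendE:
  assumes "zigzag C W X (p @ q) Z"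
  obtains Y where "zigzag C W X p Y" "zigzag C W Y q Z"
proof -
  have "\<exists>Y. zigzag C W X p Y \<and> zigzag C W Y q Z"
    using assms
  proof (induction p arbitrary: X)
    case Nil
    then show ?case using zigzag_obj by auto
  next
    case (Cons s p)
    then show ?case by (cases s) auto
  qed
  then show ?thesis using that by blast
qed

lemma zz_equiv_zigzag: "(p, q) \<in> zz_equiv C W X Y \<Longrightarrow> zigzag C W X p Y \<and> zigzag C W X q Y"
  by (simp add: zz_equiv_def)

lemma zz_equiv_refl: "zigzag C W X p Y \<Longrightarrow> (p, p) \<in> zz_equiv C W X Y"
  by (simp add: zz_equiv_def)

lemma zz_equiv_sym: "(p, q) \<in> zz_equiv C W X Y \<Longrightarrow> (q, p) \<in> zz_equiv C W X Y"
proof -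
  let ?R = "zz_step C W X Y \<union> (zz_step C W X Y)\<inverse>"
  have "sym (?R\<^sup>*)" by (rule sym_rtrancl) (auto simp: sym_def)
  then show "(p, q) \<in> zz_equiv C W X Y \<Longrightarrow> (q, p) \<in> zz_equiv C W X Y"
    unfolding zz_equiv_def by (auto dest: symD)
qed

lemma zz_equiv_trans:
  "(p, q) \<in> zz_equiv C W X Y \<Longrightarrow> (q, r) \<in> zz_equiv C W X Y \<Longrightarrow> (p, r) \<in> zz_equiv C W X Y"
  unfolding zz_equiv_def by (auto intro: rtrancl_trans)

lemma zz_equiv_red:
  assumes "zz_red C W l r" "zigzag C W X l Y" "zigzag C W X r Y"
  shows "(l, r) \<in> zz_equiv C W X Y"
proof -
  have "(l, r) \<in> zz_step C W X Y"
    unfolding zz_step_def using assms by (fastforce intro: exI[of _ "[]"])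
  then show ?thesis using assms unfolding zz_equiv_def by auto
qed

lemma zz_step_append:
  assumes "(p, p') \<in> zz_step C W X Y" "zigzag C W U a X" "zigzag C W Y b V"
  shows "(a @ p @ b, a @ p' @ b) \<in> zz_step C W U V"
proof -
  obtain c d l r where h: "zz_red C W l r" "p = c @ l @ d" "p' = c @ r @ d" "zigzag C W X p Y" "zigzag C W X p' Y"
    using assms(1) unfolding zz_step_def by blast
  then have "a @ p @ b = (a @ c) @ l @ (d @ b)" "a @ p' @ b = (a @ c) @ r @ (d @ b)" by auto
  moreover have "zigzag C W U (a @ p @ b) V" "zigzag C W U (a @ p' @ b) V"
    using h assms zigzag_append by blast+
  ultimately show ?thesis unfolding zz_step_def using h(1) by blast
qed

lemma zz_equiv_append1:
  assumes "(p, p') \<in> zz_equiv C W X Y" "zigzag C W U a X" "zigzag C W Y b V"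
  shows "(a @ p @ b, a @ p' @ b) \<in> zz_equiv C W U V"
proof -
  let ?R = "zz_step C W X Y \<union> (zz_step C W X Y)\<inverse>" and ?R' = "zz_step C W U V \<union> (zz_step C W U V)\<inverse>"
  have "(p, p') \<in> ?R\<^sup>*" using assms(1) unfolding zz_equiv_def by auto
  then have "(a @ p @ b, a @ p' @ b) \<in> ?R'\<^sup>*"
  proof (induction rule: rtrancl_induct)
    case (step y z)
    then have "(a @ y @ b, a @ z @ b) \<in> ?R'" using zz_step_append[OF _ assms(2,3)] by blast
    then show ?case using step by (meson rtrancl.rtrancl_into_rtrancl)
  qed simp
  moreover have "zigzag C W U (a @ p @ b) V" "zigzag C W U (a @ p' @ b) V"
    using zz_equiv_zigzag[OF assms(1)] assms zigzag_append by blast+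
  ultimately show ?thesis unfolding zz_equiv_def by simp
qed

lemma zz_equiv_append:
  assumes p: "(p, p') \<in> zz_equiv C W X Y" and q: "(q, q') \<in> zz_equiv C W Y Z"
  shows "(p @ q, p' @ q') \<in> zz_equiv C W X Z"
proof -
  have z: "zigzag C W X p Y" "zigzag C W X p' Y" "zigzag C W Y q Z" "zigzag C W Y q' Z"
    using zz_equiv_zigzag p q by blast+
  have n: "zigzag C W X [] X" "zigzag C W Z [] Z" using zigzag_obj z by auto
  show ?thesis
    using zz_equiv_trans[of "p @ q" "p' @ q" W X Z "p' @ q'"] zz_equiv_append1[OF p n(1) z(3)]
      zz_equiv_append1[OF q z(2) n(2)] by simp
qed

lemma zz_class_eq_iff:
  assumes "zigzag C W X p Y"
  shows "zz_class C W X p Y = zz_class C W X q Y \<longleftrightarrow> (p, q) \<in> zz_equiv C W X Y"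
proof
  assume "zz_class C W X p Y = zz_class C W X q Y"
  then have "p \<in> zz_equiv C W X Y `` {q}"
    using zz_equiv_refl[OF assms] unfolding zz_class_def by auto
  then show "(p, q) \<in> zz_equiv C W X Y" using zz_equiv_sym by blast
next
  assume "(p, q) \<in> zz_equiv C W X Y"
  then show "zz_class C W X p Y = zz_class C W X q Y"
    unfolding zz_class_def using zz_equiv_sym zz_equiv_trans by blast
qed

section \<open>The localised category and its localisation functor\<close>

lemma localisation_simps [simp]:
  "Obj (loc W) = Obj C"
  "Dom (loc W) (zz_class C W X p Y) = X"
  "Cod (loc W) (zz_class C W X p Y) = Y"
  "Ident (loc W) X = zz_class C W X [] X"
  by (simp_all add: localisation_def zz_class_def)

lemma localisation_hom_iff:
  "\<phi> \<in> hom (loc W) X Y \<longleftrightarrow> (\<exists>p. zigzag C W X p Y \<and> \<phi> = zz_class C W X p Y)"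
proof
  assume "\<phi> \<in> hom (loc W) X Y"
  then have "\<phi> \<in> Arr (loc W)" "Dom (loc W) \<phi> = X" "Cod (loc W) \<phi> = Y"
    by (auto simp: hom_iff)
  moreover then obtain X' p Y' where "\<phi> = zz_class C W X' p Y'" "zigzag C W X' p Y'"
    unfolding localisation_def by auto
  ultimately show "\<exists>p. zigzag C W X p Y \<and> \<phi> = zz_class C W X p Y" by auto
next
  assume "\<exists>p. zigzag C W X p Y \<and> \<phi> = zz_class C W X p Y"
  then show "\<phi> \<in> hom (loc W) X Y"
    by (auto simp: hom_iff) (auto simp: localisation_def)
qed

text \<open>The union over representatives collapses because concatenation respects
  equivalence.\<close>

lemma localisation_comp:
  assumes p: "zigzag C W X p Y" and q: "zigzag C W Y q Z"
  shows "zz_class C W Y q Z \<cdot>\<^bsub>loc W\<^esub> zz_class C W X p Y = zz_class C W X (p @ q) Z"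
proof -
  have "(\<Union>p' \<in> zz_equiv C W X Y `` {p}. \<Union>q' \<in> zz_equiv C W Y Z `` {q}. zz_equiv C W X Z `` {p' @ q'})
    = zz_equiv C W X Z `` {p @ q}" (is "?L = ?R")
  proof
    show "?L \<subseteq> ?R" using zz_equiv_append zz_equiv_trans by blast
    show "?R \<subseteq> ?L" using zz_equiv_refl[OF p] zz_equiv_refl[OF q] by blast
  qed
  then show ?thesis unfolding localisation_def zz_class_def by simp
qed

lemma category_localisation: "category (loc W)"
proof
  let ?L = "loc W"
  note hi = localisation_hom_iff and cp = localisation_comp
  fix f assume "f \<in> Arr ?L"
  then have "f \<in> hom ?L (Dom ?L f) (Cod ?L f)" by (simp add: hom_iff)
  then show "Dom ?L f \<in> Obj ?L" "Cod ?L f \<in> Obj ?L" using hi zigzag_obj by auto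
next
  fix X assume "X \<in> Obj (loc W)"
  then show "Ident (loc W) X \<in> hom (loc W) X X"
    using localisation_hom_iff[of _ W X X] by (auto intro!: exI[of _ "[]"])
next
  fix f g X Y Z assume "f \<in> hom (loc W) X Y" "g \<in> hom (loc W) Y Z"
  then obtain p q where "zigzag C W X p Y" "f = zz_class C W X p Y" "zigzag C W Y q Z" "g = zz_class C W Y q Z"
    using localisation_hom_iff by metis
  then show "g \<cdot>\<^bsub>loc W\<^esub> f \<in> hom (loc W) X Z"
    using localisation_comp localisation_hom_iff zigzag_append by metis
next
  fix f X Y assume "f \<in> hom (loc W) X Y"
  then obtain p where p: "zigzag C W X p Y" "f = zz_class C W X p Y" using localisation_hom_iff by metis
  have n: "zigzag C W X [] X" "zigzag C W Y [] Y" using zigzag_obj[OF p(1)] by auto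
  show "f \<cdot>\<^bsub>loc W\<^esub> Ident (loc W) X = f"
    "Ident (loc W) Y \<cdot>\<^bsub>loc W\<^esub> f = f"
    using localisation_comp[OF n(1) p(1)] localisation_comp[OF p(1) n(2)] p by simp_all
next
  fix f g k X Y Z V assume "f \<in> hom (loc W) V X" "g \<in> hom (loc W) X Y"
    "k \<in> hom (loc W) Y Z"
  then obtain p q r where h: "zigzag C W V p X" "f = zz_class C W V p X" "zigzag C W X q Y"
    "g = zz_class C W X q Y" "zigzag C W Y r Z" "k = zz_class C W Y r Z"
    using localisation_hom_iff by metis
  show "k \<cdot>\<^bsub>loc W\<^esub> g \<cdot>\<^bsub>loc W\<^esub> f = k \<cdot>\<^bsub>loc W\<^esub> (g \<cdot>\<^bsub>loc W\<^esub> f)"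
    unfolding h(2,4,6) using h(1,3,5) by (simp add: localisation_comp zigzag_append)
qed

abbreviation (input) "qm W \<equiv> fmor (loc_functor C W)"

lemma loc_functor_simps [simp]: "fobj (loc_functor C W) X = X"
  by (simp add: loc_functor_def)

lemma qm_eq: "f \<in> hom C X Y \<Longrightarrow> qm W f = zz_class C W X [Fwd f] Y"
  by (simp add: loc_functor_def hom_iff)

lemma zigzag_Fwd: "f \<in> hom C X Y \<Longrightarrow> zigzag C W X [Fwd f] Y"
  by (auto simp: hom_iff)

lemma zigzag_Bwd: "w \<in> hom C X Y \<Longrightarrow> w \<in> W \<Longrightarrow> zigzag C W Y [Bwd w] X"
  by (auto simp: hom_iff)

lemma is_functor_loc: "is_functor C (loc W) (loc_functor C W)"
  unfolding is_functor_def
proof (intro conjI ballI impI)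
  show "category C" by (rule category_axioms)
  show "category (loc W)" by (rule category_localisation)
next
  fix X assume X: "X \<in> Obj C"
  then show "fobj (loc_functor C W) X \<in> Obj (loc W)" by simp
  have "([Fwd (Ident C X)], []) \<in> zz_equiv C W X X"
    by (rule zz_equiv_red) (use X in \<open>auto intro: zz_red.intros\<close>)
  then show "qm W (Ident C X) = Ident (loc W) (fobj (loc_functor C W) X)"
    using zz_class_eq_iff[OF zigzag_Fwd[OF Ident_hom[OF X]]] by (simp add: qm_eq[OF Ident_hom[OF X]])
next
  fix f assume "f \<in> Arr C"
  then have "f \<in> hom C (Dom C f) (Cod C f)" by (simp add: hom_iff)
  then show "qm W f \<in> hom (loc W) (fobj (loc_functor C W) (Dom C f)) (fobj (loc_functor C W) (Cod C f))"
    unfolding qm_eq[OF \<open>f \<in> hom C (Dom C f) (Cod C f)\<close>] loc_functor_simps localisation_hom_iff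
    using zigzag_Fwd by blast
next
  fix f g assume fg: "f \<in> Arr C" "g \<in> Arr C" "Cod C f = Dom C g"
  then have f: "f \<in> hom C (Dom C f) (Cod C f)" and g: "g \<in> hom C (Cod C f) (Cod C g)" by (simp_all add: hom_iff)
  have "([Fwd f, Fwd g], [Fwd (g \<cdot> f)]) \<in> zz_equiv C W (Dom C f) (Cod C g)"
    by (rule zz_equiv_red) (use fg in \<open>auto intro: zz_red.intros\<close>)
  moreover have "zigzag C W (Dom C f) [Fwd f, Fwd g] (Cod C g)" using fg by auto
  ultimately have "zz_class C W (Dom C f) [Fwd f, Fwd g] (Cod C g) = zz_class C W (Dom C f) [Fwd (g \<cdot> f)] (Cod C g)"
    using zz_class_eq_iff by blast
  then show "qm W (g \<cdot> f) = qm W g \<cdot>\<^bsub>loc W\<^esub> qm W f"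
    using localisation_comp[OF zigzag_Fwd[OF f] zigzag_Fwd[OF g], of W]
    by (simp add: qm_eq[OF f] qm_eq[OF g] qm_eq[OF Comp_hom[OF f g]])
qed

lemma localisation_inverse:
  assumes w: "w \<in> hom C X Y" "w \<in> W"
  shows "zz_class C W Y [Bwd w] X \<cdot>\<^bsub>loc W\<^esub> qm W w = Ident (loc W) X"
    "qm W w \<cdot>\<^bsub>loc W\<^esub> zz_class C W Y [Bwd w] X = Ident (loc W) Y"
    "zz_class C W Y [Bwd w] X \<in> hom (loc W) Y X"
proof -
  note z = zigzag_Fwd[OF w(1), of W] zigzag_Bwd[OF w]
  have X: "X \<in> Obj C" "Y \<in> Obj C" using w hom_obj by auto
  have "([Fwd w, Bwd w], []) \<in> zz_equiv C W X X" "([Bwd w, Fwd w], []) \<in> zz_equiv C W Y Y"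
    by (rule zz_equiv_red; use w X in \<open>auto simp: hom_iff intro: zz_red.intros\<close>)+
  then have "zz_class C W X [Fwd w, Bwd w] X = zz_class C W X [] X"
     "zz_class C W Y [Bwd w, Fwd w] Y = zz_class C W Y [] Y"
    using zz_class_eq_iff zz_equiv_zigzag by blast+
  then show "zz_class C W Y [Bwd w] X \<cdot>\<^bsub>loc W\<^esub> qm W w = Ident (loc W) X"
    "qm W w \<cdot>\<^bsub>loc W\<^esub> zz_class C W Y [Bwd w] X = Ident (loc W) Y"
    using localisation_comp[OF z] localisation_comp[OF z(2,1)] by (simp_all add: qm_eq[OF w(1)])
  show "zz_class C W Y [Bwd w] X \<in> hom (loc W) Y X" using z localisation_hom_iff by blast
qed

lemma loc_functor_iso:
  assumes w: "w \<in> hom C X Y" "w \<in> W"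
  shows "iso (loc W) (qm W w)"
  using category.isoI[OF category_localisation _ localisation_inverse(3)[OF w] localisation_inverse(1,2)[OF w]]
    functorD(4)[OF is_functor_loc w(1)] by simp

text \<open>Every arrow is a composite of images of arrows and inverses of images of
  \<open>W\<close>. The inverse \<open>i\<close> is known only through its two equations, which lets
  users of the rule forget about zigzags.\<close>

lemma localisation_induct [consumes 1, case_names ident fwd bwd]:
  assumes "\<phi> \<in> hom (loc W) X Y"
    and idn: "\<And>X. X \<in> Obj C \<Longrightarrow> P X X (Ident (loc W) X)"
    and fwd: "\<And>X V Y f \<phi>. \<phi> \<in> hom (loc W) V Y \<Longrightarrow> P V Y \<phi> \<Longrightarrow> f \<in> hom C X V \<Longrightarrow>
      P X Y (\<phi> \<cdot>\<^bsub>loc W\<^esub> qm W f)"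
    and bwd: "\<And>X V Y w \<phi> i. \<phi> \<in> hom (loc W) V Y \<Longrightarrow> P V Y \<phi> \<Longrightarrow> w \<in> hom C V X \<Longrightarrow> w \<in> W \<Longrightarrow>
      i \<in> hom (loc W) X V \<Longrightarrow> i \<cdot>\<^bsub>loc W\<^esub> qm W w = Ident (loc W) V \<Longrightarrow>
      qm W w \<cdot>\<^bsub>loc W\<^esub> i = Ident (loc W) X \<Longrightarrow> P X Y (\<phi> \<cdot>\<^bsub>loc W\<^esub> i)"
  shows "P X Y \<phi>"
proof -
  obtain p where p: "zigzag C W X p Y" "\<phi> = zz_class C W X p Y" using assms(1) localisation_hom_iff by metis
  have "zigzag C W X p Y \<Longrightarrow> P X Y (zz_class C W X p Y)" for X
  proof (induction p arbitrary: X)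
    case Nil
    then show ?case using idn by auto
  next
    case (Cons s p)
    show ?case
    proof (cases s)
      case (Fwd f)
      let ?V = "Cod C f"
      have f: "f \<in> hom C X ?V" "zigzag C W ?V p Y" using Cons.prems Fwd by (auto simp: hom_iff)
      have "P X Y (zz_class C W ?V p Y \<cdot>\<^bsub>loc W\<^esub> qm W f)"
        by (rule fwd) (use f Cons.IH localisation_hom_iff in blast)+
      then show ?thesis using localisation_comp[OF zigzag_Fwd[OF f(1)] f(2)] Fwd by (simp add: qm_eq[OF f(1)])
    next
      case (Bwd w)
      let ?V = "Dom C w"
      have f: "w \<in> hom C ?V X" "w \<in> W" "zigzag C W ?V p Y" using Cons.prems Bwd by (auto simp: hom_iff)
      have "P X Y (zz_class C W ?V p Y \<cdot>\<^bsub>loc W\<^esub> zz_class C W X [Bwd w] ?V)"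
        by (rule bwd[OF _ _ f(1,2) localisation_inverse(3,1,2)[OF f(1,2)]])
          (use f Cons.IH localisation_hom_iff in blast)+
      then show ?thesis using localisation_comp[OF zigzag_Bwd[OF f(1,2)] f(3)] Bwd by simp
    qed
  qed
  then show ?thesis using p by blast
qed

end

section \<open>Factoring functors through the localisation\<close>

definition inv_arr :: "('o, 'm, 'z) cat_scheme \<Rightarrow> 'm \<Rightarrow> 'm" where
  "inv_arr C f = (SOME g. is_inverse C f g)"

lemma (in category) inv_arr:
  assumes "iso C f" "f \<in> hom C X Y"
  shows "inv_arr C f \<in> hom C Y X" "inv_arr C f \<cdot> f = Ident C X" "f \<cdot> inv_arr C f = Ident C Y"
proof -
  have "is_inverse C f (inv_arr C f)"
    using assms(1) unfolding iso_def inv_arr_def by (rule someI_ex)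
  then show "inv_arr C f \<in> hom C Y X" "inv_arr C f \<cdot> f = Ident C X" "f \<cdot> inv_arr C f = Ident C Y"
    using assms(2) unfolding is_inverse_def by (simp_all add: hom_iff)
qed

text \<open>The object argument matters only for the empty zigzag, whose end points cannot be read
  off the list.\<close>

fun zz_eval :: "('o, 'm, 'a) cat_scheme \<Rightarrow> ('p, 'q, 'b) cat_scheme \<Rightarrow> ('o, 'm, 'p, 'q) fctr \<Rightarrow>
    'o \<Rightarrow> 'm step list \<Rightarrow> 'q" where
  "zz_eval C D F X [] = Ident D (fobj F X)"
| "zz_eval C D F X (Fwd f # p) = zz_eval C D F (Cod C f) p \<cdot>\<^bsub>D\<^esub> fmor F f"
| "zz_eval C D F X (Bwd w # p) = zz_eval C D F (Dom C w) p \<cdot>\<^bsub>D\<^esub> inv_arr D (fmor F w)"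

locale inverting_functor = category C for C :: "('o, 'm, 'z) cat_scheme" (structure) +
  fixes D :: "('p, 'q, 'b) cat_scheme" and F :: "('o, 'm, 'p, 'q) fctr" and W :: "'m set"
  assumes F: "is_functor C D F"
    and inverts: "\<And>w. w \<in> Arr C \<Longrightarrow> w \<in> W \<Longrightarrow> iso D (fmor F w)"
begin

interpretation D: category D by (rule functorD(2)[OF F])

lemma inv_fmor:
  assumes "w \<in> hom C X Y" "w \<in> W"
  shows "inv_arr D (fmor F w) \<in> hom D (fobj F Y) (fobj F X)"
    "inv_arr D (fmor F w) \<cdot>\<^bsub>D\<^esub> fmor F w = Ident D (fobj F X)"
    "fmor F w \<cdot>\<^bsub>D\<^esub> inv_arr D (fmor F w) = Ident D (fobj F Y)"
  using D.inv_arr[OF inverts functorD(4)[OF F assms(1)]] assms by (simp_all add: hom_iff)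

lemma zz_eval_hom: "zigzag C W X p Y \<Longrightarrow> zz_eval C D F X p \<in> hom D (fobj F X) (fobj F Y)"
proof (induction p arbitrary: X)
  case Nil
  then show ?case using D.Ident_hom functorD(3)[OF F] by auto
next
  case (Cons s p)
  show ?case
  proof (cases s)
    case (Fwd f)
    then have "f \<in> hom C X (Cod C f)" "zigzag C W (Cod C f) p Y" using Cons.prems by (auto simp: hom_iff)
    then show ?thesis using Fwd Cons.IH D.Comp_hom functorD(4)[OF F] by fastforce
  next
    case (Bwd w)
    then have "w \<in> hom C (Dom C w) X" "w \<in> W" "zigzag C W (Dom C w) p Y" using Cons.prems by (auto simp: hom_iff)
    then show ?thesis using Bwd Cons.IH D.Comp_hom inv_fmor(1) by fastforce
  qed
qed

lemma zz_eval_append: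
  "zigzag C W X p Y \<Longrightarrow> zigzag C W Y q Z \<Longrightarrow>
    zz_eval C D F X (p @ q) = zz_eval C D F Y q \<cdot>\<^bsub>D\<^esub> zz_eval C D F X p"
proof (induction p arbitrary: X)
  case Nil
  then show ?case using zz_eval_hom[of X q Z] by (auto simp: hom_iff)
next
  case (Cons s p)
  show ?case
  proof (cases s)
    case (Fwd f)
    then have f: "f \<in> hom C X (Cod C f)" "zigzag C W (Cod C f) p Y" using Cons.prems by (auto simp: hom_iff)
    then show ?thesis
      using Fwd Cons.IH Cons.prems(2) D.Comp_assoc[OF functorD(4)[OF F f(1)] zz_eval_hom[OF f(2)] zz_eval_hom[OF Cons.prems(2)]]
      by simp
  next
    case (Bwd w)
    then have f: "w \<in> hom C (Dom C w) X" "w \<in> W" "zigzag C W (Dom C w) p Y" using Cons.prems by (auto simp: hom_iff)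
    then show ?thesis
      using Bwd Cons.IH Cons.prems(2) D.Comp_assoc[OF inv_fmor(1)[OF f(1,2)] zz_eval_hom[OF f(3)] zz_eval_hom[OF Cons.prems(2)]]
      by simp
  qed
qed

lemma zz_eval_red:
  assumes "zz_red C W l r" "zigzag C W X l Y" "zigzag C W X r Y"
  shows "zz_eval C D F X l = zz_eval C D F X r"
  using assms
proof (cases rule: zz_red.cases)
  case (1 f g)
  then have fg: "f \<in> hom C (Dom C f) (Cod C f)" "g \<in> hom C (Cod C f) (Cod C g)" by (simp_all add: hom_iff)
  note h = functorD(4)[OF F fg(1)] functorD(4)[OF F fg(2)] functorD(3)[OF F hom_obj(2)[OF fg(2)]]
  show ?thesis using 1 h functorD(6)[OF F fg] by (simp add: hom_iff)
next
  case (2 V)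
  then have V: "V = X" "V \<in> Obj C" using assms(2) by auto
  have "Ident D (fobj F X) \<cdot>\<^bsub>D\<^esub> Ident D (fobj F X) = Ident D (fobj F X)"
    using functorD(3)[OF F] V by simp
  then show ?thesis using 2 V functorD(5)[OF F] by simp
next
  case (3 w)
  then have w: "w \<in> hom C X (Cod C w)" "w \<in> W" using assms(2) by (auto simp: hom_iff)
  show ?thesis using 3 inv_fmor[OF w] functorD(3)[OF F hom_obj(1)[OF w(1)]] w(1) by (simp add: hom_iff)
next
  case (4 w)
  then have w: "w \<in> hom C (Dom C w) X" "w \<in> W" using assms(2) by (auto simp: hom_iff)
  show ?thesis using 4 inv_fmor[OF w] functorD(3)[OF F hom_obj(2)[OF w(1)]] w(1)
    functorD(4)[OF F w(1)] by (simp add: hom_iff)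
qed

text \<open>A step only records that the two whole zigzags are valid, so the replaced pieces must
  first be seen to have the same end points: \<open>a\<close> fixes where they start, and the head
  of \<open>b\<close>, or the common end \<open>Y\<close> if \<open>b\<close> is empty, fixes where
  they stop. The difference is then confined to one reduction.\<close>

lemma zz_eval_step:
  assumes "(p, q) \<in> zz_step C W X Y"
  shows "zz_eval C D F X p = zz_eval C D F X q"
proof -
  obtain a b l r where h: "zz_red C W l r" "p = a @ l @ b" "q = a @ r @ b" "zigzag C W X p Y" "zigzag C W X q Y"
    using assms unfolding zz_step_def by blast
  obtain U V where uv: "zigzag C W X a U" "zigzag C W U l V" "zigzag C W V b Y"
    using h(2,4) zigzag_appendE by metis
  obtain U' V' where uv': "zigzag C W X a U'" "zigzag C W U' r V'" "zigzag C W V' b Y"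
    using h(3,5) zigzag_appendE by metis
  have end_unique: "zigzag C W X p Y \<Longrightarrow> zigzag C W X p Y' \<Longrightarrow> Y = Y'" for X p Y Y'
  proof (induction p arbitrary: X)
    case (Cons s p)
    then show ?case by (cases s) auto
  qed simp
  have start_unique: "V = V'"
  proof (cases b)
    case Nil
    then show ?thesis using uv uv' by auto
  next
    case (Cons s b')
    then show ?thesis using uv(3) uv'(3) by (cases s) auto
  qed
  have "U = U'" using end_unique uv(1) uv'(1) by blast
  then have "zz_eval C D F U l = zz_eval C D F U r"
    using zz_eval_red[OF h(1) uv(2)] uv'(2) start_unique by simp
  moreover have "zz_eval C D F X (a @ t @ b) =
      (zz_eval C D F V b \<cdot>\<^bsub>D\<^esub> zz_eval C D F U t) \<cdot>\<^bsub>D\<^esub> zz_eval C D F X a"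
    if "zigzag C W U t V" for t
    using zz_eval_append[OF uv(1) zigzag_append[OF that uv(3)]] zz_eval_append[OF that uv(3)] by simp
  ultimately show ?thesis
    using uv(2) uv'(2) \<open>U = U'\<close> start_unique unfolding h(2,3) by simp
qed

lemma zz_eval_equiv:
  assumes "(p, q) \<in> zz_equiv C W X Y"
  shows "zz_eval C D F X p = zz_eval C D F X q"
proof -
  have "(p, q) \<in> (zz_step C W X Y \<union> (zz_step C W X Y)\<inverse>)\<^sup>*" using assms unfolding zz_equiv_def by simp
  then show ?thesis
  proof (induction rule: rtrancl_induct)
    case (step y z)
    then have "zz_eval C D F X y = zz_eval C D F X z" using zz_eval_step[of _ _ X Y] by auto
    then show ?case using step by simp
  qed simp
qed

text \<open>The value on a class is read off an arbitrary representative, legitimate by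
  \<open>zz_eval_equiv\<close>.\<close>

definition lift :: "('o, ('o, 'm) zigzag_class, 'p, 'q) fctr" where
  "lift = \<lparr>fobj = fobj F, fmor = (\<lambda>(X, c, Y). zz_eval C D F X (SOME p. p \<in> c))\<rparr>"

lemma lift_zz_class:
  assumes "zigzag C W X p Y"
  shows "fmor lift (zz_class C W X p Y) = zz_eval C D F X p"
proof -
  let ?q = "SOME q. q \<in> zz_equiv C W X Y `` {p}"
  have "?q \<in> zz_equiv C W X Y `` {p}"
    by (rule someI[of _ p]) (use zz_equiv_refl[OF assms] in auto)
  then have "zz_eval C D F X p = zz_eval C D F X ?q" using zz_eval_equiv by blast
  then show ?thesis by (simp add: lift_def zz_class_def)
qed

lemma lift_fobj [simp]: "fobj lift = fobj F"
  by (simp add: lift_def)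

lemma lift_fmor: "f \<in> Arr C \<Longrightarrow> fmor lift (fmor (loc_functor C W) f) = fmor F f"
proof -
  assume "f \<in> Arr C"
  then have f: "f \<in> hom C (Dom C f) (Cod C f)" by (simp add: hom_iff)
  show ?thesis using lift_zz_class[OF zigzag_Fwd[OF f]] qm_eq[OF f] functorD(4)[OF F f] functorD(3)[OF F hom_obj(2)[OF f]]
    by (simp add: hom_iff)
qed

lemma is_functor_lift: "is_functor (loc W) D lift"
  unfolding is_functor_def
proof (intro conjI ballI impI)
  let ?L = "loc W"
  show "category ?L" by (rule category_localisation)
  show "category D" by (rule D.category_axioms)
  show "fobj lift X \<in> Obj D" if "X \<in> Obj ?L" for X using that functorD(3)[OF F] by simp
  show "fmor lift (Ident ?L X) = Ident D (fobj lift X)" if "X \<in> Obj ?L" for X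
    using lift_zz_class[of X "[]" X] that by simp
  fix f assume "f \<in> Arr ?L"
  then have f: "f \<in> hom ?L (Dom ?L f) (Cod ?L f)" by (simp add: hom_iff)
  then obtain p where p: "zigzag C W (Dom ?L f) p (Cod ?L f)" "f = zz_class C W (Dom ?L f) p (Cod ?L f)"
    using localisation_hom_iff by metis
  show "fmor lift f \<in> hom D (fobj lift (Dom ?L f)) (fobj lift (Cod ?L f))"
    using lift_zz_class[OF p(1)] p(2) zz_eval_hom[OF p(1)] by simp
  fix g assume "g \<in> Arr ?L" "Cod ?L f = Dom ?L g"
  then have g: "g \<in> hom ?L (Cod ?L f) (Cod ?L g)" by (simp add: hom_iff)
  then obtain q where q: "zigzag C W (Cod ?L f) q (Cod ?L g)" "g = zz_class C W (Cod ?L f) q (Cod ?L g)"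
    using localisation_hom_iff by metis
  have "g \<cdot>\<^bsub>?L\<^esub> f = zz_class C W (Dom ?L f) (p @ q) (Cod ?L g)"
    using localisation_comp[OF p(1) q(1)] p(2) q(2) by simp
  then show "fmor lift (g \<cdot>\<^bsub>?L\<^esub> f) = fmor lift g \<cdot>\<^bsub>D\<^esub> fmor lift f"
    using lift_zz_class[OF p(1)] lift_zz_class[OF q(1)] lift_zz_class[OF zigzag_append[OF p(1) q(1)]]
      p(2) q(2) zz_eval_append[OF p(1) q(1)] by simp
qed

end

text \<open>The uniqueness half of the universal property. Objects are unchanged, so the same
  components serve; naturality at an inverse follows from naturality at the arrow of
  \<open>W\<close> by composing with its inverse on both sides.\<close>

lemma (in category) nat_isomorphic_localisation:
  assumes F: "is_functor (loc W) D F" and G: "is_functor (loc W) D G"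
    and n: "nat_isomorphic C D (F \<circ>\<^sub>F loc_functor C W) (G \<circ>\<^sub>F loc_functor C W)"
  shows "nat_isomorphic (loc W) D F G"
proof -
  let ?L = "loc W"
  interpret L: category ?L by (rule category_localisation)
  interpret D: category D by (rule functorD(2)[OF F])
  obtain \<eta> where e: "\<And>X. X \<in> Obj C \<Longrightarrow> iso D (\<eta> X)"
    "\<And>X. X \<in> Obj C \<Longrightarrow> \<eta> X \<in> hom D (fobj F X) (fobj G X)"
    "\<And>f X Y. f \<in> hom C X Y \<Longrightarrow> \<eta> Y \<cdot>\<^bsub>D\<^esub> fmor F (qm W f) = fmor G (qm W f) \<cdot>\<^bsub>D\<^esub> \<eta> X"
    using nat_isomorphicE[OF n] unfolding fcomp_simps loc_functor_simps by metis
  show ?thesis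
  proof (rule nat_isomorphicI[of _ _ \<eta>])
    fix \<phi> X Y assume "\<phi> \<in> hom ?L X Y"
    then show "\<eta> Y \<cdot>\<^bsub>D\<^esub> fmor F \<phi> = fmor G \<phi> \<cdot>\<^bsub>D\<^esub> \<eta> X"
    proof (induct rule: localisation_induct)
      case (ident X)
      then have X: "X \<in> Obj ?L" by simp
      show ?case unfolding functorD(5)[OF F X] functorD(5)[OF G X] using e(2)[OF ident] by (simp add: hom_iff)
    next
      case (fwd X V Y f \<phi>)
      have q: "qm W f \<in> hom ?L X V" using functorD(4)[OF is_functor_loc fwd(3)] by simp
      note h = functorD(4)[OF F q] functorD(4)[OF F fwd(1)] functorD(4)[OF G q] functorD(4)[OF G fwd(1)]
        e(2)[OF hom_obj(1)[OF fwd(3)]] e(2)[OF hom_obj(2)[OF fwd(3)]]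
      have "\<eta> Y \<in> hom D (fobj F Y) (fobj G Y)" using e(2) L.hom_obj[OF fwd(1)] by simp
      then show ?case
        unfolding functorD(6)[OF F q fwd(1)] functorD(6)[OF G q fwd(1)]
        using h by (simp add: hom_iff D.assoc_eq[OF fwd(2)] e(3)[OF fwd(3)])
    next
      case (bwd X V Y w \<phi> i)
      have q: "qm W w \<in> hom ?L V X" using functorD(4)[OF is_functor_loc bwd(3)] by simp
      note X = hom_obj(2)[OF bwd(3)] and V = hom_obj(1)[OF bwd(3)]
      note h = functorD(4)[OF F q] functorD(4)[OF F bwd(1)] functorD(4)[OF G q] functorD(4)[OF G bwd(1)]
        e(2)[OF X] e(2)[OF V] functorD(4)[OF F bwd(5)] functorD(4)[OF G bwd(5)]
      have Y: "\<eta> Y \<in> hom D (fobj F Y) (fobj G Y)" using e(2) L.hom_obj[OF bwd(1)] by simp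
      have Fi: "fmor F (qm W w) \<cdot>\<^bsub>D\<^esub> fmor F i = Ident D (fobj F X)"
        using functorD(6)[OF F bwd(5) q] bwd(7) functorD(5)[OF F, of X] X by simp
      have Gi: "fmor G i \<cdot>\<^bsub>D\<^esub> fmor G (qm W w) = Ident D (fobj G V)"
        using functorD(6)[OF G q bwd(5)] bwd(6) functorD(5)[OF G, of V] V by simp
      have "\<eta> V \<cdot>\<^bsub>D\<^esub> fmor F i = fmor G i \<cdot>\<^bsub>D\<^esub> (fmor G (qm W w) \<cdot>\<^bsub>D\<^esub> \<eta> V) \<cdot>\<^bsub>D\<^esub> fmor F i"
        using h by (simp add: hom_iff D.assoc_eq[OF Gi])
      also have "\<dots> = fmor G i \<cdot>\<^bsub>D\<^esub> \<eta> X"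
        unfolding e(3)[OF bwd(3), symmetric] using h by (simp add: hom_iff Fi)
      finally have nat: "\<eta> V \<cdot>\<^bsub>D\<^esub> fmor F i = fmor G i \<cdot>\<^bsub>D\<^esub> \<eta> X" .
      then show ?case
        unfolding functorD(6)[OF F bwd(5,1)] functorD(6)[OF G bwd(5,1)]
        using h Y by (simp add: hom_iff D.assoc_eq[OF bwd(2)])
    qed
  qed (use e in auto)
qed

section \<open>Calculus of right fractions\<close>

text \<open>The target of a functor that will detect equality in the localisation. Its objects are
  all subsets of one type, and maps are extensional so that equal values give equal arrows.\<close>

definition set_cat :: "('a set, 'a set \<times> ('a \<Rightarrow> 'a) \<times> 'a set) cat" where
  "set_cat = \<lparr>Obj = UNIV, Arr = {(A, f, B). f \<in> A \<rightarrow>\<^sub>E B}, Dom = (\<lambda>(A, f, B). A), Cod = (\<lambda>(A, f, B). B),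
     Ident = (\<lambda>A. (A, restrict id A, A)), Comp = (\<lambda>(B', g, D) (A, f, B). (A, compose A g f, D))\<rparr>"

lemma set_cat_simps [simp]:
  "Obj set_cat = UNIV" "(A, f, B) \<in> Arr set_cat \<longleftrightarrow> f \<in> A \<rightarrow>\<^sub>E B" "Dom set_cat (A, f, B) = A"
  "Cod set_cat (A, f, B) = B" "Ident set_cat A = (A, restrict id A, A)"
  "(B', g, D) \<cdot>\<^bsub>set_cat\<^esub> (A, f, B) = (A, compose A g f, D)"
  by (simp_all add: set_cat_def)

lemma hom_set_cat: "\<phi> \<in> hom set_cat A B \<longleftrightarrow> (\<exists>f. \<phi> = (A, f, B) \<and> f \<in> A \<rightarrow>\<^sub>E B)"
  by (cases \<phi>) (auto simp: hom_iff)

lemma category_set_cat: "category set_cat"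
proof
  show "Ident set_cat X \<in> hom set_cat X X" for X :: "'a set" by (auto simp: hom_set_cat)
next
  fix f g X Y Z assume "f \<in> hom set_cat X Y" "g \<in> hom set_cat Y Z"
  then show "g \<cdot>\<^bsub>set_cat\<^esub> f \<in> hom set_cat X Z"
    unfolding hom_set_cat by (auto simp: compose_def PiE_iff)
next
  fix f g k W X Y Z assume "f \<in> hom set_cat W X" "g \<in> hom set_cat X Y" "k \<in> hom set_cat Y Z"
  then show "k \<cdot>\<^bsub>set_cat\<^esub> g \<cdot>\<^bsub>set_cat\<^esub> f = k \<cdot>\<^bsub>set_cat\<^esub> (g \<cdot>\<^bsub>set_cat\<^esub> f)"
    unfolding hom_set_cat by (auto simp: compose_def PiE_iff restrict_def fun_eq_iff)
qed (auto simp: hom_set_cat compose_def PiE_iff extensional_def restrict_def fun_eq_iff)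

lemma set_cat_iso:
  assumes f: "f \<in> A \<rightarrow>\<^sub>E B" and b: "bij_betw f A B"
  shows "iso set_cat (A, f, B)"
proof -
  let ?g = "restrict (inv_into A f) B"
  have "compose A ?g f = restrict id A" "compose B f ?g = restrict id B"
    using f b by (auto simp: compose_def restrict_def fun_eq_iff bij_betw_inv_into_left
        bij_betw_inv_into_right bij_betwE)
  moreover have "?g \<in> B \<rightarrow>\<^sub>E A" using b by (auto simp: bij_betw_def inv_into_into)
  ultimately show ?thesis
    unfolding iso_def is_inverse_def using f
    by (intro exI[of _ "(B, ?g, A)"]) (auto simp: hom_set_cat)
qed

locale right_calculus = category C for C :: "('o, 'm, 'z) cat_scheme" (structure) +
  fixes W :: "'m set"
  assumes W_arr: "w \<in> W \<Longrightarrow> w \<in> Arr C"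
    and W_ident: "X \<in> Obj C \<Longrightarrow> Ident C X \<in> W"
    and W_comp: "\<lbrakk>v \<in> W; w \<in> W; Dom C w = Cod C v\<rbrakk> \<Longrightarrow> w \<cdot> v \<in> W"
    and ore: "\<lbrakk>s \<in> hom C Y' Y; s \<in> W; f \<in> hom C X Y\<rbrakk> \<Longrightarrow>
      \<exists>P s' f'. s' \<in> hom C P X \<and> s' \<in> W \<and> f' \<in> hom C P Y' \<and> f \<cdot> s' = s \<cdot> f'"
    and cancel: "\<lbrakk>s \<in> hom C Y Z; s \<in> W; a \<in> hom C X Y; b \<in> hom C X Y; s \<cdot> a = s \<cdot> b\<rbrakk> \<Longrightarrow>
      \<exists>V t. t \<in> hom C V X \<and> t \<in> W \<and> a \<cdot> t = b \<cdot> t"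
begin

text \<open>The relation \<open>\<phi> = f / s\<close> is written as an equation that avoids the
  inverse of the denominator. Along a zigzag, a forward step is moved past the denominator by the
  Ore condition, and a backward step is absorbed into the denominator.\<close>

lemma fraction_ex:
  assumes "\<phi> \<in> hom (loc W) X Y"
  shows "\<exists>V s f. s \<in> hom C V X \<and> s \<in> W \<and> f \<in> hom C V Y \<and>
    \<phi> \<cdot>\<^bsub>loc W\<^esub> qm W s = qm W f"
  using assms
proof (induct rule: localisation_induct)
  case (ident X)
  interpret L: category "loc W" by (rule category_localisation)
  have "qm W (Ident C X) \<in> hom (loc W) X X"
    using functorD(4)[OF is_functor_loc Ident_hom[OF ident]] by simp
  then have "Ident (loc W) X \<cdot>\<^bsub>loc W\<^esub> qm W (Ident C X) = qm W (Ident C X)"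
    by (rule L.Ident_Comp)
  then show ?case using Ident_hom[OF ident] W_ident[OF ident] by blast
next
  case (fwd X V Y f \<phi>)
  interpret L: category "loc W" by (rule category_localisation)
  obtain U s g where s: "s \<in> hom C U V" "s \<in> W" "g \<in> hom C U Y" "\<phi> \<cdot>\<^bsub>loc W\<^esub> qm W s = qm W g"
    using fwd(2) by blast
  obtain P s' f' where p: "s' \<in> hom C P X" "s' \<in> W" "f' \<in> hom C P U" "f \<cdot> s' = s \<cdot> f'"
    using ore[OF s(1,2) fwd(3)] by blast
  note q = functorD(4)[OF is_functor_loc, unfolded loc_functor_simps]
  note qc = functorD(6)[OF is_functor_loc]
  have "(\<phi> \<cdot>\<^bsub>loc W\<^esub> qm W f) \<cdot>\<^bsub>loc W\<^esub> qm W s' =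
      \<phi> \<cdot>\<^bsub>loc W\<^esub> qm W (f \<cdot> s')"
    using L.Comp_assoc[OF q[OF p(1)] q[OF fwd(3)] fwd(1)] qc[OF p(1) fwd(3)] by simp
  also have "\<dots> = qm W (g \<cdot> f')"
    using L.Comp_assoc[OF q[OF p(3)] q[OF s(1)] fwd(1)] qc[OF p(3) s(1)] qc[OF p(3) s(3)] s(4) p(4) by simp
  finally show ?case using p(1,2) Comp_hom[OF p(3) s(3)] by blast
next
  case (bwd X V Y w \<phi> i)
  interpret L: category "loc W" by (rule category_localisation)
  obtain U s g where s: "s \<in> hom C U V" "s \<in> W" "g \<in> hom C U Y" "\<phi> \<cdot>\<^bsub>loc W\<^esub> qm W s = qm W g"
    using bwd(2) by blast
  note q = functorD(4)[OF is_functor_loc, unfolded loc_functor_simps]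
  have "(\<phi> \<cdot>\<^bsub>loc W\<^esub> i) \<cdot>\<^bsub>loc W\<^esub> qm W (w \<cdot> s) = qm W g"
    unfolding functorD(6)[OF is_functor_loc s(1) bwd(3)] s(4)[symmetric]
    using q[OF s(1), of W] q[OF bwd(3), of W] bwd(1,5) by (simp add: hom_iff L.assoc_eq[OF bwd(6)] del: localisation_simps(4))
  moreover have "w \<cdot> s \<in> W" using W_comp[OF s(2) bwd(4)] s(1) bwd(3) by (simp add: hom_iff)
  ultimately show ?case using Comp_hom[OF s(1) bwd(3)] s(3) by blast
qed

text \<open>Equality in the localisation is detected by the functor sending \<open>Y\<close> to the set of right
  fractions \<open>X \<leftarrow> \<bullet> \<rightarrow> Y\<close> modulo common refinement, with values in sets; it inverts \<open>W\<close>.\<close>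

definition frac :: "'o \<Rightarrow> 'o \<Rightarrow> ('m \<times> 'm) set" where
  "frac X Y = {(s, f). s \<in> W \<and> Cod C s = X \<and> f \<in> hom C (Dom C s) Y}"

definition feq :: "'m \<times> 'm \<Rightarrow> 'm \<times> 'm \<Rightarrow> bool" where
  "feq x y \<longleftrightarrow> (\<exists>V. \<exists>u \<in> hom C V (Dom C (fst x)). \<exists>v \<in> hom C V (Dom C (fst y)).
     fst x \<cdot> u = fst y \<cdot> v \<and> fst x \<cdot> u \<in> W \<and> snd x \<cdot> u = snd y \<cdot> v)"

definition fcl :: "'o \<Rightarrow> 'o \<Rightarrow> 'm \<times> 'm \<Rightarrow> ('m \<times> 'm) set" where
  "fcl X Y x = {y \<in> frac X Y. feq x y}"

lemma feq_refl: "x \<in> frac X Y \<Longrightarrow> feq x x"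
  unfolding feq_def frac_def
  by (rule exI[of _ "Dom C (fst x)"], rule bexI[of _ "Ident C (Dom C (fst x))"],
      rule bexI[of _ "Ident C (Dom C (fst x))"]) (auto simp: hom_iff W_arr)

lemma feq_sym: "feq x y \<Longrightarrow> feq y x"
  unfolding feq_def by metis

text \<open>The Ore condition joins the two given refinements over \<open>D\<close>. There
  \<open>v \<cdot> b\<close> and \<open>u' \<cdot> a\<close> agree only after \<open>s'\<close>, so
  a further arrow \<open>t\<close> from \<open>cancel\<close> is needed to make the numerators agree
  as well.\<close>

lemma feq_trans:
  assumes "feq (s, f) (s', f')" "feq (s', f') (s'', f'')"
    and fr: "(s, f) \<in> frac X Y" "(s', f') \<in> frac X Y" "(s'', f'') \<in> frac X Y"
  shows "feq (s, f) (s'', f'')"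
proof -
  have h: "s \<in> hom C (Dom C s) X" "f \<in> hom C (Dom C s) Y" "s' \<in> hom C (Dom C s') X" "f' \<in> hom C (Dom C s') Y"
    "s'' \<in> hom C (Dom C s'') X" "f'' \<in> hom C (Dom C s'') Y" "s' \<in> W"
    using fr W_arr unfolding frac_def by (auto simp: hom_iff)
  obtain A u u' where u: "u \<in> hom C A (Dom C s)" "u' \<in> hom C A (Dom C s')" "s \<cdot> u = s' \<cdot> u'"
    "s \<cdot> u \<in> W" "f \<cdot> u = f' \<cdot> u'" using assms(1) unfolding feq_def by auto
  obtain B v v' where v: "v \<in> hom C B (Dom C s')" "v' \<in> hom C B (Dom C s'')" "s' \<cdot> v = s'' \<cdot> v'"
    "s' \<cdot> v \<in> W" "f' \<cdot> v = f'' \<cdot> v'" using assms(2) unfolding feq_def by auto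
  obtain D b a where d: "b \<in> hom C D B" "b \<in> W" "a \<in> hom C D A" "(s' \<cdot> v) \<cdot> b = (s \<cdot> u) \<cdot> a"
    using ore[OF Comp_hom[OF u(1) h(1)] u(4) Comp_hom[OF v(1) h(3)]] by blast
  have "s' \<cdot> (v \<cdot> b) = s' \<cdot> (u' \<cdot> a)"
    using d(4) unfolding u(3) using h(3) u(2) v(1) d(1,3) by (simp add: hom_iff)
  then obtain E t where t: "t \<in> hom C E D" "t \<in> W" "v \<cdot> b \<cdot> t = u' \<cdot> a \<cdot> t"
    using cancel[OF h(3,7) Comp_hom[OF d(1) v(1)] Comp_hom[OF d(3) u(2)]] by blast
  have l: "u \<cdot> (a \<cdot> t) \<in> hom C E (Dom C s)" "v' \<cdot> (b \<cdot> t) \<in> hom C E (Dom C s'')"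
    using u(1) v(2) d(1,3) t(1) Comp_hom by blast+
  have vt: "v \<cdot> (b \<cdot> t) = u' \<cdot> (a \<cdot> t)"
    using t(3) u(2) v(1) d(1,3) t(1) by (simp add: hom_iff)
  have e1: "s \<cdot> (u \<cdot> (a \<cdot> t)) = s' \<cdot> (u' \<cdot> (a \<cdot> t))"
    using u(1,2) h d(3) t(1) by (simp add: hom_iff assoc_eq[OF u(3)])
  have e2: "s'' \<cdot> (v' \<cdot> (b \<cdot> t)) = s' \<cdot> (v \<cdot> (b \<cdot> t))"
    using v(1,2) h d(1) t(1) by (simp add: hom_iff assoc_eq[OF v(3)[symmetric]])
  have e3: "f \<cdot> (u \<cdot> (a \<cdot> t)) = f' \<cdot> (u' \<cdot> (a \<cdot> t))"
    using u(1,2) h d(3) t(1) by (simp add: hom_iff assoc_eq[OF u(5)])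
  have e4: "f'' \<cdot> (v' \<cdot> (b \<cdot> t)) = f' \<cdot> (v \<cdot> (b \<cdot> t))"
    using v(1,2) h d(1) t(1) by (simp add: hom_iff assoc_eq[OF v(5)[symmetric]])
  have "((s' \<cdot> v) \<cdot> b) \<cdot> t \<in> W"
    using v(1,4) h d(1,2) t(1,2) W_comp[OF d(2) v(4)] by (intro W_comp[OF t(2)]) (simp_all add: hom_iff)
  then have "s' \<cdot> (v \<cdot> (b \<cdot> t)) \<in> W"
    using v(1) h d(1) t(1) by (simp add: hom_iff)
  then show ?thesis
    unfolding feq_def fst_conv snd_conv using e1 e2 e3 e4 vt
    by (intro exI[of _ E], intro bexI[OF _ l(1)], intro bexI[OF _ l(2)]) simp
qed

lemma fcl_eq_iff:
  assumes "x \<in> frac X Y" "y \<in> frac X Y"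
  shows "fcl X Y x = fcl X Y y \<longleftrightarrow> feq x y"
proof
  assume "fcl X Y x = fcl X Y y"
  then have "y \<in> fcl X Y x" using feq_refl assms(2) unfolding fcl_def by auto
  then show "feq x y" unfolding fcl_def by simp
next
  have tr: "feq a b \<Longrightarrow> feq b c \<Longrightarrow> a \<in> frac X Y \<Longrightarrow> b \<in> frac X Y \<Longrightarrow> c \<in> frac X Y \<Longrightarrow> feq a c" for a b c
    using feq_trans by (cases a; cases b; cases c) blast
  assume "feq x y"
  then show "fcl X Y x = fcl X Y y"
    unfolding fcl_def using assms tr feq_sym by blast
qed

definition frac_obj :: "'o \<Rightarrow> 'o \<Rightarrow> ('m \<times> 'm) set set" where
  "frac_obj X Y = fcl X Y ` frac X Y"

text \<open>All sets in the union coincide by \<open>feq_push\<close>, which avoids choosing a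
  representative.\<close>

definition frac_map :: "'o \<Rightarrow> 'm \<Rightarrow> ('m \<times> 'm) set \<Rightarrow> ('m \<times> 'm) set" where
  "frac_map X g = (\<lambda>c \<in> frac_obj X (Dom C g). \<Union>(s, f) \<in> c. fcl X (Cod C g) (s, g \<cdot> f))"

definition frac_functor :: "'o \<Rightarrow> ('o, 'm, ('m \<times> 'm) set set,
    ('m \<times> 'm) set set \<times> (('m \<times> 'm) set \<Rightarrow> ('m \<times> 'm) set) \<times> ('m \<times> 'm) set set) fctr" where
  "frac_functor X = \<lparr>fobj = frac_obj X, fmor = (\<lambda>g. (frac_obj X (Dom C g), frac_map X g, frac_obj X (Cod C g)))\<rparr>"

lemma frac_push: "(s, f) \<in> frac X Y \<Longrightarrow> g \<in> hom C Y Z \<Longrightarrow> (s, g \<cdot> f) \<in> frac X Z"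
  unfolding frac_def using Comp_hom by auto

lemma feq_push:
  assumes "feq (s, f) (s', f')" "(s, f) \<in> frac X Y" "(s', f') \<in> frac X Y" "g \<in> hom C Y Z"
  shows "feq (s, g \<cdot> f) (s', g \<cdot> f')"
proof -
  obtain A u u' where u: "u \<in> hom C A (Dom C s)" "u' \<in> hom C A (Dom C s')" "s \<cdot> u = s' \<cdot> u'"
    "s \<cdot> u \<in> W" "f \<cdot> u = f' \<cdot> u'" using assms(1) unfolding feq_def by auto
  have h: "f \<in> hom C (Dom C s) Y" "f' \<in> hom C (Dom C s') Y" using assms unfolding frac_def by auto
  have "(g \<cdot> f) \<cdot> u = (g \<cdot> f') \<cdot> u'" using h assms(4) u(1,2,5) by (simp add: hom_iff)
  then show ?thesis unfolding feq_def fst_conv snd_conv using u by blast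
qed

lemma frac_map_apply:
  assumes "(s, f) \<in> frac X Y" "g \<in> hom C Y Z"
  shows "frac_map X g (fcl X Y (s, f)) = fcl X Z (s, g \<cdot> f)"
proof -
  have "fcl X Y (s, f) \<in> frac_obj X Y" using assms unfolding frac_obj_def by blast
  then have "frac_map X g (fcl X Y (s, f)) = (\<Union>(s', f') \<in> fcl X Y (s, f). fcl X Z (s', g \<cdot> f'))"
    using assms(2) unfolding frac_map_def by (simp add: hom_iff)
  also have "\<dots> = fcl X Z (s, g \<cdot> f)"
  proof -
    have eq: "fcl X Z (s', g \<cdot> f') = fcl X Z (s, g \<cdot> f)" if "(s', f') \<in> fcl X Y (s, f)" for s' f'
    proof -
      have m: "(s', f') \<in> frac X Y" "feq (s, f) (s', f')" using that unfolding fcl_def by auto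
      show ?thesis
        using fcl_eq_iff[OF frac_push[OF assms] frac_push[OF m(1) assms(2)]]
          feq_push[OF m(2) assms(1) m(1) assms(2)] by simp
    qed
    have "(s, f) \<in> fcl X Y (s, f)" using feq_refl assms(1) unfolding fcl_def by simp
    then show ?thesis using eq by blast
  qed
  finally show ?thesis .
qed

lemma frac_map_funcset: "g \<in> hom C Y Z \<Longrightarrow> frac_map X g \<in> frac_obj X Y \<rightarrow>\<^sub>E frac_obj X Z"
proof
  fix c assume g: "g \<in> hom C Y Z" and "c \<in> frac_obj X Y"
  then obtain s f where "(s, f) \<in> frac X Y" "c = fcl X Y (s, f)" unfolding frac_obj_def by auto
  then show "frac_map X g c \<in> frac_obj X Z"
    using frac_map_apply[OF _ g] frac_push[OF _ g] unfolding frac_obj_def by auto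
qed (auto simp: frac_map_def hom_iff)

lemma is_functor_frac: "is_functor C set_cat (frac_functor X)"
  unfolding is_functor_def
proof (intro conjI ballI impI)
  show "category C" "category set_cat" by (rule category_axioms, rule category_set_cat)
  show "fobj (frac_functor X) Y \<in> Obj set_cat" for Y by simp
  show "fmor (frac_functor X) f \<in> hom set_cat (fobj (frac_functor X) (Dom C f)) (fobj (frac_functor X) (Cod C f))"
    if "f \<in> Arr C" for f
    using frac_map_funcset[of f "Dom C f" "Cod C f" X] that by (auto simp: hom_set_cat frac_functor_def hom_iff)
next
  fix Y assume Y: "Y \<in> Obj C"
  have "frac_map X (Ident C Y) c = restrict id (frac_obj X Y) c" for c
  proof (cases "c \<in> frac_obj X Y")
    case True
    then obtain s f where sf: "(s, f) \<in> frac X Y" "c = fcl X Y (s, f)" unfolding frac_obj_def by auto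
    then have "Ident C Y \<cdot> f = f" unfolding frac_def by (simp add: hom_iff)
    then show ?thesis using frac_map_apply[OF sf(1) Ident_hom[OF Y]] sf(2) True by simp
  qed (use Y in \<open>simp add: frac_map_def\<close>)
  then show "fmor (frac_functor X) (Ident C Y) = Ident set_cat (fobj (frac_functor X) Y)"
    using Y by (auto simp: frac_functor_def)
next
  fix f g assume fg: "f \<in> Arr C" "g \<in> Arr C" "Cod C f = Dom C g"
  then have f: "f \<in> hom C (Dom C f) (Dom C g)" and g: "g \<in> hom C (Dom C g) (Cod C g)" by (simp_all add: hom_iff)
  have "frac_map X (g \<cdot> f) c = compose (frac_obj X (Dom C f)) (frac_map X g) (frac_map X f) c" for c
  proof (cases "c \<in> frac_obj X (Dom C f)")
    case True
    then obtain s k where sk: "(s, k) \<in> frac X (Dom C f)" "c = fcl X (Dom C f) (s, k)" unfolding frac_obj_def by auto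
    then have "(g \<cdot> f) \<cdot> k = g \<cdot> (f \<cdot> k)" unfolding frac_def using fg by (simp add: hom_iff)
    then show ?thesis
      using frac_map_apply[OF sk(1) Comp_hom[OF f g]] frac_map_apply[OF sk(1) f]
        frac_map_apply[OF frac_push[OF sk(1) f] g] sk(2) True by (simp add: compose_def)
  qed (use fg in \<open>simp add: frac_map_def compose_def\<close>)
  then show "fmor (frac_functor X) (g \<cdot> f) = fmor (frac_functor X) g \<cdot>\<^bsub>set_cat\<^esub> fmor (frac_functor X) f"
    using fg by (auto simp: frac_functor_def)
qed

text \<open>Injectivity is the cancellation axiom and surjectivity the Ore condition.\<close>

lemma frac_functor_inverts:
  assumes w: "w \<in> Arr C" "w \<in> W"
  shows "iso set_cat (fmor (frac_functor X) w)"
proof -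
  let ?Y = "Dom C w" and ?Z = "Cod C w"
  have wh: "w \<in> hom C ?Y ?Z" using w by (simp add: hom_iff)
  have "bij_betw (frac_map X w) (frac_obj X ?Y) (frac_obj X ?Z)"
    unfolding bij_betw_def
  proof
    show "inj_on (frac_map X w) (frac_obj X ?Y)"
    proof (rule inj_onI)
      fix c c' assume "c \<in> frac_obj X ?Y" "c' \<in> frac_obj X ?Y" and eq: "frac_map X w c = frac_map X w c'"
      then obtain s f s' f' where c: "(s, f) \<in> frac X ?Y" "c = fcl X ?Y (s, f)"
         "(s', f') \<in> frac X ?Y" "c' = fcl X ?Y (s', f')" unfolding frac_obj_def by auto
      have h: "f \<in> hom C (Dom C s) ?Y" "f' \<in> hom C (Dom C s') ?Y" "s \<in> hom C (Dom C s) X" "s' \<in> hom C (Dom C s') X"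
        using c(1,3) W_arr unfolding frac_def by (auto simp: hom_iff)
      have "feq (s, w \<cdot> f) (s', w \<cdot> f')"
        using eq c frac_map_apply[OF c(1) wh] frac_map_apply[OF c(3) wh]
          fcl_eq_iff[OF frac_push[OF c(1) wh] frac_push[OF c(3) wh]] by simp
      then obtain A u u' where u: "u \<in> hom C A (Dom C s)" "u' \<in> hom C A (Dom C s')" "s \<cdot> u = s' \<cdot> u'"
        "s \<cdot> u \<in> W" "(w \<cdot> f) \<cdot> u = (w \<cdot> f') \<cdot> u'" unfolding feq_def by auto
      have "w \<cdot> (f \<cdot> u) = w \<cdot> (f' \<cdot> u')" using u(1,2,5) h wh by (simp add: hom_iff)
      then obtain V t where t: "t \<in> hom C V A" "t \<in> W" "f \<cdot> u \<cdot> t = f' \<cdot> u' \<cdot> t"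
        using cancel[OF wh w(2) Comp_hom[OF u(1) h(1)] Comp_hom[OF u(2) h(2)]] by blast
      have "(s \<cdot> u) \<cdot> t \<in> W" by (rule W_comp[OF t(2) u(4)]) (use t(1) u(1) h in \<open>simp add: hom_iff\<close>)
      then have "s \<cdot> (u \<cdot> t) \<in> W" using t(1) u(1) h by (simp add: hom_iff)
      moreover have "s \<cdot> (u \<cdot> t) = s' \<cdot> (u' \<cdot> t)" using t(1) u(1,2) h by (simp add: hom_iff assoc_eq[OF u(3)])
      moreover have "f \<cdot> (u \<cdot> t) = f' \<cdot> (u' \<cdot> t)" using t u(1,2) h by (simp add: hom_iff)
      ultimately have "feq (s, f) (s', f')"
        unfolding feq_def fst_conv snd_conv using Comp_hom[OF t(1) u(1)] Comp_hom[OF t(1) u(2)] by blast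
      then show "c = c'" using c fcl_eq_iff by blast
    qed
    show "frac_map X w ` frac_obj X ?Y = frac_obj X ?Z"
    proof
      show "frac_map X w ` frac_obj X ?Y \<subseteq> frac_obj X ?Z" using frac_map_funcset[OF wh, of X] by auto
      show "frac_obj X ?Z \<subseteq> frac_map X w ` frac_obj X ?Y"
      proof
        fix c assume "c \<in> frac_obj X ?Z"
        then obtain s f where c: "(s, f) \<in> frac X ?Z" "c = fcl X ?Z (s, f)" unfolding frac_obj_def by auto
        have h: "s \<in> hom C (Dom C s) X" "f \<in> hom C (Dom C s) ?Z" "s \<in> W"
          using c(1) W_arr unfolding frac_def by (auto simp: hom_iff)
        obtain P v f' where p: "v \<in> hom C P (Dom C s)" "v \<in> W" "f' \<in> hom C P ?Y" "f \<cdot> v = w \<cdot> f'"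
          using ore[OF wh w(2) h(2)] by blast
        have sv: "s \<cdot> v \<in> W" by (rule W_comp[OF p(2) h(3)]) (use p(1) h in \<open>simp add: hom_iff\<close>)
        have fr: "(s \<cdot> v, f') \<in> frac X ?Y" using sv p(1,3) h unfolding frac_def by (simp add: hom_iff)
        have "feq (s \<cdot> v, w \<cdot> f') (s, f)"
          unfolding feq_def fst_conv snd_conv
          by (rule exI[of _ P], rule bexI[of _ "Ident C P"], rule bexI[OF _ p(1)])
            (use p(1,3,4) h wh sv in \<open>auto simp: hom_iff\<close>)
        then have "frac_map X w (fcl X ?Y (s \<cdot> v, f')) = c"
          using frac_map_apply[OF fr wh] fcl_eq_iff[OF frac_push[OF fr wh] c(1)] c(2) by simp
        then show "c \<in> frac_map X w ` frac_obj X ?Y" using fr unfolding frac_obj_def by blast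
      qed
    qed
  qed
  then show ?thesis using set_cat_iso[OF frac_map_funcset[OF wh]] by (simp add: frac_functor_def)
qed

text \<open>The functor of fractions under \<open>X\<close> factors through the localisation, so it
  takes \<open>a\<close> and \<open>b\<close> to the same map. As in the Yoneda lemma, this map is
  evaluated at the fraction whose two legs are the identity of \<open>X\<close>.\<close>

lemma localisation_eqD:
  assumes ab: "a \<in> hom C X Y" "b \<in> hom C X Y" and eq: "qm W a = qm W b"
  shows "\<exists>V t. t \<in> hom C V X \<and> t \<in> W \<and> a \<cdot> t = b \<cdot> t"
proof -
  interpret inverting_functor C set_cat "frac_functor X" W
    by unfold_locales (use is_functor_frac frac_functor_inverts in auto)
  have "fmor (frac_functor X) a = fmor (frac_functor X) b"
    using lift_fmor[of a] lift_fmor[of b] ab eq by (simp add: hom_iff)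
  then have m: "frac_map X a = frac_map X b" by (simp add: frac_functor_def)
  have X: "X \<in> Obj C" using ab hom_obj by blast
  have fr: "(Ident C X, Ident C X) \<in> frac X X" unfolding frac_def using X W_ident by (simp add: hom_iff)
  have "fcl X Y (Ident C X, a \<cdot> Ident C X) = fcl X Y (Ident C X, b \<cdot> Ident C X)"
    using frac_map_apply[OF fr ab(1)] frac_map_apply[OF fr ab(2)] m by simp
  then have "feq (Ident C X, a \<cdot> Ident C X) (Ident C X, b \<cdot> Ident C X)"
    using fcl_eq_iff frac_push[OF fr ab(1)] frac_push[OF fr ab(2)] by blast
  then show ?thesis unfolding feq_def using ab X by (auto simp: hom_iff)
qed

end

section \<open>Serre subcategories\<close>

locale serre = abelian_cat C for C :: "('o, 'm, 'z) cat_scheme" (structure) +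
  fixes K :: "'o set"
  assumes serre: "serre_subcategory C K"
begin

lemma K_obj: "X \<in> K \<Longrightarrow> X \<in> Obj C"
  using serre unfolding serre_subcategory_def by blast

lemma K_mono: "mono_arr C f \<Longrightarrow> Cod C f \<in> K \<Longrightarrow> Dom C f \<in> K"
  using serre unfolding serre_subcategory_def by blast

lemma K_epi: "epi_arr C f \<Longrightarrow> Dom C f \<in> K \<Longrightarrow> Cod C f \<in> K"
  using serre unfolding serre_subcategory_def by blast

lemma K_extension:
  "is_kernel C g f \<Longrightarrow> is_cokernel C f g \<Longrightarrow> Dom C f \<in> K \<Longrightarrow> Cod C g \<in> K \<Longrightarrow> Cod C f \<in> K"
  using serre unfolding serre_subcategory_def short_exact_def by blast

text \<open>A Serre subcategory is required to be nonempty, and a zero object embeds in any of its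
  members.\<close>

lemma K_zero:
  assumes Z: "zero_obj C Z"
  shows "Z \<in> K"
proof -
  obtain X where X: "X \<in> K" using serre unfolding serre_subcategory_def by blast
  obtain a where a: "a \<in> hom C Z X" using zero_obj_hom_ex[OF Z K_obj[OF X]] .
  have "mono_arr C a"
    using a zero_obj_unique(1)[OF Z] unfolding mono_arr_def by (auto simp: hom_iff)
  then show ?thesis using K_mono[of a] a X by (simp add: hom_iff)
qed

lemma serre_op: "serre (op_cat C) K"
proof -
  interpret op: abelian_cat "op_cat C" by (rule abelian_op)
  show ?thesis
  proof
    show "serre_subcategory (op_cat C) K"
      unfolding serre_subcategory_def short_exact_def op_cat_simps mono_arr_op epi_arr_op
        is_kernel_op is_cokernel_op
    proof (intro conjI allI impI)
      show "K \<subseteq> Obj C" "K \<noteq> {}" using serre unfolding serre_subcategory_def by blast+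
      show "Cod C f \<in> K" if "epi_arr C f \<and> Dom C f \<in> K" for f using K_epi that by blast
      show "Dom C f \<in> K" if "mono_arr C f \<and> Cod C f \<in> K" for f using K_mono that by blast
      fix f g assume "(is_cokernel C g f \<and> is_kernel C f g) \<and> Cod C f \<in> K \<and> Dom C g \<in> K"
      then show "Dom C f \<in> K"
        using K_extension[of f g] cokernel_arr(3)[of g f] by simp
    qed
  qed
qed

text \<open>The domain of \<open>r\<close> is an extension of the image of \<open>r\<close> by its
  kernel, and the image is a subobject of the codomain.\<close>

lemma K_middle:
  assumes k: "is_kernel C r k" "Dom C k \<in> K" "Cod C r \<in> K"
  shows "Dom C r \<in> K"
proof -
  note ka = kernel_arr[OF k(1)]
  obtain I e m where em: "e \<in> hom C (Dom C r) I" "m \<in> hom C I (Cod C r)" "m \<cdot> e = r"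
    "epi_arr C e" "mono_arr C m"
    using factorisation[of r "Dom C r" "Cod C r"] ka by (auto simp: hom_iff)
  have ke: "is_kernel C e k"
    by (rule kernel_of_post_mono[OF _ em(5)]) (use k em in \<open>simp_all add: hom_iff\<close>)
  have "I \<in> K" using K_mono[OF em(5)] em(2) k by (simp add: hom_iff)
  then show ?thesis
    using K_extension[OF ke epi_cokernel_of_kernel[OF em(4) ke] k(2)] em(1) ka by (simp add: hom_iff)
qed

section \<open>Arrows with kernel and cokernel in the Serre subcategory\<close>

abbreviation "W \<equiv> serre_arrows C K"

lemma W_arr: "w \<in> W \<Longrightarrow> w \<in> Arr C"
  unfolding serre_arrows_def by simp

lemma W_I: "is_kernel C f k \<Longrightarrow> is_cokernel C f c \<Longrightarrow> Dom C k \<in> K \<Longrightarrow> Cod C c \<in> K \<Longrightarrow> f \<in> W"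
  unfolding serre_arrows_def using kernel_arr by blast

lemma serre_arrows_op: "serre_arrows (op_cat C) K = W"
  unfolding serre_arrows_def by auto

lemma W_kernel:
  assumes "f \<in> W" "is_kernel C f k"
  shows "Dom C k \<in> K"
proof -
  obtain k' where k': "is_kernel C f k'" "Dom C k' \<in> K" using assms unfolding serre_arrows_def by blast
  obtain u where "u \<in> hom C (Dom C k) (Dom C k')" "iso C u" using kernel_iso[OF k'(1) assms(2)] .
  then show ?thesis using K_mono[OF iso_mono, of u] k' by (simp add: hom_iff)
qed

lemma W_cokernel: "f \<in> W \<Longrightarrow> is_cokernel C f c \<Longrightarrow> Cod C c \<in> K"
  using serre.W_kernel[OF serre_op, of f c] serre_arrows_op by simp

lemma W_mono:
  assumes "mono_arr C f" "is_cokernel C f c" "Cod C c \<in> K"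
  shows "f \<in> W"
proof -
  obtain k where k: "is_kernel C f k" using kernel_ex cokernel_arr[OF assms(2)] by blast
  show ?thesis using W_I[OF k assms(2)] assms(3) K_zero mono_kernel_zero[OF assms(1) k] by blast
qed

lemma W_epi:
  assumes "epi_arr C f" "is_kernel C f k" "Dom C k \<in> K"
  shows "f \<in> W"
proof -
  obtain c where c: "is_cokernel C f c" using cokernel_ex kernel_arr[OF assms(2)] by blast
  show ?thesis using W_I[OF assms(2) c assms(3)] K_zero epi_cokernel_zero[OF assms(1) c] by blast
qed

lemma W_ident:
  assumes "X \<in> Obj C" shows "Ident C X \<in> W"
proof -
  have X: "Ident C X \<in> Arr C" using assms by simp
  obtain k where k: "is_kernel C (Ident C X) k" using kernel_ex[OF X] .
  show ?thesis
    using W_epi[OF iso_epi[OF iso_ident[OF assms]] k] K_zero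
      mono_kernel_zero[OF iso_mono[OF iso_ident[OF assms]] k] by blast
qed

text \<open>The kernel of \<open>w \<cdot> v\<close> maps to the kernel of \<open>w\<close> by
  \<open>r\<close>, and the kernel of \<open>r\<close> embeds in the kernel of \<open>v\<close> by
  \<open>x\<close>. So \<open>K_middle\<close> applies to \<open>r\<close>.\<close>

lemma kernel_comp_in_K:
  assumes vw: "v \<in> W" "w \<in> W" "Dom C w = Cod C v" and k: "is_kernel C (w \<cdot> v) k"
  shows "Dom C k \<in> K"
proof -
  have va: "v \<in> Arr C" "w \<in> Arr C" using vw W_arr by auto
  have kh: "k \<in> hom C (Dom C k) (Dom C v)" using kernel_arr[OF k] va vw(3) by (simp add: hom_iff)
  obtain kv where kv: "is_kernel C v kv" using kernel_ex[OF va(1)] .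
  obtain kw where kw: "is_kernel C w kw" using kernel_ex[OF va(2)] .
  note kva = kernel_arr[OF kv] and kwa = kernel_arr[OF kw]
  have "zero_arr C (w \<cdot> (v \<cdot> k))" using kernel_arr(4)[OF k] va vw(3) kh by (simp add: hom_iff)
  then obtain r where r: "r \<in> hom C (Dom C k) (Dom C kw)" "kw \<cdot> r = v \<cdot> k"
    using kernel_lift[OF kw, of "v \<cdot> k" "Dom C k"] kh va vw(3) by (auto simp: hom_iff)
  obtain n where n: "is_kernel C r n" using kernel_ex r by (auto simp: hom_iff)
  note na = kernel_arr[OF n]
  have nh: "n \<in> hom C (Dom C n) (Dom C k)" using na r(1) by (simp add: hom_iff)
  have "zero_arr C (kw \<cdot> (r \<cdot> n))"
    by (rule zero_arr_comp1[OF na(4)]) (use nh r(1) kwa in \<open>simp_all add: hom_iff\<close>)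
  then have "zero_arr C (v \<cdot> (k \<cdot> n))"
    using nh r(1) kwa kh va by (simp add: hom_iff assoc_eq[OF r(2)])
  then obtain x where x: "x \<in> hom C (Dom C n) (Dom C kv)" "kv \<cdot> x = k \<cdot> n"
    using kernel_lift[OF kv Comp_hom[OF nh kh]] by metis
  have kvh: "kv \<in> hom C (Dom C kv) (Dom C v)" using kva by (simp add: hom_iff)
  have "mono_arr C (k \<cdot> n)"
    by (rule mono_comp[OF kernel_mono[OF n] kernel_mono[OF k]]) (use nh in \<open>simp add: hom_iff\<close>)
  then have "mono_arr C x" using mono_of_comp[OF _ x(1) kvh] x(2) by simp
  then have "Dom C n \<in> K" using K_mono[of x] x(1) W_kernel[OF vw(1) kv] by (simp add: hom_iff)
  then show ?thesis using K_middle[OF n] W_kernel[OF vw(2) kw] r(1) by (simp add: hom_iff)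
qed

lemma W_comp:
  assumes vw: "v \<in> W" "w \<in> W" "Dom C w = Cod C v"
  shows "w \<cdot> v \<in> W"
proof -
  have wv: "w \<cdot> v \<in> Arr C" using vw W_arr by auto
  obtain k where k: "is_kernel C (w \<cdot> v) k" using kernel_ex[OF wv] .
  obtain c where c: "is_cokernel C (w \<cdot> v) c" using cokernel_ex[OF wv] .
  have "Cod C c \<in> K"
    using serre.kernel_comp_in_K[OF serre_op, of w v c] c vw serre_arrows_op by simp
  then show ?thesis using W_I[OF k c kernel_comp_in_K[OF vw k]] by blast
qed

text \<open>Reduces the Ore condition to two cases: a monomorphism with cokernel in
  \<open>K\<close>, and an epimorphism with kernel in \<open>K\<close>.\<close>

lemma W_factorisation:
  assumes "s \<in> hom C X Y" "s \<in> W"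
  obtains I e m k c where "e \<in> hom C X I" "m \<in> hom C I Y" "m \<cdot> e = s" "epi_arr C e" "mono_arr C m"
    "is_kernel C e k" "Dom C k \<in> K" "is_cokernel C m c" "Cod C c \<in> K"
proof -
  obtain I e m where em: "e \<in> hom C X I" "m \<in> hom C I Y" "m \<cdot> e = s" "epi_arr C e" "mono_arr C m"
    using factorisation[OF assms(1)] .
  obtain k where k: "is_kernel C s k" using kernel_ex W_arr assms by blast
  obtain c where c: "is_cokernel C s c" using cokernel_ex W_arr assms by blast
  have "is_kernel C e k"
    by (rule kernel_of_post_mono[OF _ em(5)]) (use k em in \<open>simp_all add: hom_iff\<close>)
  moreover have "is_cokernel C m c"
    using category.kernel_of_post_mono[OF category_op, of e m c] c em by (simp add: hom_iff)
  ultimately show ?thesis using that em W_kernel[OF assms(2) k] W_cokernel[OF assms(2) c] by blast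
qed

text \<open>The arrow \<open>m'\<close> is the preimage of the subobject \<open>m\<close> under
  \<open>f\<close>, taken as the kernel of \<open>c \<cdot> f\<close>. The quotient \<open>I\<close>
  of \<open>X\<close> by it is the image of \<open>c \<cdot> f\<close>, a subobject of the cokernel
  of \<open>m\<close>.\<close>

lemma ore_mono:
  assumes m: "m \<in> hom C Y' Y" "mono_arr C m" "is_cokernel C m c" "Cod C c \<in> K" and f: "f \<in> hom C X Y"
  obtains X' m' f' where "m' \<in> hom C X' X" "m' \<in> W" "f' \<in> hom C X' Y'" "f \<cdot> m' = m \<cdot> f'"
proof -
  have ch: "c \<in> hom C Y (Cod C c)" using cokernel_arr[OF m(3)] m(1) by (simp add: hom_iff)
  obtain m' where m': "is_kernel C (c \<cdot> f) m'" using kernel_ex Comp_hom[OF f ch] by (auto simp: hom_iff)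
  have mh: "m' \<in> hom C (Dom C m') X" using kernel_arr[OF m'] f ch by (simp add: hom_iff)
  have "zero_arr C (c \<cdot> (f \<cdot> m'))" using kernel_arr(4)[OF m'] mh f ch by (simp add: hom_iff)
  then obtain f' where f': "f' \<in> hom C (Dom C m') Y'" "m \<cdot> f' = f \<cdot> m'"
    using kernel_lift[OF mono_kernel_of_cokernel[OF m(2,3)], of "f \<cdot> m'" "Dom C m'"] mh f m(1) ch
    by (auto simp: hom_iff)
  obtain I e n where en: "e \<in> hom C X I" "n \<in> hom C I (Cod C c)" "n \<cdot> e = c \<cdot> f" "epi_arr C e" "mono_arr C n"
    using factorisation[OF Comp_hom[OF f ch]] .
  have ke: "is_kernel C e m'"
    by (rule kernel_of_post_mono[OF _ en(5)]) (use m' en in \<open>simp_all add: hom_iff\<close>)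
  have "I \<in> K" using K_mono[OF en(5)] en(2) m(4) by (simp add: hom_iff)
  then have "m' \<in> W"
    using W_mono[OF kernel_mono[OF ke] epi_cokernel_of_kernel[OF en(4) ke]] en(1) by (simp add: hom_iff)
  then show ?thesis using that mh f' by metis
qed

text \<open>In the pullback \<open>e'\<close> is again epic, and \<open>f'\<close> maps its kernel
  to the kernel of \<open>e\<close>. This map \<open>r\<close> is monic because \<open>e'\<close>
  and \<open>f'\<close> are jointly monic, so the kernel of \<open>e'\<close> lies in
  \<open>K\<close>.\<close>

lemma ore_epi:
  assumes e: "e \<in> hom C Y' Y" "epi_arr C e" "is_kernel C e k" "Dom C k \<in> K" and f: "f \<in> hom C X Y"
  obtains X' e' f' where "e' \<in> hom C X' X" "e' \<in> W" "f' \<in> hom C X' Y'" "f \<cdot> e' = e \<cdot> f'"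
proof -
  obtain P e' f' where p: "e' \<in> hom C P X" "f' \<in> hom C P Y'" "f \<cdot> e' = e \<cdot> f'" "epi_arr C e'"
    "\<And>V n. n \<in> hom C V P \<Longrightarrow> zero_arr C (e' \<cdot> n) \<Longrightarrow> zero_arr C (f' \<cdot> n) \<Longrightarrow> zero_arr C n"
    using epi_pullback[OF e(1,2) f] by metis
  obtain n where n: "is_kernel C e' n" using kernel_ex p by (auto simp: hom_iff)
  note na = kernel_arr[OF n]
  have nh: "n \<in> hom C (Dom C n) P" using na p by (simp add: hom_iff)
  have "zero_arr C (f \<cdot> (e' \<cdot> n))"
    by (rule zero_arr_comp1[OF na(4)]) (use nh f p(1) in \<open>simp_all add: hom_iff\<close>)
  then have "zero_arr C (e \<cdot> (f' \<cdot> n))"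
    using nh f p(1,2) e(1) by (simp add: hom_iff assoc_eq[OF p(3)[symmetric]])
  moreover have "f' \<cdot> n \<in> hom C (Dom C n) (Dom C e)" using nh p(2) e(1) by (simp add: hom_iff)
  ultimately obtain r where r: "r \<in> hom C (Dom C n) (Dom C k)" "k \<cdot> r = f' \<cdot> n"
    using kernel_lift[OF e(3)] by metis
  have kh: "k \<in> hom C (Dom C k) Y'" using kernel_arr[OF e(3)] e(1) by (simp add: hom_iff)
  have "mono_arr C r"
  proof (rule monoI[OF r(1)])
    fix V g assume g: "g \<in> hom C V (Dom C n)" "zero_arr C (r \<cdot> g)"
    have "zero_arr C (k \<cdot> (r \<cdot> g))" by (rule zero_arr_comp1[OF g(2)]) (use g(1) r(1) kh in \<open>simp_all add: hom_iff\<close>)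
    then have "zero_arr C (f' \<cdot> (n \<cdot> g))" using g(1) r(1) kh nh p(2) by (simp add: hom_iff assoc_eq[OF r(2)])
    moreover have "zero_arr C ((e' \<cdot> n) \<cdot> g)"
      by (rule zero_arr_comp2[OF na(4)]) (use g(1) nh p(1) in \<open>simp_all add: hom_iff\<close>)
    ultimately have "zero_arr C (n \<cdot> g)"
      using p(5)[OF Comp_hom[OF g(1) nh]] g(1) nh p(1) by (simp add: hom_iff)
    then show "zero_arr C g" using zero_arr_cancel_mono[OF kernel_mono[OF n] g(1)] by blast
  qed
  then have "Dom C n \<in> K" using K_mono[of r] r(1) e(4) by (simp add: hom_iff)
  then show ?thesis using that[OF p(1) W_epi[OF p(4) n] p(2,3)] by blast
qed

lemma right_calculus_W: "right_calculus C W"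
proof
  fix s f X Y Y' assume s: "s \<in> hom C Y' Y" "s \<in> W" and f: "f \<in> hom C X Y"
  obtain I e m k c where em: "e \<in> hom C Y' I" "m \<in> hom C I Y" "m \<cdot> e = s" "epi_arr C e" "mono_arr C m"
    "is_kernel C e k" "Dom C k \<in> K" "is_cokernel C m c" "Cod C c \<in> K"
    using W_factorisation[OF s] .
  obtain X1 m' f1 where m': "m' \<in> hom C X1 X" "m' \<in> W" "f1 \<in> hom C X1 I" "f \<cdot> m' = m \<cdot> f1"
    using ore_mono[OF em(2,5,8,9) f] .
  obtain X2 e' f2 where e': "e' \<in> hom C X2 X1" "e' \<in> W" "f2 \<in> hom C X2 Y'" "f1 \<cdot> e' = e \<cdot> f2"
    using ore_epi[OF em(1,4,6,7) m'(3)] .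
  have "f \<cdot> (m' \<cdot> e') = s \<cdot> f2"
    unfolding em(3)[symmetric] using em(1,2) m'(1,3) e'(1,3) f
    by (simp add: hom_iff assoc_eq[OF m'(4)] e'(4))
  moreover have "m' \<cdot> e' \<in> W" using W_comp[OF e'(2) m'(2)] e'(1) m'(1) by (simp add: hom_iff)
  ultimately show "\<exists>P s' f'. s' \<in> hom C P X \<and> s' \<in> W \<and> f' \<in> hom C P Y' \<and> f \<cdot> s' = s \<cdot> f'"
    using Comp_hom[OF e'(1) m'(1)] e'(3) by blast
next
  fix s a b X Y Z assume s: "s \<in> hom C Y Z" "s \<in> W" and ab: "a \<in> hom C X Y" "b \<in> hom C X Y" "s \<cdot> a = s \<cdot> b"
  have ob: "X \<in> Obj C" "Y \<in> Obj C" using ab hom_obj by auto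
  \<comment> \<open>With \<open>d\<close> the difference of \<open>a\<close> and \<open>b\<close>,
    the image \<open>I\<close> of \<open>d\<close> embeds in the kernel of \<open>s\<close> and so
    lies in \<open>K\<close>. The kernel \<open>t\<close> of \<open>d\<close> equalises
    \<open>a\<close> and \<open>b\<close>, and its cokernel is \<open>I\<close>.\<close>
  obtain d where d: "d \<in> hom C X Y" "\<And>V W r t. t \<in> hom C V X \<Longrightarrow> r \<in> hom C Y W \<Longrightarrow>
      r \<cdot> (a \<cdot> t) = r \<cdot> (b \<cdot> t) \<longleftrightarrow> zero_arr C (r \<cdot> (d \<cdot> t))"
    using diff_ex[OF ab(1,2)] by metis
  have sd: "zero_arr C (s \<cdot> d)"
    using d(2)[OF Ident_hom[OF ob(1)] s(1)] ab d(1) by (simp add: hom_iff)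
  obtain t where t: "is_kernel C d t" using kernel_ex d(1) by (auto simp: hom_iff)
  have th: "t \<in> hom C (Dom C t) X" using kernel_arr[OF t] d(1) by (simp add: hom_iff)
  obtain I e m where em: "e \<in> hom C X I" "m \<in> hom C I Y" "m \<cdot> e = d" "epi_arr C e" "mono_arr C m"
    using factorisation[OF d(1)] .
  obtain k where k: "is_kernel C s k" using kernel_ex s W_arr by blast
  have kh: "k \<in> hom C (Dom C k) Y" using kernel_arr[OF k] s(1) by (simp add: hom_iff)
  have "zero_arr C (s \<cdot> m)"
  proof (rule zero_arr_cancel_epi[OF em(4)])
    show "s \<cdot> m \<in> hom C (Cod C e) Z" using s em by (simp add: hom_iff)
    show "zero_arr C (s \<cdot> m \<cdot> e)" using sd em s by (simp add: hom_iff)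
  qed
  then obtain r where r: "r \<in> hom C I (Dom C k)" "k \<cdot> r = m"
    using kernel_lift[OF k, of m I] em(2) s(1) by (auto simp: hom_iff)
  have "mono_arr C r" using mono_of_comp[OF _ r(1) kh] r(2) em(5) by simp
  then have I: "I \<in> K" using K_mono[of r] r(1) W_kernel[OF s(2) k] by (simp add: hom_iff)
  have ke: "is_kernel C e t"
    by (rule kernel_of_post_mono[OF _ em(5)]) (use t em in \<open>simp_all add: hom_iff\<close>)
  have "t \<in> W"
    using W_mono[OF kernel_mono[OF t] epi_cokernel_of_kernel[OF em(4) ke]] I em(1) by (simp add: hom_iff)
  moreover have "a \<cdot> t = b \<cdot> t"
    using d(2)[OF th Ident_hom[OF ob(2)]] kernel_arr(4)[OF t] ab th d(1) by (simp add: hom_iff)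
  ultimately show "\<exists>V t. t \<in> hom C V X \<and> t \<in> W \<and> a \<cdot> t = b \<cdot> t" using th by blast
qed (use W_arr W_ident W_comp in auto)

end

section \<open>Functors with fractions on both sides\<close>

text \<open>Abstracts from the localisation what the rest needs. Denominators are described by their
  images being invertible, and the axioms are self-dual. Zigzag classes over \<open>op_cat A\<close>
  differ from those over \<open>A\<close>, so a concrete localisation could not be dualised by
  rewriting; the abstract \<open>L\<close> is simply replaced by \<open>op_cat L\<close>.\<close>

locale fraction_functor = A: abelian_cat A for A :: "('o, 'm, 'z) cat_scheme" (structure) +
  fixes L :: "('o, 'n, 'y) cat_scheme" and Q :: "('o, 'm, 'o, 'n) fctr"
  assumes Q: "is_functor A L Q"
    and Q_obj: "fobj Q X = X" and L_obj: "Obj L = Obj A"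
    and right_fraction: "\<phi> \<in> hom L X Y \<Longrightarrow> \<exists>V s f. s \<in> hom A V X \<and> iso L (fmor Q s) \<and>
      f \<in> hom A V Y \<and> \<phi> \<cdot>\<^bsub>L\<^esub> fmor Q s = fmor Q f"
    and left_fraction: "\<phi> \<in> hom L X Y \<Longrightarrow> \<exists>V s f. s \<in> hom A Y V \<and> iso L (fmor Q s) \<and>
      f \<in> hom A X V \<and> fmor Q s \<cdot>\<^bsub>L\<^esub> \<phi> = fmor Q f"
    and right_eq: "\<lbrakk>a \<in> hom A X Y; b \<in> hom A X Y; fmor Q a = fmor Q b\<rbrakk> \<Longrightarrow>
      \<exists>V t. t \<in> hom A V X \<and> iso L (fmor Q t) \<and> a \<cdot> t = b \<cdot> t"
    and left_eq: "\<lbrakk>a \<in> hom A X Y; b \<in> hom A X Y; fmor Q a = fmor Q b\<rbrakk> \<Longrightarrow>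
      \<exists>V t. t \<in> hom A Y V \<and> iso L (fmor Q t) \<and> t \<cdot> a = t \<cdot> b"
begin

sublocale L: category L by (rule functorD(2)[OF Q])

lemma fraction_functor_op: "fraction_functor (op_cat A) (op_cat L) Q"
proof -
  interpret op: abelian_cat "op_cat A" by (rule A.abelian_op)
  show ?thesis
    by unfold_locales (use functor_op[OF Q] Q_obj L_obj right_fraction left_fraction right_eq left_eq in simp_all)
qed

lemma Q_hom: "f \<in> hom A X Y \<Longrightarrow> fmor Q f \<in> hom L X Y"
  using functorD(4)[OF Q] Q_obj by simp

lemmas Q_comp = functorD(6)[OF Q]

lemma Q_ident: "X \<in> Obj A \<Longrightarrow> fmor Q (Ident A X) = Ident L X"
  using functorD(5)[OF Q] Q_obj by simp

text \<open>The second fraction is taken of \<open>\<psi>\<close> already composed with the first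
  denominator \<open>s\<close>, so refining \<open>s\<close> by \<open>t\<close> serves both
  arrows.\<close>

lemma common_fraction:
  assumes "\<phi> \<in> hom L X Y" "\<psi> \<in> hom L X Z"
  obtains V s f g where "s \<in> hom A V X" "iso L (fmor Q s)" "f \<in> hom A V Y" "g \<in> hom A V Z"
    "\<phi> \<cdot>\<^bsub>L\<^esub> fmor Q s = fmor Q f" "\<psi> \<cdot>\<^bsub>L\<^esub> fmor Q s = fmor Q g"
proof -
  obtain V s f where s: "s \<in> hom A V X" "iso L (fmor Q s)" "f \<in> hom A V Y" "\<phi> \<cdot>\<^bsub>L\<^esub> fmor Q s = fmor Q f"
    using right_fraction[OF assms(1)] by blast
  obtain U t g where t: "t \<in> hom A U V" "iso L (fmor Q t)" "g \<in> hom A U Z"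
    "(\<psi> \<cdot>\<^bsub>L\<^esub> fmor Q s) \<cdot>\<^bsub>L\<^esub> fmor Q t = fmor Q g"
    using right_fraction[OF L.Comp_hom[OF Q_hom[OF s(1)] assms(2)]] by blast
  note h = Q_hom[OF s(1)] Q_hom[OF t(1)] assms
  have "iso L (fmor Q (s \<cdot> t))"
    unfolding Q_comp[OF t(1) s(1)] by (rule L.iso_comp[OF t(2) s(2)]) (use h in \<open>simp add: hom_iff\<close>)
  moreover have "\<phi> \<cdot>\<^bsub>L\<^esub> fmor Q (s \<cdot> t) = fmor Q (f \<cdot> t)"
    unfolding Q_comp[OF t(1) s(1)] Q_comp[OF t(1) s(3)] s(4)[symmetric] using h by (simp add: hom_iff)
  moreover have "\<psi> \<cdot>\<^bsub>L\<^esub> fmor Q (s \<cdot> t) = fmor Q g"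
    unfolding Q_comp[OF t(1) s(1)] t(4)[symmetric] using h by (simp add: hom_iff)
  ultimately show ?thesis using that A.Comp_hom[OF t(1) s(1)] A.Comp_hom[OF t(1) s(3)] t(3) by blast
qed

lemma cancel_iso:
  assumes "\<phi> \<in> hom L X Y" "\<psi> \<in> hom L X Y" "s \<in> hom A V X" "iso L (fmor Q s)"
    "\<phi> \<cdot>\<^bsub>L\<^esub> fmor Q s = \<psi> \<cdot>\<^bsub>L\<^esub> fmor Q s"
  shows "\<phi> = \<psi>"
  by (rule L.epiD[OF L.iso_epi[OF assms(4)] assms(5)]) (use assms Q_hom[OF assms(3)] in \<open>simp_all add: hom_iff\<close>)

section \<open>Preservation of zero objects, kernels and biproducts\<close>

lemma hom_to_zero:
  assumes Z: "zero_obj A Z" and X: "X \<in> Obj L"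
  shows "\<exists>!\<phi>. \<phi> \<in> hom L X Z"
proof -
  obtain a where a: "a \<in> hom A X Z" using A.zero_obj_hom_ex[OF Z] X L_obj by metis
  show ?thesis
  proof (rule ex1I[of _ "fmor Q a"])
    show "fmor Q a \<in> hom L X Z" using Q_hom[OF a] .
    fix \<psi> assume psi: "\<psi> \<in> hom L X Z"
    obtain V s f where s: "s \<in> hom A V X" "iso L (fmor Q s)" "f \<in> hom A V Z" "\<psi> \<cdot>\<^bsub>L\<^esub> fmor Q s = fmor Q f"
      using right_fraction[OF psi] by blast
    have "f = a \<cdot> s" using A.zero_obj_unique(1)[OF Z s(3) A.Comp_hom[OF s(1) a]] .
    then have "\<psi> \<cdot>\<^bsub>L\<^esub> fmor Q s = fmor Q a \<cdot>\<^bsub>L\<^esub> fmor Q s" using s(4) Q_comp[OF s(1) a] by simp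
    then show "\<psi> = fmor Q a" using cancel_iso[OF psi Q_hom[OF a] s(1,2)] by blast
  qed
qed

lemma Q_zero_obj:
  assumes "zero_obj A Z" shows "zero_obj L Z"
proof -
  interpret op: fraction_functor "op_cat A" "op_cat L" Q by (rule fraction_functor_op)
  have "Z \<in> Obj L" using assms L_obj unfolding zero_obj_def by simp
  then show ?thesis
    unfolding zero_obj_def using hom_to_zero[OF assms] op.hom_to_zero[of Z] assms by auto
qed

lemma Q_zero_arr:
  assumes "zero_arr A z" shows "zero_arr L (fmor Q z)"
proof -
  obtain Z a b where Z: "zero_obj A Z" "a \<in> hom A (Dom A z) Z" "b \<in> hom A Z (Cod A z)" "z = b \<cdot> a"
    using assms unfolding zero_arr_def by blast
  show ?thesis using L.zero_arrI[OF Q_zero_obj[OF Z(1)] Q_hom[OF Z(2)] Q_hom[OF Z(3)]] Q_comp[OF Z(2,3)] Z(4) by simp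
qed

lemma Q_zero_arrD:
  assumes a: "a \<in> hom A X Y" "zero_arr L (fmor Q a)"
  obtains V t where "t \<in> hom A V X" "iso L (fmor Q t)" "zero_arr A (a \<cdot> t)"
proof -
  obtain z where z: "z \<in> hom A X Y" "zero_arr A z" using A.zero_arr_ex A.hom_obj a(1) by metis
  have "fmor Q a = fmor Q z"
    by (rule L.zero_arr_unique[OF a(2) Q_zero_arr[OF z(2)]])
      (use Q_hom[OF a(1)] Q_hom[OF z(1)] in \<open>simp_all add: hom_iff\<close>)
  then obtain V t where t: "t \<in> hom A V X" "iso L (fmor Q t)" "a \<cdot> t = z \<cdot> t"
    using right_eq[OF a(1) z(1)] by blast
  have "zero_arr A (z \<cdot> t)" by (rule A.zero_arr_comp2[OF z(2)]) (use t z in \<open>simp_all add: hom_iff\<close>)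
  then show ?thesis using that t by simp
qed

text \<open>After clearing a common denominator, equality in \<open>L\<close> becomes equality in
  \<open>A\<close> up to one more inverted arrow \<open>t\<close>, and \<open>m\<close> cancels
  there.\<close>

lemma Q_mono:
  assumes "mono_arr A m" shows "mono_arr L (fmor Q m)"
proof -
  have m: "m \<in> hom A (Dom A m) (Cod A m)" using assms by (simp add: mono_arr_def hom_iff)
  have qm: "fmor Q m \<in> Arr L" "Dom L (fmor Q m) = Dom A m" using Q_hom[OF m] by (simp_all add: hom_iff)
  show ?thesis
    unfolding mono_arr_def qm(2)
  proof (intro conjI allI ballI impI)
    fix X \<phi> \<psi> assume h: "\<phi> \<in> hom L X (Dom A m)" "\<psi> \<in> hom L X (Dom A m)"
      and eq: "fmor Q m \<cdot>\<^bsub>L\<^esub> \<phi> = fmor Q m \<cdot>\<^bsub>L\<^esub> \<psi>"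
    obtain V s f g where s: "s \<in> hom A V X" "iso L (fmor Q s)" "f \<in> hom A V (Dom A m)" "g \<in> hom A V (Dom A m)"
      "\<phi> \<cdot>\<^bsub>L\<^esub> fmor Q s = fmor Q f" "\<psi> \<cdot>\<^bsub>L\<^esub> fmor Q s = fmor Q g"
      using common_fraction[OF h] .
    have "fmor Q m \<cdot>\<^bsub>L\<^esub> (\<phi> \<cdot>\<^bsub>L\<^esub> fmor Q s) = fmor Q m \<cdot>\<^bsub>L\<^esub> (\<psi> \<cdot>\<^bsub>L\<^esub> fmor Q s)"
      using L.Comp_assoc[OF Q_hom[OF s(1)] h(1) Q_hom[OF m]] L.Comp_assoc[OF Q_hom[OF s(1)] h(2) Q_hom[OF m]] eq by simp
    then have "fmor Q (m \<cdot> f) = fmor Q (m \<cdot> g)" unfolding s(5,6) by (simp add: Q_comp[OF s(3) m] Q_comp[OF s(4) m])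
    then obtain U t where t: "t \<in> hom A U V" "iso L (fmor Q t)" "m \<cdot> f \<cdot> t = m \<cdot> g \<cdot> t"
      using right_eq[OF A.Comp_hom[OF s(3) m] A.Comp_hom[OF s(4) m]] by blast
    have "f \<cdot> t = g \<cdot> t"
      by (rule A.monoD[OF assms, of _ _ U]) (use t s(3,4) m in \<open>simp_all add: hom_iff\<close>)
    then have "fmor Q f \<cdot>\<^bsub>L\<^esub> fmor Q t = fmor Q g \<cdot>\<^bsub>L\<^esub> fmor Q t" using Q_comp[OF t(1) s(3)] Q_comp[OF t(1) s(4)] by simp
    then have "fmor Q f = fmor Q g" by (rule cancel_iso[OF Q_hom[OF s(3)] Q_hom[OF s(4)] t(1,2)])
    then show "\<phi> = \<psi>" using cancel_iso[OF h s(1,2)] s(5,6) by simp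
  qed (rule qm)
qed

text \<open>An arrow \<open>\<phi>\<close> killed by \<open>Q f\<close> is a fraction with numerator
  \<open>a\<close> such that \<open>f \<cdot> a\<close> dies in \<open>L\<close>, hence dies in
  \<open>A\<close> after some inverted \<open>t\<close>. Then \<open>a \<cdot> t\<close> lifts along
  \<open>k\<close>, and dividing the lift by both denominators \<open>s\<close> and \<open>t\<close>
  lifts \<open>\<phi>\<close>.\<close>

lemma Q_kernel:
  assumes k: "is_kernel A f k" shows "is_kernel L (fmor Q f) (fmor Q k)"
proof -
  note ka = A.kernel_arr[OF k]
  have f: "f \<in> hom A (Dom A f) (Cod A f)" and kh: "k \<in> hom A (Dom A k) (Dom A f)" using ka by (simp_all add: hom_iff)
  show ?thesis
  proof (rule L.kernelI[OF Q_hom[OF f] Q_hom[OF kh] Q_mono[OF A.kernel_mono[OF k]]])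
    show "zero_arr L (fmor Q f \<cdot>\<^bsub>L\<^esub> fmor Q k)" using Q_zero_arr[OF ka(4)] Q_comp[OF kh f] by simp
    fix X \<phi> assume phi: "\<phi> \<in> hom L X (Dom A f)" "zero_arr L (fmor Q f \<cdot>\<^bsub>L\<^esub> \<phi>)"
    obtain V s a where s: "s \<in> hom A V X" "iso L (fmor Q s)" "a \<in> hom A V (Dom A f)" "\<phi> \<cdot>\<^bsub>L\<^esub> fmor Q s = fmor Q a"
      using right_fraction[OF phi(1)] by blast
    have "zero_arr L ((fmor Q f \<cdot>\<^bsub>L\<^esub> \<phi>) \<cdot>\<^bsub>L\<^esub> fmor Q s)"
      by (rule L.zero_arr_comp2[OF phi(2)]) (use phi(1) Q_hom[OF s(1)] Q_hom[OF f] in \<open>simp_all add: hom_iff\<close>)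
    then have "zero_arr L (fmor Q (f \<cdot> a))"
      using L.Comp_assoc[OF Q_hom[OF s(1)] phi(1) Q_hom[OF f]] s(4) Q_comp[OF s(3) f] by simp
    then obtain U t where t: "t \<in> hom A U V" "iso L (fmor Q t)" "zero_arr A (f \<cdot> a \<cdot> t)"
      using Q_zero_arrD[OF A.Comp_hom[OF s(3) f]] by metis
    have "zero_arr A (f \<cdot> (a \<cdot> t))" using t(1,3) s(3) f by (simp add: hom_iff)
    then obtain b where b: "b \<in> hom A U (Dom A k)" "k \<cdot> b = a \<cdot> t"
      using A.kernel_lift[OF k A.Comp_hom[OF t(1) s(3)]] by metis
    have st: "fmor Q s \<cdot>\<^bsub>L\<^esub> fmor Q t \<in> hom L U X" using Q_hom[OF s(1)] Q_hom[OF t(1)] L.Comp_hom by blast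
    have "iso L (fmor Q s \<cdot>\<^bsub>L\<^esub> fmor Q t)"
      by (rule L.iso_comp[OF t(2) s(2)]) (use Q_hom[OF s(1)] Q_hom[OF t(1)] in \<open>simp add: hom_iff\<close>)
    then obtain \<sigma> where sg: "\<sigma> \<in> hom L X U" "fmor Q s \<cdot>\<^bsub>L\<^esub> fmor Q t \<cdot>\<^bsub>L\<^esub> \<sigma> = Ident L X"
      using L.isoE[OF _ st] by metis
    have "fmor Q k \<cdot>\<^bsub>L\<^esub> (fmor Q b \<cdot>\<^bsub>L\<^esub> \<sigma>) = fmor Q (k \<cdot> b) \<cdot>\<^bsub>L\<^esub> \<sigma>"
      unfolding Q_comp[OF b(1) kh] using Q_hom[OF kh] Q_hom[OF b(1)] sg(1) by (simp add: hom_iff)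
    also have "\<dots> = \<phi> \<cdot>\<^bsub>L\<^esub> (fmor Q s \<cdot>\<^bsub>L\<^esub> fmor Q t \<cdot>\<^bsub>L\<^esub> \<sigma>)"
      unfolding b(2) Q_comp[OF t(1) s(3)] s(4)[symmetric]
      using Q_hom[OF s(1)] Q_hom[OF t(1)] sg(1) phi(1) by (simp add: hom_iff)
    also have "\<dots> = \<phi>" unfolding sg(2) using phi(1) by (rule L.Comp_Ident)
    finally show "\<exists>u\<in>hom L X (Dom A k). fmor Q k \<cdot>\<^bsub>L\<^esub> u = \<phi>"
      using L.Comp_hom[OF sg(1) Q_hom[OF b(1)]] by blast
  qed
qed

lemma Q_cokernel: "is_cokernel A f c \<Longrightarrow> is_cokernel L (fmor Q f) (fmor Q c)"
  using fraction_functor.Q_kernel[OF fraction_functor_op, of f c] by simp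

lemma Q_exact: "exact_functor A L Q"
  by (rule exact_functorI[OF Q Q_kernel Q_cokernel])

text \<open>Existence pairs the numerators over a common denominator. For uniqueness, two solutions
  get numerators \<open>x\<close> and \<open>y\<close>; their \<open>p\<close>-components agree
  after \<open>t\<close>, their \<open>q\<close>-components after a further \<open>t'\<close>, and
  the biproduct of \<open>A\<close> then gives equality.\<close>

lemma Q_product:
  assumes B: "biproduct A X Y P i j p q" and f: "\<phi> \<in> hom L V X" "\<psi> \<in> hom L V Y"
  shows "\<exists>!u. u \<in> hom L V P \<and> fmor Q p \<cdot>\<^bsub>L\<^esub> u = \<phi> \<and> fmor Q q \<cdot>\<^bsub>L\<^esub> u = \<psi>"
proof -
  note a = biproduct_arr[OF B]
  note pq = Q_hom[OF a(3)] Q_hom[OF a(4)]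
  obtain U s f g where s: "s \<in> hom A U V" "iso L (fmor Q s)" "f \<in> hom A U X" "g \<in> hom A U Y"
    "\<phi> \<cdot>\<^bsub>L\<^esub> fmor Q s = fmor Q f" "\<psi> \<cdot>\<^bsub>L\<^esub> fmor Q s = fmor Q g" using common_fraction[OF f] .
  obtain u where u: "u \<in> hom A U P" "p \<cdot> u = f" "q \<cdot> u = g" using A.biproduct_pair[OF B s(3,4)] .
  obtain \<sigma> where sg: "\<sigma> \<in> hom L V U" "fmor Q s \<cdot>\<^bsub>L\<^esub> \<sigma> = Ident L V" using L.isoE[OF s(2) Q_hom[OF s(1)]] by metis
  have c: "\<chi> \<cdot>\<^bsub>L\<^esub> fmor Q s \<cdot>\<^bsub>L\<^esub> \<sigma> = \<chi>" if "\<chi> \<in> hom L V Z" for \<chi> Z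
    using that Q_hom[OF s(1)] sg by (simp add: hom_iff)
  show ?thesis
  proof (rule ex1I[of _ "fmor Q u \<cdot>\<^bsub>L\<^esub> \<sigma>"], intro conjI)
    show "fmor Q u \<cdot>\<^bsub>L\<^esub> \<sigma> \<in> hom L V P" using L.Comp_hom[OF sg(1) Q_hom[OF u(1)]] .
    show "fmor Q p \<cdot>\<^bsub>L\<^esub> (fmor Q u \<cdot>\<^bsub>L\<^esub> \<sigma>) = \<phi>"
      using L.Comp_assoc[OF sg(1) Q_hom[OF u(1)] pq(1)] Q_comp[OF u(1) a(3)] u(2) s(5) c[OF f(1)] by simp
    show "fmor Q q \<cdot>\<^bsub>L\<^esub> (fmor Q u \<cdot>\<^bsub>L\<^esub> \<sigma>) = \<psi>"
      using L.Comp_assoc[OF sg(1) Q_hom[OF u(1)] pq(2)] Q_comp[OF u(1) a(4)] u(3) s(6) c[OF f(2)] by simp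
  next
    fix v assume v: "v \<in> hom L V P \<and> fmor Q p \<cdot>\<^bsub>L\<^esub> v = \<phi> \<and> fmor Q q \<cdot>\<^bsub>L\<^esub> v = \<psi>"
    define v' where "v' = fmor Q u \<cdot>\<^bsub>L\<^esub> \<sigma>"
    have v': "v' \<in> hom L V P" "fmor Q p \<cdot>\<^bsub>L\<^esub> v' = \<phi>" "fmor Q q \<cdot>\<^bsub>L\<^esub> v' = \<psi>"
      unfolding v'_def
      using L.Comp_assoc[OF sg(1) Q_hom[OF u(1)] pq(1)] Q_comp[OF u(1) a(3)] u(2) s(5) c[OF f(1)]
        L.Comp_assoc[OF sg(1) Q_hom[OF u(1)] pq(2)] Q_comp[OF u(1) a(4)] u(3) s(6) c[OF f(2)]
        L.Comp_hom[OF sg(1) Q_hom[OF u(1)]] by simp_all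
    have vh: "v \<in> hom L V P" using v by blast
    obtain R r x y where r: "r \<in> hom A R V" "iso L (fmor Q r)" "x \<in> hom A R P" "y \<in> hom A R P"
      "v \<cdot>\<^bsub>L\<^esub> fmor Q r = fmor Q x" "v' \<cdot>\<^bsub>L\<^esub> fmor Q r = fmor Q y" using common_fraction[OF vh v'(1)] .
    have e: "fmor Q (p \<cdot> x) = fmor Q (p \<cdot> y)" "fmor Q (q \<cdot> x) = fmor Q (q \<cdot> y)"
      unfolding Q_comp[OF r(3) a(3)] Q_comp[OF r(4) a(3)] Q_comp[OF r(3) a(4)] Q_comp[OF r(4) a(4)] r(5,6)[symmetric]
      using v v' L.Comp_assoc[OF Q_hom[OF r(1)] vh pq(1)] L.Comp_assoc[OF Q_hom[OF r(1)] v'(1) pq(1)]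
        L.Comp_assoc[OF Q_hom[OF r(1)] vh pq(2)] L.Comp_assoc[OF Q_hom[OF r(1)] v'(1) pq(2)] by simp_all
    obtain R1 t where t: "t \<in> hom A R1 R" "iso L (fmor Q t)" "p \<cdot> x \<cdot> t = p \<cdot> y \<cdot> t"
      using right_eq[OF A.Comp_hom[OF r(3) a(3)] A.Comp_hom[OF r(4) a(3)] e(1)] by blast
    have "fmor Q (q \<cdot> x \<cdot> t) = fmor Q (q \<cdot> y \<cdot> t)"
      using e(2) Q_comp[OF t(1) A.Comp_hom[OF r(3) a(4)]] Q_comp[OF t(1) A.Comp_hom[OF r(4) a(4)]] by simp
    then obtain R2 t' where t': "t' \<in> hom A R2 R1" "iso L (fmor Q t')"
      "q \<cdot> x \<cdot> t \<cdot> t' = q \<cdot> y \<cdot> t \<cdot> t'"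
      using right_eq[OF A.Comp_hom[OF t(1) A.Comp_hom[OF r(3) a(4)]] A.Comp_hom[OF t(1) A.Comp_hom[OF r(4) a(4)]]]
      by blast
    have tt: "t \<cdot> t' \<in> hom A R2 R" using t t' A.Comp_hom by blast
    have "x \<cdot> (t \<cdot> t') = y \<cdot> (t \<cdot> t')"
    proof (rule A.biproduct_pair_eq[OF B A.Comp_hom[OF tt r(3)] A.Comp_hom[OF tt r(4)]])
      have "(p \<cdot> x \<cdot> t) \<cdot> t' = (p \<cdot> y \<cdot> t) \<cdot> t'" using t(3) by simp
      then show "p \<cdot> (x \<cdot> (t \<cdot> t')) = p \<cdot> (y \<cdot> (t \<cdot> t'))"
        using a(1-4) r(3,4) t(1) t'(1) by (simp add: hom_iff)
      show "q \<cdot> (x \<cdot> (t \<cdot> t')) = q \<cdot> (y \<cdot> (t \<cdot> t'))"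
        using t'(3) a(1-4) r(3,4) t(1) t'(1) by (simp add: hom_iff)
    qed
    then have eq: "fmor Q x \<cdot>\<^bsub>L\<^esub> fmor Q (t \<cdot> t') = fmor Q y \<cdot>\<^bsub>L\<^esub> fmor Q (t \<cdot> t')"
      using Q_comp[OF tt r(3)] Q_comp[OF tt r(4)] by simp
    have "iso L (fmor Q (t \<cdot> t'))"
      unfolding Q_comp[OF t'(1) t(1)] using L.iso_comp[OF t'(2) t(2)] Q_hom[OF t(1)] Q_hom[OF t'(1)] by (simp add: hom_iff)
    then have "fmor Q x = fmor Q y" using cancel_iso[OF Q_hom[OF r(3)] Q_hom[OF r(4)] tt _ eq] by blast
    then show "v = fmor Q u \<cdot>\<^bsub>L\<^esub> \<sigma>" using cancel_iso[OF vh v'(1) r(1,2)] r(5,6) v'_def by simp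
  qed
qed

lemma Q_biproduct:
  assumes B: "biproduct A X Y P i j p q"
  shows "biproduct L X Y P (fmor Q i) (fmor Q j) (fmor Q p) (fmor Q q)"
proof -
  interpret op: fraction_functor "op_cat A" "op_cat L" Q by (rule fraction_functor_op)
  note a = biproduct_arr[OF B]
  have ob: "X \<in> Obj A" "Y \<in> Obj A" "P \<in> Obj A" using a A.hom_obj by blast+
  have B': "biproduct (op_cat A) X Y P p q i j" using B by simp
  show ?thesis
    unfolding biproduct_def
  proof (intro conjI ballI)
    show "fmor Q p \<cdot>\<^bsub>L\<^esub> fmor Q i = Ident L X" "fmor Q q \<cdot>\<^bsub>L\<^esub> fmor Q j = Ident L Y"
      using Q_comp[OF a(1,3)] Q_comp[OF a(2,4)] a(5,6) Q_ident ob by simp_all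
    show "zero_arr L (fmor Q q \<cdot>\<^bsub>L\<^esub> fmor Q i)" "zero_arr L (fmor Q p \<cdot>\<^bsub>L\<^esub> fmor Q j)"
      using Q_comp[OF a(1,4)] Q_comp[OF a(2,3)] Q_zero_arr[OF a(7)] Q_zero_arr[OF a(8)] by simp_all
    show "\<exists>!u. u \<in> hom L V P \<and> fmor Q p \<cdot>\<^bsub>L\<^esub> u = f \<and> fmor Q q \<cdot>\<^bsub>L\<^esub> u = g"
      if "f \<in> hom L V X" "g \<in> hom L V Y" for V f g using Q_product[OF B that] .
    show "\<exists>!u. u \<in> hom L P V \<and> u \<cdot>\<^bsub>L\<^esub> fmor Q i = f \<and> u \<cdot>\<^bsub>L\<^esub> fmor Q j = g"
      if "f \<in> hom L X V" "g \<in> hom L Y V" for V f g using op.Q_product[OF B', of f V g] that by simp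
  qed (use ob L_obj Q_hom a in auto)
qed

text \<open>Negate the numerator: \<open>Q\<close> carries the biproduct and codiagonal that witness
  the sum in \<open>A\<close> to witnesses in \<open>L\<close>, and precomposing with the inverse
  \<open>\<sigma>\<close> of the denominator moves the sum to \<open>\<phi>\<close>.\<close>

lemma Q_neg:
  assumes \<phi>: "\<phi> \<in> Arr L" shows "\<exists>\<nu>. is_neg L \<phi> \<nu>"
proof -
  have ph: "\<phi> \<in> hom L (Dom L \<phi>) (Cod L \<phi>)" using \<phi> by (simp add: hom_iff)
  let ?X = "Dom L \<phi>" and ?Y = "Cod L \<phi>"
  obtain V s f where s: "s \<in> hom A V ?X" "iso L (fmor Q s)" "f \<in> hom A V ?Y" "\<phi> \<cdot>\<^bsub>L\<^esub> fmor Q s = fmor Q f"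
    using right_fraction[OF ph] by blast
  obtain n where "is_neg A f n" using A.neg_ex[OF s(3)] by metis
  then obtain z where z: "zero_arr A z" "is_sum A f n z" unfolding is_neg_def by blast
  obtain P i j p q u v where P: "biproduct A ?Y ?Y P i j p q" "u \<in> hom A V P" "p \<cdot> u = f" "q \<cdot> u = n"
    "v \<in> hom A P ?Y" "v \<cdot> i = Ident A ?Y" "v \<cdot> j = Ident A ?Y" "z = v \<cdot> u"
    using A.is_sumE[OF z(2) s(3)] .
  note a = biproduct_arr[OF P(1)]
  have Y: "?Y \<in> Obj A" using L_obj L.arr_obj(2)[OF \<phi>] by simp
  have vij: "fmor Q v \<cdot>\<^bsub>L\<^esub> fmor Q i = Ident L ?Y" "fmor Q v \<cdot>\<^bsub>L\<^esub> fmor Q j = Ident L ?Y"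
    using Q_comp[OF a(1) P(5)] Q_comp[OF a(2) P(5)] P(6,7) Q_ident[OF Y] by simp_all
  have "is_sum L (fmor Q p \<cdot>\<^bsub>L\<^esub> fmor Q u) (fmor Q q \<cdot>\<^bsub>L\<^esub> fmor Q u) (fmor Q v \<cdot>\<^bsub>L\<^esub> fmor Q u)"
    by (rule L.is_sumI[OF Q_biproduct[OF P(1)] Q_hom[OF P(2)] Q_hom[OF P(5)] vij])
  then have sum: "is_sum L (fmor Q f) (fmor Q n) (fmor Q z)"
    using Q_comp[OF P(2) a(3)] Q_comp[OF P(2) a(4)] Q_comp[OF P(2,5)] P(3,4,8) by simp
  obtain \<sigma> where sg: "\<sigma> \<in> hom L ?X V" "fmor Q s \<cdot>\<^bsub>L\<^esub> \<sigma> = Ident L ?X" using L.isoE[OF s(2) Q_hom[OF s(1)]] by metis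
  have "is_sum L (fmor Q f \<cdot>\<^bsub>L\<^esub> \<sigma>) (fmor Q n \<cdot>\<^bsub>L\<^esub> \<sigma>) (fmor Q z \<cdot>\<^bsub>L\<^esub> \<sigma>)"
    by (rule L.is_sum_pre[OF sum Q_hom[OF s(3)] sg(1)])
  moreover have "fmor Q f \<cdot>\<^bsub>L\<^esub> \<sigma> = \<phi>"
    using L.Comp_assoc[OF sg(1) Q_hom[OF s(1)] ph] sg(2) s(4) L.Comp_Ident[OF ph] by simp
  moreover have "zero_arr L (fmor Q z \<cdot>\<^bsub>L\<^esub> \<sigma>)"
    by (rule L.zero_arr_comp2[OF Q_zero_arr[OF z(1)]])
      (use Q_hom[OF A.is_sum_hom(2)[OF z(2) s(3)]] sg(1) in \<open>simp_all add: hom_iff\<close>)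
  ultimately show ?thesis unfolding is_neg_def by metis
qed

section \<open>Abelian structure of the target\<close>

lemma L_additive: "additive L"
  unfolding additive_def
proof (intro conjI ballI)
  show "category L" by (rule L.category_axioms)
  show "\<exists>Z. zero_obj L Z" using A.zero_obj_ex Q_zero_obj by metis
  show "\<exists>P i j p q. biproduct L X Y P i j p q" if "X \<in> Obj L" "Y \<in> Obj L" for X Y
    using that L_obj A.biproduct_ex[of X Y] Q_biproduct by metis
qed (rule Q_neg)

text \<open>A left fraction is used because composing with the invertible denominator afterwards
  does not change the kernel. The fraction is returned too, since kernels under a descended functor
  are compared through its numerator.\<close>

lemma L_kernel:
  assumes "\<phi> \<in> hom L X Y"
  obtains s V f k where "s \<in> hom A Y V" "iso L (fmor Q s)" "f \<in> hom A X V" "fmor Q s \<cdot>\<^bsub>L\<^esub> \<phi> = fmor Q f"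
    "is_kernel A f k" "is_kernel L \<phi> (fmor Q k)"
proof -
  obtain V s f where s: "s \<in> hom A Y V" "iso L (fmor Q s)" "f \<in> hom A X V" "fmor Q s \<cdot>\<^bsub>L\<^esub> \<phi> = fmor Q f"
    using left_fraction[OF assms] by blast
  obtain k where k: "is_kernel A f k" using A.kernel_ex s(3) by (auto simp: hom_iff)
  have "is_kernel L \<phi> (fmor Q k)"
    by (rule L.kernel_of_post_mono[OF _ L.iso_mono[OF s(2)]])
      (use Q_kernel[OF k] s(4) Q_hom[OF s(1)] assms in \<open>simp_all add: hom_iff\<close>)
  then show ?thesis using that s k by blast
qed

text \<open>Up to isomorphism \<open>\<phi>\<close> is the image of the numerator \<open>f\<close>,
  factored as \<open>m\<close> after \<open>e\<close>. The image of \<open>e\<close> is monic, so it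
  is a cokernel of a zero arrow and thus invertible; hence \<open>\<phi>\<close> is isomorphic to
  the image of \<open>m\<close>, which is a kernel.\<close>

lemma L_mono_normal:
  assumes "mono_arr L \<phi>" shows "\<exists>\<gamma>. is_kernel L \<gamma> \<phi>"
proof -
  let ?X = "Dom L \<phi>" and ?Y = "Cod L \<phi>"
  have ph: "\<phi> \<in> hom L ?X ?Y" using assms by (simp add: mono_arr_def hom_iff)
  obtain V s f where s: "s \<in> hom A V ?X" "iso L (fmor Q s)" "f \<in> hom A V ?Y" "\<phi> \<cdot>\<^bsub>L\<^esub> fmor Q s = fmor Q f"
    using right_fraction[OF ph] by blast
  have mf: "mono_arr L (fmor Q f)" unfolding s(4)[symmetric]
    by (rule L.mono_comp[OF L.iso_mono[OF s(2)] assms]) (use Q_hom[OF s(1)] in \<open>simp add: hom_iff\<close>)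
  obtain I e m where em: "e \<in> hom A V I" "m \<in> hom A I ?Y" "m \<cdot> e = f" "epi_arr A e" "mono_arr A m"
    using A.factorisation[OF s(3)] .
  obtain k where k: "is_kernel A e k" using A.kernel_ex em(1) by (auto simp: hom_iff)
  have "mono_arr L (fmor Q e)"
    using L.mono_of_comp[OF _ Q_hom[OF em(1)] Q_hom[OF em(2)]] mf Q_comp[OF em(1,2)] em(3) by simp
  then have "zero_arr L (fmor Q k)"
    using L.zero_arr_cancel_mono[of "fmor Q e" "fmor Q k" "Dom A k"] L.kernel_arr[OF Q_kernel[OF k]]
      functor_arr[OF Q A.kernel_arr(2)[OF k]] Q_obj by (simp add: hom_iff)
  then have ie: "iso L (fmor Q e)"
    using L.cokernel_of_zero_iso Q_cokernel[OF A.epi_cokernel_of_kernel[OF em(4) k]] by blast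
  obtain g where g: "is_cokernel A m g" using A.cokernel_ex em(2) by (auto simp: hom_iff)
  have kg: "is_kernel L (fmor Q g) (fmor Q m)" using Q_kernel[OF A.mono_kernel_of_cokernel[OF em(5) g]] .
  obtain \<sigma> where sg: "\<sigma> \<in> hom L ?X V" "fmor Q s \<cdot>\<^bsub>L\<^esub> \<sigma> = Ident L ?X" "iso L \<sigma>"
    using L.isoE[OF s(2) Q_hom[OF s(1)]] by metis
  have "iso L (fmor Q e \<cdot>\<^bsub>L\<^esub> \<sigma>)" by (rule L.iso_comp[OF sg(3) ie]) (use sg(1) Q_hom[OF em(1)] in \<open>simp add: hom_iff\<close>)
  then have "is_kernel L (fmor Q g) (fmor Q m \<cdot>\<^bsub>L\<^esub> (fmor Q e \<cdot>\<^bsub>L\<^esub> \<sigma>))"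
    using L.kernel_comp_iso[OF kg, of "fmor Q e \<cdot>\<^bsub>L\<^esub> \<sigma>" ?X] L.Comp_hom[OF sg(1) Q_hom[OF em(1)]] Q_hom[OF em(2)]
    by (simp add: hom_iff)
  moreover have "fmor Q m \<cdot>\<^bsub>L\<^esub> (fmor Q e \<cdot>\<^bsub>L\<^esub> \<sigma>) = \<phi>"
    using L.Comp_assoc[OF sg(1) Q_hom[OF em(1)] Q_hom[OF em(2)]] Q_comp[OF em(1,2)] em(3) s(4)
      L.Comp_assoc[OF sg(1) Q_hom[OF s(1)] ph] sg(2) L.Comp_Ident[OF ph] by simp
  ultimately show ?thesis by auto
qed

lemma L_abelian: "abelian_cat L"
proof (rule abelian_catI)
  interpret op: fraction_functor "op_cat A" "op_cat L" Q by (rule fraction_functor_op)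
  show "abelian L"
    unfolding abelian_def
  proof (intro conjI ballI allI impI)
    show "additive L" by (rule L_additive)
    show "\<exists>k. is_kernel L f k" if "f \<in> Arr L" for f
      using L_kernel[of f "Dom L f" "Cod L f"] that by (auto simp: hom_iff)
    show "\<exists>c. is_cokernel L f c" if "f \<in> Arr L" for f
      using op.L_kernel[of f "Cod L f" "Dom L f"] that by (auto simp: hom_iff)
    show "\<exists>g. is_kernel L g f" if "mono_arr L f" for f using L_mono_normal[OF that] .
    show "\<exists>g. is_cokernel L g f" if "epi_arr L f" for f using op.L_mono_normal[of f] that by simp
  qed
qed

text \<open>Kernels in \<open>L\<close> are, up to isomorphism, images of kernels \<open>n\<close>
  of numerators \<open>f\<close>, and on those \<open>G\<close> agrees with the exact functor
  \<open>F\<close>. The invertible denominator is cancelled afterwards.\<close>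

lemma descended_kernel:
  assumes B: "abelian_cat B" and F: "exact_functor A B F" and G: "is_functor L B G"
    and GQ: "\<And>f. f \<in> Arr A \<Longrightarrow> fmor G (fmor Q f) = fmor F f"
    and k: "is_kernel L \<phi> \<kappa>"
  shows "is_kernel B (fmor G \<phi>) (fmor G \<kappa>)"
proof -
  interpret B: abelian_cat B by (rule B)
  let ?X = "Dom L \<phi>" and ?Y = "Cod L \<phi>"
  have ph: "\<phi> \<in> hom L ?X ?Y" using L.kernel_arr[OF k] by (simp add: hom_iff)
  obtain s V f n where s: "s \<in> hom A ?Y V" "iso L (fmor Q s)" "f \<in> hom A ?X V" "fmor Q s \<cdot>\<^bsub>L\<^esub> \<phi> = fmor Q f"
    "is_kernel A f n" "is_kernel L \<phi> (fmor Q n)" using L_kernel[OF ph] .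
  obtain u where u: "u \<in> hom L (Dom L \<kappa>) (Dom L (fmor Q n))" "fmor Q n \<cdot>\<^bsub>L\<^esub> u = \<kappa>" "iso L u"
    using L.kernel_iso[OF s(6) k] .
  have nn: "fmor Q n \<in> hom L (Dom L (fmor Q n)) ?X" using L.kernel_arr[OF s(6)] by (simp add: hom_iff)
  have "fmor F f = fmor G (fmor Q s) \<cdot>\<^bsub>B\<^esub> fmor G \<phi>"
    using GQ[of f] s(3,4) functorD(6)[OF G ph Q_hom[OF s(1)]] by (simp add: hom_iff)
  moreover have "is_kernel B (fmor F f) (fmor F n)" using exact_kernel[OF A.abelian_cat_axioms B F s(5)] .
  ultimately have "is_kernel B (fmor G (fmor Q s) \<cdot>\<^bsub>B\<^esub> fmor G \<phi>) (fmor G (fmor Q n))"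
    using GQ[OF A.kernel_arr(2)[OF s(5)]] by simp
  then have kn: "is_kernel B (fmor G \<phi>) (fmor G (fmor Q n))"
    by (rule B.kernel_of_post_mono[OF _ B.iso_mono[OF functor_iso[OF G Q_hom[OF s(1)] s(2)]]])
      (use functorD(4)[OF G ph] functorD(4)[OF G Q_hom[OF s(1)]] in \<open>simp_all add: hom_iff\<close>)
  have "is_kernel B (fmor G \<phi>) (fmor G (fmor Q n) \<cdot>\<^bsub>B\<^esub> fmor G u)"
    by (rule B.kernel_comp_iso[OF kn _ functor_iso[OF G u(1,3)]])
      (use functorD(4)[OF G u(1)] functorD(4)[OF G nn] in \<open>simp add: hom_iff\<close>)
  then show ?thesis using functorD(6)[OF G u(1) nn] u(2) by simp
qed

lemma descended_exact:
  assumes B: "abelian_cat B" and F: "exact_functor A B F" and G: "is_functor L B G"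
    and GQ: "\<And>f. f \<in> Arr A \<Longrightarrow> fmor G (fmor Q f) = fmor F f"
  shows "exact_functor L B G"
proof (rule exact_functorI[OF G descended_kernel[OF B F G GQ]])
  interpret op: fraction_functor "op_cat A" "op_cat L" Q by (rule fraction_functor_op)
  interpret B: abelian_cat B by (rule B)
  fix f c assume "is_cokernel L f c"
  then show "is_cokernel B (fmor G f) (fmor G c)"
    using op.descended_kernel[OF B.abelian_op exact_functor_op[OF A.abelian_cat_axioms B F] functor_op[OF G], of f c]
      GQ by simp
qed

end

text \<open>The class \<open>W\<close> is self-dual, so \<open>op_cat C\<close> has right fractions
  for it as well. They are not applied to a localisation of \<open>op_cat C\<close>: its Ore and
  cancellation conditions, read in \<open>C\<close>, convert the right-hand statements into
  left-hand ones.\<close>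

lemma (in serre) fraction_functor_serre:
  "fraction_functor C (loc W) (loc_functor C W)"
proof -
  interpret R: right_calculus C W by (rule right_calculus_W)
  interpret op: serre "op_cat C" K by (rule serre_op)
  interpret O: right_calculus "op_cat C" W using op.right_calculus_W serre_arrows_op by simp
  interpret L: category "loc W" by (rule category_localisation)
  note q = functorD(4)[OF is_functor_loc[of W], unfolded loc_functor_simps]
  note qc = functorD(6)[OF is_functor_loc[of W]]
  show ?thesis
  proof
    show "is_functor C (loc W) (loc_functor C W)" by (rule is_functor_loc)
    show "fobj (loc_functor C W) X = X" for X by simp
    show "Obj (loc W) = Obj C" by simp
  next
    fix \<phi> X Y assume "\<phi> \<in> hom (loc W) X Y"
    then show "\<exists>V s f. s \<in> hom C V X \<and> iso (loc W) (qm W s) \<and> f \<in> hom C V Y \<and>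
        \<phi> \<cdot>\<^bsub>loc W\<^esub> qm W s = qm W f"
      using R.fraction_ex loc_functor_iso by meson
  next
    fix \<phi> X Y assume ph: "\<phi> \<in> hom (loc W) X Y"
    obtain V s f where s: "s \<in> hom C V X" "s \<in> W" "f \<in> hom C V Y" "\<phi> \<cdot>\<^bsub>loc W\<^esub> qm W s = qm W f"
      using R.fraction_ex[OF ph] by blast
    \<comment> \<open>The dual Ore square on \<open>f\<close> and \<open>s\<close> rewrites
      \<open>f / s\<close> with the denominator \<open>t\<close> on the left.\<close>
    obtain U t g where t: "t \<in> hom C Y U" "t \<in> W" "g \<in> hom C X U" "t \<cdot> f = g \<cdot> s"
      using O.ore[of s X V f Y] s by auto
    have "(qm W t \<cdot>\<^bsub>loc W\<^esub> \<phi>) \<cdot>\<^bsub>loc W\<^esub> qm W s = qm W g \<cdot>\<^bsub>loc W\<^esub> qm W s"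
      using L.Comp_assoc[OF q[OF s(1)] ph q[OF t(1)]] s(4) qc[OF s(3) t(1)] qc[OF s(1) t(3)] t(4) by simp
    then have "qm W t \<cdot>\<^bsub>loc W\<^esub> \<phi> = qm W g"
      by (rule L.epiD[OF L.iso_epi[OF loc_functor_iso[OF s(1,2)]], of _ _ U])
        (use q[OF s(1)] q[OF t(1)] q[OF t(3)] ph in \<open>simp_all add: hom_iff\<close>)
    then show "\<exists>V s f. s \<in> hom C Y V \<and> iso (loc W) (qm W s) \<and> f \<in> hom C X V \<and>
        qm W s \<cdot>\<^bsub>loc W\<^esub> \<phi> = qm W f"
      using t loc_functor_iso by blast
  next
    fix a b X Y assume ab: "a \<in> hom C X Y" "b \<in> hom C X Y" "qm W a = qm W b"
    obtain V t where t: "t \<in> hom C V X" "t \<in> W" "a \<cdot> t = b \<cdot> t" using R.localisation_eqD[OF ab] by blast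
    then show "\<exists>V t. t \<in> hom C V X \<and> iso (loc W) (qm W t) \<and> a \<cdot> t = b \<cdot> t"
      using loc_functor_iso by blast
    have "\<exists>U r. r \<in> hom C Y U \<and> r \<in> W \<and> r \<cdot> a = r \<cdot> b"
      using O.cancel[of t X V a Y b] t ab by simp
    then show "\<exists>U r. r \<in> hom C Y U \<and> iso (loc W) (qm W r) \<and> r \<cdot> a = r \<cdot> b"
      using loc_functor_iso by blast
  qed
qed

section \<open>The kernel of an exact functor\<close>

text \<open>The Serre subcategory against which minimality of the generated one is used.\<close>

lemma serre_kernel_exact:
  assumes A: "abelian_cat A" and B: "abelian_cat B" and F: "exact_functor A B F"
  shows "serre_subcategory A {X \<in> Obj A. zero_obj B (fobj F X)}"
proof -
  interpret A: abelian_cat A by (rule A)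
  interpret B: abelian_cat B by (rule B)
  note F' = exact_functorD(1)[OF F]
  show ?thesis
    unfolding serre_subcategory_def
  proof (intro conjI allI impI)
    obtain Z where Z: "zero_obj A Z" using A.zero_obj_ex .
    then show "{X \<in> Obj A. zero_obj B (fobj F X)} \<noteq> {}"
      using exact_zero_obj[OF A B F Z] unfolding zero_obj_def[of A] by blast
  next
    fix f assume f: "mono_arr A f \<and> Cod A f \<in> {X \<in> Obj A. zero_obj B (fobj F X)}"
    then have fa: "f \<in> Arr A" by (simp add: mono_arr_def)
    obtain c where c: "is_cokernel A f c" using A.cokernel_ex[OF fa] .
    have "mono_arr B (fmor F f)"
      using B.kernel_mono exact_kernel[OF A B F A.mono_kernel_of_cokernel[OF _ c]] f by blast
    then show "Dom A f \<in> {X \<in> Obj A. zero_obj B (fobj F X)}"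
      using B.zero_obj_mono[of "fmor F f"] f fa functor_arr[OF F' fa] by simp
  next
    fix f assume f: "epi_arr A f \<and> Dom A f \<in> {X \<in> Obj A. zero_obj B (fobj F X)}"
    then have fa: "f \<in> Arr A" by (simp add: epi_arr_def)
    obtain k where k: "is_kernel A f k" using A.kernel_ex[OF fa] .
    have "epi_arr B (fmor F f)"
      using B.cokernel_epi exact_cokernel[OF A B F A.epi_cokernel_of_kernel[OF _ k]] f by blast
    then show "Cod A f \<in> {X \<in> Obj A. zero_obj B (fobj F X)}"
      using B.zero_obj_epi[of "fmor F f"] f fa functor_arr[OF F' fa] by simp
  next
    fix f g assume h: "short_exact A f g \<and> Dom A f \<in> {X \<in> Obj A. zero_obj B (fobj F X)} \<and>
      Cod A g \<in> {X \<in> Obj A. zero_obj B (fobj F X)}"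
    then have k: "is_kernel A g f" unfolding short_exact_def by blast
    note fa = A.kernel_arr[OF k]
    \<comment> \<open>The image of \<open>f\<close> is a kernel of a zero arrow, hence invertible,
      and its domain vanishes.\<close>
    have "zero_arr B (fmor F g)"
      using B.zero_arr_cod functor_arr[OF F' fa(1)] h by simp
    then have "iso B (fmor F f)" using B.kernel_of_zero_iso exact_kernel[OF A B F k] by blast
    then have "zero_obj B (fobj F (Cod A f))"
      using B.zero_obj_iso[of "fobj F (Dom A f)" "fmor F f"] functor_arr[OF F' fa(2)] h by (simp add: hom_iff)
    then show "Cod A f \<in> {X \<in> Obj A. zero_obj B (fobj F X)}" using fa by simp
  qed blast
qed

lemma exact_inverts_serre_arrows:
  assumes A: "abelian_cat A" and B: "abelian_cat B" and F: "exact_functor A B F"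
    and K: "\<And>X. X \<in> K \<Longrightarrow> zero_obj B (fobj F X)" and f: "f \<in> serre_arrows A K"
  shows "iso B (fmor F f)"
proof -
  interpret A: abelian_cat A by (rule A)
  interpret B: abelian_cat B by (rule B)
  note F' = exact_functorD(1)[OF F]
  obtain k c where kc: "is_kernel A f k" "is_cokernel A f c" "Dom A k \<in> K" "Cod A c \<in> K"
    using f unfolding serre_arrows_def by blast
  have "zero_arr B (fmor F k)" "zero_arr B (fmor F c)"
    using B.zero_arr_dom B.zero_arr_cod functor_arr[OF F' A.kernel_arr(2)[OF kc(1)]]
      functor_arr[OF F' A.cokernel_arr(2)[OF kc(2)]] K kc(3,4) by simp_all
  then show ?thesis
    using B.mono_epi_iso B.kernel_zero_mono B.cokernel_zero_epi exact_kernel[OF A B F kc(1)]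
      exact_cokernel[OF A B F kc(2)] by blast
qed

text \<open>Shows that the family intersected in \<open>serre_generated\<close> is nonempty, which
  keeps the intersection inside the objects of \<open>A\<close>.\<close>

lemma serre_subcategory_Obj:
  assumes "abelian_cat A" shows "serre_subcategory A (Obj A)"
proof -
  interpret A: abelian_cat A by (rule assms)
  obtain Z where "zero_obj A Z" using A.zero_obj_ex .
  then have "Obj A \<noteq> {}" unfolding zero_obj_def by blast
  then show ?thesis
    unfolding serre_subcategory_def
    by (auto simp: mono_arr_def epi_arr_def short_exact_def is_kernel_def)
qed

lemma serre_generated:
  assumes A: "abelian_cat A" and U: "U \<subseteq> Obj A"
  shows "serre A (serre_generated A U)" "U \<subseteq> serre_generated A U"
    "serre_subcategory A K \<Longrightarrow> U \<subseteq> K \<Longrightarrow> serre_generated A U \<subseteq> K"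
proof -
  interpret A: abelian_cat A by (rule A)
  let ?G = "serre_generated A U"
  show "U \<subseteq> ?G" unfolding serre_generated_def by blast
  show low: "serre_subcategory A K \<Longrightarrow> U \<subseteq> K \<Longrightarrow> ?G \<subseteq> K" for K unfolding serre_generated_def by blast
  have D: "serre A K" if "serre_subcategory A K" for K using that A by (simp add: serre_def serre_axioms_def)
  obtain Z where Z: "zero_obj A Z" using A.zero_obj_ex .
  \<comment> \<open>A zero object lies in every Serre subcategory, which makes the intersection
    nonempty.\<close>
  have ZG: "Z \<in> ?G" unfolding serre_generated_def using serre.K_zero[OF D Z] by blast
  show "serre A ?G"
  proof
    show "serre_subcategory A ?G"
      unfolding serre_subcategory_def
    proof (intro conjI allI impI)
      show "?G \<subseteq> Obj A" using low[OF serre_subcategory_Obj[OF A] U] .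
      show "?G \<noteq> {}" using ZG by blast
      show "Dom A f \<in> ?G" if "mono_arr A f \<and> Cod A f \<in> ?G" for f
        using that serre.K_mono[OF D] unfolding serre_generated_def by blast
      show "Cod A f \<in> ?G" if "epi_arr A f \<and> Dom A f \<in> ?G" for f
        using that serre.K_epi[OF D] unfolding serre_generated_def by blast
      show "Cod A f \<in> ?G" if "short_exact A f g \<and> Dom A f \<in> ?G \<and> Cod A g \<in> ?G" for f g
        using that serre.K_extension[OF D] unfolding serre_generated_def short_exact_def by blast
    qed
  qed
qed

section \<open>Triangulated categories\<close>

locale triangulated_sub = triangulated T for T :: "('o, 'm, 'z) tcat_scheme" (structure) +
  fixes S :: "'o set"
  assumes sub: "triangulated_subcategory T S"
begin

sublocale additive_cat T
  using additive by (simp add: additive_cat_def additive_cat_axioms_def additive_def)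

lemma Shift_functor: "is_functor T T (Shift T)"
  using Shift_equivalence unfolding is_equivalence_def by blast

lemma S_obj: "X \<in> S \<Longrightarrow> X \<in> Obj T"
  using sub unfolding triangulated_subcategory_def by blast

lemma S_shift: "X \<in> Obj T \<Longrightarrow> fobj (Shift T) X \<in> S \<longleftrightarrow> X \<in> S"
  using sub unfolding triangulated_subcategory_def by blast

lemma S_cone: "(u, v, w) \<in> Tri T \<Longrightarrow> Dom T u \<in> S \<Longrightarrow> Dom T v \<in> S \<Longrightarrow> Dom T w \<in> S"
  using sub unfolding triangulated_subcategory_def by blast

lemma tri_arr:
  assumes "(u, v, w) \<in> Tri T"
  shows "u \<in> Arr T" "v \<in> Arr T" "w \<in> Arr T" "Cod T u = Dom T v" "Cod T v = Dom T w"
    "Cod T w = fobj (Shift T) (Dom T u)"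
  using Tri_candidate[OF assms] unfolding candidate_def by auto

lemma rotate:
  assumes t: "(u, v, w) \<in> Tri T"
  obtains n where "is_neg T (fmor (Shift T) u) n" "(v, w, n) \<in> Tri T"
proof -
  have u: "u \<in> hom T (Dom T u) (Cod T u)" using tri_arr[OF t] by (simp add: hom_iff)
  obtain n where "is_neg T (fmor (Shift T) u) n" using neg_ex functorD(4)[OF Shift_functor u] by metis
  then show ?thesis using that Tri_rotate[OF Tri_candidate[OF t]] t by blast
qed

lemma ident_triangle:
  assumes "X \<in> Obj T" "zero_obj T Z"
  obtains v w where "v \<in> hom T X Z" "w \<in> hom T Z (fobj (Shift T) X)" "(Ident T X, v, w) \<in> Tri T"
proof -
  obtain v where v: "v \<in> hom T X Z" using zero_obj_hom_ex[OF assms(2,1)] .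
  obtain w where w: "w \<in> hom T Z (fobj (Shift T) X)"
    using zero_obj_hom_ex[OF assms(2) functorD(3)[OF Shift_functor assms(1)]] .
  show ?thesis using that v w Tri_Ident[OF assms v w] by blast
qed

text \<open>Zero is a cone of the identity of any object of \<open>S\<close>.\<close>

lemma zero_in_S:
  assumes "zero_obj T Z" shows "Z \<in> S"
proof -
  obtain X where X: "X \<in> S" using sub unfolding triangulated_subcategory_def by blast
  obtain v w where "v \<in> hom T X Z" "w \<in> hom T Z (fobj (Shift T) X)" "(Ident T X, v, w) \<in> Tri T"
    using ident_triangle[OF S_obj[OF X] assms] .
  then show ?thesis using S_cone[of "Ident T X" v w] X S_obj[OF X] by (simp add: hom_iff)
qed

lemma is_neg_hom: "is_neg T f n \<Longrightarrow> f \<in> hom T X Y \<Longrightarrow> n \<in> hom T X Y"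
  unfolding is_neg_def using is_sum_hom by blast

text \<open>An isomorphism \<open>e : X \<rightarrow> X'\<close> has cone \<open>0\<close>; rotating twice exhibits the shift of \<open>X'\<close> as a
  cone of an arrow \<open>0 \<rightarrow> \<Sigma>X\<close>.\<close>

lemma S_iso_closed:
  assumes X: "X \<in> S" and e: "e \<in> hom T X X'" "iso T e"
  shows "X' \<in> S"
proof -
  have XO: "X \<in> Obj T" "X' \<in> Obj T" using hom_obj e by blast+
  obtain Z where Z: "zero_obj T Z" using zero_obj_ex .
  obtain v w where vw: "v \<in> hom T X Z" "w \<in> hom T Z (fobj (Shift T) X)" "(Ident T X, v, w) \<in> Tri T"
    using ident_triangle[OF XO(1) Z] .
  have ZO: "Z \<in> Obj T" using hom_obj vw by blast
  obtain v' where v': "v' \<in> hom T X' Z" using zero_obj_hom_ex[OF Z XO(2)] .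
  have "v' \<cdot> e = v" using zero_obj_unique(1)[OF Z Comp_hom[OF e(1) v'] vw(1)] .
  moreover have "candidate T e v' w" "candidate T (Ident T X) v w"
    unfolding candidate_def using e(1) v' vw(1,2) XO by (simp_all add: hom_iff)
  moreover have "fmor (Shift T) (Ident T X) \<cdot> w = w" "w \<cdot> Ident T Z = w"
    using functorD(5)[OF Shift_functor XO(1)] vw(2) by (simp_all add: hom_iff)
  \<comment> \<open>The components are the identity of \<open>X\<close>, \<open>e\<close>, and the
    identity of \<open>Z\<close>.\<close>
  ultimately have "tri_iso T (Ident T X, v, w) (e, v', w)"
    unfolding tri_iso_def prod.case using e v' vw(1,2) XO ZO
    by (intro conjI bexI[of _ "Ident T X"] bexI[of _ e] bexI[of _ "Ident T Z"]) (simp_all add: hom_iff)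
  then have tri: "(e, v', w) \<in> Tri T" using Tri_iso vw(3) by blast
  obtain n where n: "is_neg T (fmor (Shift T) e) n" "(v', w, n) \<in> Tri T" using rotate[OF tri] .
  obtain n' where n': "(w, n, n') \<in> Tri T" "is_neg T (fmor (Shift T) v') n'" using rotate[OF n(2)] by metis
  have "n \<in> hom T (fobj (Shift T) X) (fobj (Shift T) X')"
    using is_neg_hom[OF n(1) functorD(4)[OF Shift_functor e(1)]] .
  moreover have "n' \<in> hom T (fobj (Shift T) X') (fobj (Shift T) Z)"
    using is_neg_hom[OF n'(2) functorD(4)[OF Shift_functor v']] .
  ultimately have "fobj (Shift T) X' \<in> S"
    using S_cone[OF n'(1)] vw(2) zero_in_S[OF Z] S_shift[OF XO(1)] X by (simp add: hom_iff)
  then show ?thesis using S_shift[OF XO(2)] by blast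
qed

text \<open>Rotating the identity triangle shows that \<open>X \<rightarrow> 0\<close> has the shift
  of \<open>X\<close> as a cone. This is what makes objects of \<open>S\<close> vanish in the
  Verdier quotient.\<close>

lemma cone_arrow_to_zero:
  assumes X: "X \<in> S" and Z: "zero_obj T Z"
  obtains v where "v \<in> hom T X Z" "v \<in> cone_arrows T S"
proof -
  obtain v w where vw: "v \<in> hom T X Z" "w \<in> hom T Z (fobj (Shift T) X)" "(Ident T X, v, w) \<in> Tri T"
    using ident_triangle[OF S_obj[OF X] Z] .
  obtain n where "(v, w, n) \<in> Tri T" using rotate[OF vw(3)] by metis
  moreover have "Cod T w \<in> S" "v \<in> Arr T" using vw(1,2) S_shift[OF S_obj[OF X]] X by (simp_all add: hom_iff)
  ultimately have "v \<in> cone_arrows T S" unfolding cone_arrows_def by blast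
  then show ?thesis using that vw(1) by blast
qed

text \<open>Rotation backwards. The cone is replaced by an isomorphic shift of some
  \<open>W\<close>, and the last arrow of the triangle, up to sign, is lifted through the full
  functor \<open>Shift T\<close> to an arrow \<open>w'\<close> out of \<open>W\<close>.\<close>

lemma cone_arrow_fibre:
  assumes u: "u \<in> cone_arrows T S"
  obtains w v where "(w, u, v) \<in> Tri T" "Dom T w \<in> S"
proof -
  obtain v w where t: "(u, v, w) \<in> Tri T" "Cod T v \<in> S" using u unfolding cone_arrows_def by blast
  note a = tri_arr[OF t(1)]
  let ?X = "Dom T u" and ?Y = "Cod T u" and ?C = "Cod T v" and ?s = "fobj (Shift T)"
  have h: "u \<in> hom T ?X ?Y" "v \<in> hom T ?Y ?C" "w \<in> hom T ?C (?s ?X)" using a by (simp_all add: hom_iff)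
  obtain W \<phi> where W: "W \<in> Obj T" "\<phi> \<in> hom T (?s W) ?C" "iso T \<phi>"
    using equivalence_ess_surj[OF Shift_equivalence S_obj[OF t(2)]] .
  obtain e where e: "e \<in> hom T ?C (?s W)" "e \<cdot> \<phi> = Ident T (?s W)" "\<phi> \<cdot> e = Ident T ?C" "iso T e"
    using isoE[OF W(3,2)] .
  have WS: "W \<in> S" using S_iso_closed[OF t(2) e(1,4)] S_shift[OF W(1)] by blast
  note wp = Comp_hom[OF W(2) h(3)]
  \<comment> \<open>Rotating \<open>(w', u, _)\<close> produces the negative of the shifted
    \<open>w'\<close>. So the negative \<open>m\<close> of \<open>w \<cdot> \<phi>\<close> is
    lifted, and \<open>w \<cdot> \<phi>\<close> is then in turn the negative of
    \<open>m\<close>.\<close>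
  obtain m where m: "m \<in> hom T (?s W) (?s ?X)" "is_neg T (w \<cdot> \<phi>) m" using neg_ex[OF wp] by metis
  then have m': "is_neg T m (w \<cdot> \<phi>)" unfolding is_neg_def using is_sum_commute by blast
  obtain w' where w': "w' \<in> hom T W ?X" "fmor (Shift T) w' = m"
    using equivalence_full[OF Shift_equivalence W(1) hom_obj(1)[OF h(1)] m(1)] .
  have "candidate T u v w" using Tri_candidate t(1) by blast
  moreover have "candidate T u (e \<cdot> v) (w \<cdot> \<phi>)"
    unfolding candidate_def using h e(1) W(2) by (simp add: hom_iff)
  moreover have ob: "?X \<in> Obj T" "?Y \<in> Obj T" using a(1) by simp_all
  moreover have "fmor (Shift T) (Ident T ?X) \<cdot> w = (w \<cdot> \<phi>) \<cdot> e"
    using functorD(5)[OF Shift_functor ob(1)] h(3) W(2) e(1) by (simp add: hom_iff e(3))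
  ultimately have "tri_iso T (u, v, w) (u, e \<cdot> v, w \<cdot> \<phi>)"
    unfolding tri_iso_def prod.case using h e(1,4) W(2)
    by (intro conjI bexI[of _ "Ident T ?X"] bexI[of _ "Ident T ?Y"] bexI[of _ e]) (simp_all add: hom_iff)
  then have tri: "(u, e \<cdot> v, w \<cdot> \<phi>) \<in> Tri T" using Tri_iso t(1) by blast
  have "candidate T w' u (e \<cdot> v)" unfolding candidate_def using w'(1) h e(1) by (simp add: hom_iff)
  then have "(w', u, e \<cdot> v) \<in> Tri T" using Tri_rotate[of w' u "e \<cdot> v" "w \<cdot> \<phi>"] w'(2) m' tri by simp
  then show ?thesis using that WS w'(1) by (simp add: hom_iff)
qed

section \<open>Cohomological functors on a triangulated category\<close>

lemma cohomologicalD: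
  "cohomological T D H \<Longrightarrow> is_functor T D H"
  "cohomological T D H \<Longrightarrow> (u, v, w) \<in> Tri T \<Longrightarrow> exact_at D (fmor H u) (fmor H v)"
  unfolding cohomological_def by auto

text \<open>In the identity triangle of a zero object the second arrow is the identity too, so the
  image satisfies the exactness criterion for a zero object.\<close>

lemma cohomological_zero:
  assumes D: "abelian_cat D" and H: "cohomological T D H" and Z: "zero_obj T Z"
  shows "zero_obj D (fobj H Z)"
proof -
  interpret D: abelian_cat D by (rule D)
  have ZO: "Z \<in> Obj T" using Z by (simp add: zero_obj_def)
  obtain v w where vw: "v \<in> hom T Z Z" "(Ident T Z, v, w) \<in> Tri T" using ident_triangle[OF ZO Z] by metis
  have "v = Ident T Z" using zero_obj_unique(1)[OF Z vw(1) Ident_hom[OF ZO]] .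
  then have "exact_at D (fmor H (Ident T Z)) (fmor H (Ident T Z))" using cohomologicalD(2)[OF H vw(2)] by simp
  then show ?thesis
    using D.zero_obj_exact_ident functorD(3,5)[OF cohomologicalD(1)[OF H] ZO] by simp
qed

text \<open>The cone of \<open>u\<close> makes its image epic, the fibre makes it monic, and an
  abelian category is balanced.\<close>

lemma cohomological_inverts:
  assumes D: "abelian_cat D" and H: "cohomological T D H"
    and S: "\<And>X. X \<in> S \<Longrightarrow> zero_obj D (fobj H X)" and u: "u \<in> cone_arrows T S"
  shows "iso D (fmor H u)"
proof -
  interpret D: abelian_cat D by (rule D)
  note H' = cohomologicalD(1)[OF H]
  obtain v w where t: "(u, v, w) \<in> Tri T" "Cod T v \<in> S" using u unfolding cone_arrows_def by blast
  obtain w' v' where t': "(w', u, v') \<in> Tri T" "Dom T w' \<in> S" using cone_arrow_fibre[OF u] .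
  note a = tri_arr[OF t(1)] and a' = tri_arr[OF t'(1)]
  have "zero_arr D (fmor H v)" using D.zero_arr_cod functor_arr[OF H' a(2)] S[OF t(2)] by simp
  then have "epi_arr D (fmor H u)" using D.exact_at_zero_right[OF cohomologicalD(2)[OF H t(1)]] by blast
  moreover have "zero_arr D (fmor H w')" using D.zero_arr_dom functor_arr[OF H' a'(1)] S[OF t'(2)] by simp
  then have "mono_arr D (fmor H u)" using D.exact_at_zero_left[OF cohomologicalD(2)[OF H t'(1)]] by blast
  ultimately show ?thesis using D.mono_epi_iso by blast
qed

end

section \<open>The Verdier quotient\<close>

text \<open>Shift and triangles sit in extra record fields, so the categorical notions used below
  are the same for the Verdier quotient as for the underlying localisation.\<close>

lemma verdier_quotient_simps [simp]:
  "Obj (verdier_quotient T S) = Obj (localisation T (cone_arrows T S))"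
  "Arr (verdier_quotient T S) = Arr (localisation T (cone_arrows T S))"
  "Dom (verdier_quotient T S) = Dom (localisation T (cone_arrows T S))"
  "Cod (verdier_quotient T S) = Cod (localisation T (cone_arrows T S))"
  "Ident (verdier_quotient T S) = Ident (localisation T (cone_arrows T S))"
  "Comp (verdier_quotient T S) = Comp (localisation T (cone_arrows T S))"
  by (simp_all add: verdier_quotient_def Let_def cat.extend_def)

lemma verdier_quotient_hom: "hom (verdier_quotient T S) = hom (localisation T (cone_arrows T S))"
  by (simp add: hom_def fun_eq_iff)

lemma verdier_quotient_category:
  "category (verdier_quotient T S) \<longleftrightarrow> category (localisation T (cone_arrows T S))"
  by (simp add: category_def verdier_quotient_hom)

lemma verdier_quotient_is_functor:
  "is_functor (verdier_quotient T S) D H \<longleftrightarrow> is_functor (localisation T (cone_arrows T S)) D H"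
  "is_functor D (verdier_quotient T S) G \<longleftrightarrow> is_functor D (localisation T (cone_arrows T S)) G"
  by (simp_all add: is_functor_def verdier_quotient_hom verdier_quotient_category)

lemma verdier_quotient_nat_isomorphic:
  "nat_isomorphic (verdier_quotient T S) D H G \<longleftrightarrow> nat_isomorphic (localisation T (cone_arrows T S)) D H G"
  by (simp add: nat_isomorphic_def nat_trans_def)

text \<open>Of the isomorphism of triangles the two squares around \<open>u'\<close> and
  \<open>v'\<close> are kept: these are what transporting exactness of the first two arrows
  requires.\<close>

lemma verdier_quotient_TriE:
  assumes "(u', v', w') \<in> Tri (verdier_quotient T S)"
  obtains u v w a b c where "(u, v, w) \<in> Tri T"
    "let L = localisation T (cone_arrows T S); q = fmor (verdier_quotient_functor T S) in
      u' \<in> Arr L \<and> v' \<in> Arr L \<and> w' \<in> Arr L \<and> Cod L u' = Dom L v' \<and> Cod L v' = Dom L w' \<and>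
      Cod L (q u) = Dom L (q v) \<and> Cod L (q v) = Dom L (q w) \<and>
      a \<in> hom L (Dom L (q u)) (Dom L u') \<and> b \<in> hom L (Dom L (q v)) (Dom L v') \<and> c \<in> hom L (Dom L (q w)) (Dom L w') \<and>
      iso L a \<and> iso L b \<and> iso L c \<and> b \<cdot>\<^bsub>L\<^esub> q u = u' \<cdot>\<^bsub>L\<^esub> a \<and> c \<cdot>\<^bsub>L\<^esub> q v = v' \<cdot>\<^bsub>L\<^esub> b"
proof -
  let ?L = "localisation T (cone_arrows T S)" and ?q = "fmor (verdier_quotient_functor T S)"
  \<comment> \<open>The intermediate category of the definition, with a shift but no triangles; it
    shares its arrows and composition with the localisation.\<close>
  let ?V = "cat.extend ?L (tcat.fields (loc_shift T (cone_arrows T S)) {})"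
  have s: "Obj ?V = Obj ?L" "Arr ?V = Arr ?L" "Dom ?V = Dom ?L" "Cod ?V = Cod ?L" "Ident ?V = Ident ?L"
    "Comp ?V = Comp ?L" by (simp_all add: cat.extend_def)
  have hs: "hom ?V = hom ?L" by (simp add: hom_def s fun_eq_iff)
  have ii: "iso ?V = iso ?L" by (simp add: iso_def is_inverse_def hs s fun_eq_iff)
  obtain u v w where t: "(u, v, w) \<in> Tri T" "tri_iso ?V (?q u, ?q v, ?q w) (u', v', w')"
    using assms unfolding verdier_quotient_def Let_def by auto
  then show ?thesis
    using that[OF t(1)] t(2) unfolding tri_iso_def candidate_def prod.case Let_def s hs ii by blast
qed

section \<open>Extension of cohomological functors\<close>

lemma precomp_fobj [simp]: "fobj (precomp C h) F = F \<circ>\<^sub>F h"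
  by (simp add: precomp_def)

lemma exact_functors_Obj: "F \<in> Obj (exact_functors A D) \<longleftrightarrow> exact_functor A D F"
  by (auto simp: exact_functors_def full_subcat_def functor_cat_def exact_functor_def)

lemma cohomological_functors_Obj: "F \<in> Obj (cohomological_functors T D) \<longleftrightarrow> cohomological T D F"
  by (auto simp: cohomological_functors_def full_subcat_def functor_cat_def cohomological_def)

text \<open>The uniqueness half of the universal property: an equivalence reflects the relation of
  being isomorphic, here between objects that are functors.\<close>

lemma precomp_reflects_nat_isomorphic:
  assumes e: "is_equivalence (exact_functors A D) (cohomological_functors T D) (precomp T h)"
    and F: "exact_functor A D F" "exact_functor A D G"
    and n: "nat_isomorphic T D (F \<circ>\<^sub>F h) (G \<circ>\<^sub>F h)"
  shows "nat_isomorphic A D F G"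
proof -
  have P: "is_functor (exact_functors A D) (cohomological_functors T D) (precomp T h)"
    using e unfolding is_equivalence_def by blast
  have c: "cohomological T D (F \<circ>\<^sub>F h)" "cohomological T D (G \<circ>\<^sub>F h)"
    using functorD(3)[OF P] F by (simp_all add: exact_functors_Obj cohomological_functors_Obj)
  then have f: "is_functor T D (F \<circ>\<^sub>F h)" "is_functor T D (G \<circ>\<^sub>F h)"
    by (simp_all add: cohomological_def)
  obtain \<phi> where "\<phi> \<in> hom (cohomological_functors T D) (F \<circ>\<^sub>F h) (G \<circ>\<^sub>F h)"
    "iso (cohomological_functors T D) \<phi>"
    using functor_cat_iso_iff[OF f c] n unfolding cohomological_functors_def by blast
  then obtain \<psi> where "\<psi> \<in> hom (exact_functors A D) F G" "iso (exact_functors A D) \<psi>"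
    using equivalence_reflects_iso_objects[OF e, of F G \<phi>] F by (auto simp: exact_functors_Obj)
  then show ?thesis
    using functor_cat_iso_iff[OF exact_functorD(1)[OF F(1)] exact_functorD(1)[OF F(2)] F]
    unfolding exact_functors_def by blast
qed

text \<open>The existence half: essential surjectivity extends \<open>H\<close> along
  \<open>h\<close>, up to isomorphism.\<close>

lemma precomp_ess_surj:
  assumes e: "is_equivalence (exact_functors A D) (cohomological_functors T D) (precomp T h)"
    and H: "cohomological T D H"
  obtains E where "exact_functor A D E" "nat_isomorphic T D (E \<circ>\<^sub>F h) H"
proof -
  have P: "is_functor (exact_functors A D) (cohomological_functors T D) (precomp T h)"
    using e unfolding is_equivalence_def by blast
  obtain E \<phi> where E: "exact_functor A D E" "\<phi> \<in> hom (cohomological_functors T D) (E \<circ>\<^sub>F h) H"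
      "iso (cohomological_functors T D) \<phi>"
    using equivalence_ess_surj[OF e, of H] H
    unfolding exact_functors_Obj cohomological_functors_Obj precomp_fobj by metis
  have c: "cohomological T D (E \<circ>\<^sub>F h)"
    using functorD(3)[OF P, of E] E(1) by (simp add: exact_functors_Obj cohomological_functors_Obj)
  then have f: "is_functor T D (E \<circ>\<^sub>F h)" "is_functor T D H"
    using H by (simp_all add: cohomological_def)
  show ?thesis
    using that[OF E(1)] functor_cat_iso_iff[OF f c H] E unfolding cohomological_functors_def by blast
qed

section \<open>Comparison of the two quotients\<close>

lemma fcomp_assoc: "(F \<circ>\<^sub>F G) \<circ>\<^sub>F H = F \<circ>\<^sub>F (G \<circ>\<^sub>F H)"
  by (simp add: fcomp_def comp_assoc)

lemma fcomp_id [simp]: "id_fctr \<circ>\<^sub>F F = F"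
  by (simp add: fcomp_def id_fctr_def)

text \<open>The two pairs of types in the hypotheses are those of the test categories that occur,
  \<open>B\<close> and the Serre quotient of \<open>A\<close>. That \<open>G\<close> is induced by
  \<open>F\<close> is expressed on the nose: \<open>G\<close> after the quotient functor agrees with
  \<open>F\<close> on objects and arrows.\<close>

theorem proposition3:
  fixes T :: "('o, 'm) tcat" and S :: "'o set"
    and A :: "('p, 'q) cat" and h :: "('o, 'm, 'p, 'q) fctr"
    and B :: "('r, 's) cat" and h' :: "('o, ('o, 'm) zigzag_class, 'r, 's) fctr"
    and F :: "('p, 'q, 'r, 's) fctr"
  assumes "triangulated T"
    and "triangulated_subcategory T S"
    and "abelianisation TYPE('r) TYPE('s) T A h"
    and "abelianisation TYPE('p) TYPE(('p, 'q) zigzag_class) T A h"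
    and "abelianisation TYPE('r) TYPE('s) (verdier_quotient T S) B h'"
    and "abelianisation TYPE('p) TYPE(('p, 'q) zigzag_class) (verdier_quotient T S) B h'"
    and "exact_functor A B F"
    and "nat_isomorphic T B (F \<circ>\<^sub>F h) (h' \<circ>\<^sub>F verdier_quotient_functor T S)"
  shows "\<exists>G. is_equivalence (serre_quotient A (serre_generated A (fobj h ` S))) B G \<and>
      (\<forall>X \<in> Obj A.
         fobj G (fobj (serre_quotient_functor A (serre_generated A (fobj h ` S))) X) = fobj F X) \<and>
      (\<forall>f \<in> Arr A.
         fmor G (fmor (serre_quotient_functor A (serre_generated A (fobj h ` S))) f) = fmor F f)"
proof -
  interpret T: triangulated_sub T S
    using assms(1,2) by (simp add: triangulated_sub_def triangulated_sub_axioms_def)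
  interpret A: abelian_cat A using assms(3) abelian_catI unfolding abelianisation_def by blast
  interpret B: abelian_cat B using assms(5) abelian_catI unfolding abelianisation_def by blast
  let ?W = "cone_arrows T S"
  let ?V = "verdier_quotient T S" and ?q = "verdier_quotient_functor T S"
  let ?VL = "localisation T ?W"
  define K where "K = serre_generated A (fobj h ` S)"
  define L where "L = serre_quotient A K"
  define Q where "Q = serre_quotient_functor A K"
  have h: "cohomological T A h" "is_functor T A h"
    using assms(3) unfolding abelianisation_def cohomological_def by blast+
  have h': "is_functor ?V B h'" "is_functor ?VL B h'"
    using assms(5) unfolding abelianisation_def cohomological_def verdier_quotient_is_functor by blast+
  note F = assms(7) and F' = exact_functorD(1)[OF assms(7)]
  have q: "is_functor T ?VL ?q" "is_functor T ?V ?q"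
    using T.is_functor_loc unfolding verdier_quotient_functor_def verdier_quotient_is_functor by blast+
  have hS: "fobj h ` S \<subseteq> Obj A" using functorD(3)[OF h(2)] T.S_obj by blast
  interpret K: serre A K unfolding K_def by (rule serre_generated(1)[OF A.abelian_cat_axioms hS])
  interpret L: fraction_functor A L Q
    using K.fraction_functor_serre unfolding L_def Q_def serre_quotient_def serre_quotient_functor_def .
  have Lab: "abelian_cat L" by (rule L.L_abelian)
  interpret Lab: abelian_cat L by (rule Lab)

  obtain \<eta> where eta: "\<And>X. X \<in> Obj T \<Longrightarrow> iso B (\<eta> X)"
    "\<And>X. X \<in> Obj T \<Longrightarrow> \<eta> X \<in> hom B (fobj F (fobj h X)) (fobj h' X)"
    using nat_isomorphicE[OF assms(8)] unfolding fcomp_simps verdier_quotient_functor_def T.loc_functor_simps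
    by metis
  have Fh: "cohomological T B (F \<circ>\<^sub>F h)"
    using h(1) F unfolding cohomological_def exact_functor_def by (auto intro: is_functor_comp)
  \<comment> \<open>The arrow from \<open>X\<close> to a zero object \<open>Z\<close> becomes
    invertible in the quotient, so \<open>h' X\<close> and \<open>h' Z\<close> are isomorphic;
    \<open>\<eta>\<close> compares them with the values of \<open>F \<circ> h\<close>, which
    vanishes at \<open>Z\<close>.\<close>
  have FhS: "zero_obj B (fobj F (fobj h X))" if X: "X \<in> S" for X
  proof -
    obtain Z where Z: "zero_obj T Z" using T.zero_obj_ex .
    have ZO: "Z \<in> Obj T" and XO: "X \<in> Obj T" using Z T.S_obj[OF X] by (simp_all add: zero_obj_def)
    obtain v where v: "v \<in> hom T X Z" "v \<in> ?W" using T.cone_arrow_to_zero[OF X Z] .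
    have qv: "fmor ?q v \<in> hom ?VL X Z" "iso ?VL (fmor ?q v)"
      using functorD(4)[OF q(1) v(1)] T.loc_functor_iso[OF v] by (simp_all add: verdier_quotient_functor_def)
    obtain i where i: "i \<in> hom B (fobj h' Z) (fobj h' X)" "iso B i"
      using B.isoE[OF functor_iso[OF h'(2) qv] functorD(4)[OF h'(2) qv(1)]] by metis
    have "zero_obj B (fobj F (fobj h Z))"
      using T.cohomological_zero[OF B.abelian_cat_axioms Fh Z] by simp
    then have "zero_obj B (fobj h' X)"
      using B.zero_obj_iso[OF B.zero_obj_iso[OF _ eta(2,1)[OF ZO]] i] by blast
    moreover obtain j where "j \<in> hom B (fobj h' X) (fobj F (fobj h X))" "iso B j"
      using B.isoE[OF eta(1,2)[OF XO]] by metis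
    ultimately show ?thesis using B.zero_obj_iso by blast
  qed
  \<comment> \<open>Minimality of \<open>K\<close> reduces the claim to the generators treated in
    \<open>FhS\<close>.\<close>
  have "K \<subseteq> {X \<in> Obj A. zero_obj B (fobj F X)}"
    unfolding K_def
    by (rule serre_generated(3)[OF A.abelian_cat_axioms hS
          serre_kernel_exact[OF A.abelian_cat_axioms B.abelian_cat_axioms F]])
      (use FhS hS in blast)
  then interpret FQ: inverting_functor A B F "serre_arrows A K"
    by unfold_locales
      (use F' exact_inverts_serre_arrows[OF A.abelian_cat_axioms B.abelian_cat_axioms F] in blast)+
  define G where "G = FQ.lift"
  have G: "is_functor L B G" using FQ.is_functor_lift unfolding G_def L_def serre_quotient_def .
  have GQ: "fmor G (fmor Q f) = fmor F f" if "f \<in> Arr A" for f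
    using FQ.lift_fmor[OF that] unfolding G_def Q_def serre_quotient_functor_def .
  have GQ0: "fobj G (fobj Q X) = fobj F X" for X
    by (simp add: G_def L.Q_obj)
  have Gex: "exact_functor L B G" by (rule L.descended_exact[OF B.abelian_cat_axioms F G GQ])

  have Qh: "cohomological T L (Q \<circ>\<^sub>F h)"
    using h(1) L.Q_exact unfolding cohomological_def exact_functor_def by (auto intro: is_functor_comp)
  have QhS: "zero_obj L (fobj (Q \<circ>\<^sub>F h) X)" if X: "X \<in> S" for X
  proof -
    have XK: "fobj h X \<in> K" unfolding K_def using serre_generated(2)[OF A.abelian_cat_axioms hS] X by blast
    obtain Z where Z: "zero_obj A Z" using A.zero_obj_ex .
    obtain z where z: "z \<in> hom A Z (fobj h X)" using A.zero_obj_hom_ex[OF Z K.K_obj[OF XK]] by metis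
    have z0: "zero_arr A z" using A.zero_arr_dom Z z by (simp add: hom_iff)
    \<comment> \<open>The kernel and cokernel of the zero arrow \<open>z\<close> are the identities
      of \<open>Z\<close> and of \<open>h X\<close>, both objects of \<open>K\<close>. So
      \<open>Q\<close> inverts \<open>z\<close> and makes \<open>h X\<close> isomorphic to
      zero.\<close>
    have "z \<in> serre_arrows A K"
      by (rule K.W_I[OF A.kernel_zero_arr[OF z0] A.cokernel_zero_arr[OF z0]])
        (use z XK K.K_zero[OF Z] A.hom_obj[OF z] in \<open>simp_all add: hom_iff\<close>)
    then have "iso L (fmor Q z)"
      using A.loc_functor_iso[OF z] unfolding L_def Q_def serre_quotient_def serre_quotient_functor_def by blast
    then have "zero_obj L (fobj h X)"
      using L.L.zero_obj_iso[OF L.Q_zero_obj[OF Z] L.Q_hom[OF z]] by blast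
    then show ?thesis by (simp add: L.Q_obj)
  qed
  interpret QhV: inverting_functor T L "Q \<circ>\<^sub>F h" ?W
    by unfold_locales
      (use T.cohomologicalD(1)[OF Qh] T.cohomological_inverts[OF Lab Qh QhS] in blast)+
  define H where "H = QhV.lift"
  have H: "is_functor ?VL L H" using QhV.is_functor_lift unfolding H_def .
  have Hq: "fmor H (fmor ?q f) = fmor Q (fmor h f)" if "f \<in> Arr T" for f
    using QhV.lift_fmor[OF that] unfolding H_def verdier_quotient_functor_def by simp
  have Hq0: "fobj H (fobj ?q X) = fobj Q (fobj h X)" for X
    by (simp add: H_def verdier_quotient_functor_def)
  \<comment> \<open>On images of triangles of \<open>T\<close> the functor \<open>H\<close>
    restricts to the cohomological functor \<open>Q \<circ> h\<close>; exactness then passes along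
    the isomorphism to an arbitrary triangle of the quotient.\<close>
  have Hcoh: "cohomological ?V L H"
    unfolding cohomological_def verdier_quotient_is_functor
  proof (intro conjI H ballI, clarify)
    fix u' v' w' assume "(u', v', w') \<in> Tri ?V"
    then obtain u v w a b c where t: "(u, v, w) \<in> Tri T"
      and r: "u' \<in> Arr ?VL" "v' \<in> Arr ?VL" "w' \<in> Arr ?VL" "Cod ?VL u' = Dom ?VL v'" "Cod ?VL v' = Dom ?VL w'"
      "Cod ?VL (fmor ?q u) = Dom ?VL (fmor ?q v)" "Cod ?VL (fmor ?q v) = Dom ?VL (fmor ?q w)"
      "a \<in> hom ?VL (Dom ?VL (fmor ?q u)) (Dom ?VL u')" "b \<in> hom ?VL (Dom ?VL (fmor ?q v)) (Dom ?VL v')"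
      "c \<in> hom ?VL (Dom ?VL (fmor ?q w)) (Dom ?VL w')"
      "iso ?VL a" "iso ?VL b" "iso ?VL c" "b \<cdot>\<^bsub>?VL\<^esub> fmor ?q u = u' \<cdot>\<^bsub>?VL\<^esub> a" "c \<cdot>\<^bsub>?VL\<^esub> fmor ?q v = v' \<cdot>\<^bsub>?VL\<^esub> b"
      using verdier_quotient_TriE[of u' v' w' T S] unfolding Let_def by metis
    note ta = T.tri_arr[OF t]
    have uh: "fmor ?q u \<in> hom ?VL (Dom ?VL (fmor ?q u)) (Dom ?VL (fmor ?q v))"
      and vh: "fmor ?q v \<in> hom ?VL (Dom ?VL (fmor ?q v)) (Dom ?VL (fmor ?q w))"
      and uh': "u' \<in> hom ?VL (Dom ?VL u') (Dom ?VL v')" and vh': "v' \<in> hom ?VL (Dom ?VL v') (Dom ?VL w')"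
      using r(1,2,4-7) functor_arr(1)[OF q(1) ta(1)] functor_arr(1)[OF q(1) ta(2)] by (simp_all add: hom_iff)
    note Hu = functorD(4)[OF H uh] and Hv = functorD(4)[OF H vh]
    have "exact_at L (fmor H (fmor ?q u)) (fmor H (fmor ?q v))"
      using T.cohomologicalD(2)[OF Qh t] Hq ta by simp
    then show "exact_at L (fmor H u') (fmor H v')"
    proof (rule L.L.exact_at_iso)
      show "fmor H b \<in> hom L (Cod L (fmor H (fmor ?q u))) (fobj H (Dom ?VL v'))"
        "fmor H a \<in> hom L (Dom L (fmor H (fmor ?q u))) (fobj H (Dom ?VL u'))"
        "fmor H c \<in> hom L (Cod L (fmor H (fmor ?q v))) (fobj H (Dom ?VL w'))"
        using functorD(4)[OF H r(8)] functorD(4)[OF H r(9)] functorD(4)[OF H r(10)] Hu Hv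
        by (simp_all add: hom_iff)
      show "iso L (fmor H b)" "iso L (fmor H a)" "iso L (fmor H c)"
        using functor_iso[OF H r(8,11)] functor_iso[OF H r(9,12)] functor_iso[OF H r(10,13)] by blast+
      show "fmor H u' \<in> hom L (fobj H (Dom ?VL u')) (fobj H (Dom ?VL v'))"
        "fmor H v' \<in> hom L (fobj H (Dom ?VL v')) (fobj H (Dom ?VL w'))"
        using functorD(4)[OF H uh'] functorD(4)[OF H vh'] by blast+
      show "fmor H b \<cdot>\<^bsub>L\<^esub> fmor H (fmor ?q u) = fmor H u' \<cdot>\<^bsub>L\<^esub> fmor H a"
        "fmor H c \<cdot>\<^bsub>L\<^esub> fmor H (fmor ?q v) = fmor H v' \<cdot>\<^bsub>L\<^esub> fmor H b"
        using functorD(6)[OF H uh r(9)] functorD(6)[OF H r(8) uh'] r(14)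
          functorD(6)[OF H vh r(10)] functorD(6)[OF H r(9) vh'] r(15) by simp_all
    qed
  qed

  have eqB: "is_equivalence (exact_functors B L) (cohomological_functors ?V L) (precomp ?V h')"
    "is_equivalence (exact_functors B B) (cohomological_functors ?V B) (precomp ?V h')"
    "is_equivalence (exact_functors A L) (cohomological_functors T L) (precomp T h)"
    using assms(4-6) Lab.abelian B.abelian unfolding abelianisation_def by blast+
  obtain E where E: "exact_functor B L E" "nat_isomorphic ?V L (E \<circ>\<^sub>F h') H"
    using precomp_ess_surj[OF eqB(1) Hcoh] .
  note E' = exact_functorD(1)[OF E(1)]
  have Eh: "is_functor ?VL L (E \<circ>\<^sub>F h')" using is_functor_comp[OF h'(2) E'] .
  have EH: "nat_isomorphic ?VL L (E \<circ>\<^sub>F h') H" using E(2) unfolding verdier_quotient_nat_isomorphic .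
  have FhF: "is_functor T B (F \<circ>\<^sub>F h)" using is_functor_comp[OF h(2) F'] .
  have hq: "is_functor T B (h' \<circ>\<^sub>F ?q)" using is_functor_comp[OF q(1) h'(2)] .

  \<comment> \<open>By universality of \<open>h'\<close> it suffices to compare after
    \<open>h'\<close>, where \<open>G \<circ> E \<circ> h'\<close> is isomorphic to
    \<open>G \<circ> H\<close>. By uniqueness for the localisation that is compared with
    \<open>h'\<close> after the quotient functor, where \<open>G \<circ> H\<close> becomes
    \<open>G \<circ> Q \<circ> h\<close>, that is \<open>F \<circ> h\<close>, and the assumed
    isomorphism finishes.\<close>
  have GE: "nat_isomorphic B B (G \<circ>\<^sub>F E) id_fctr"
  proof (rule precomp_reflects_nat_isomorphic[OF eqB(2)])
    show "exact_functor B B (G \<circ>\<^sub>F E)" by (rule exact_functor_comp[OF E(1) Gex])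
    show "exact_functor B B id_fctr" by (rule exact_functor_id[OF B.category_axioms])
    have GH: "is_functor ?VL B (G \<circ>\<^sub>F H)" using is_functor_comp[OF H G] .
    have "nat_isomorphic T B ((G \<circ>\<^sub>F H) \<circ>\<^sub>F ?q) (F \<circ>\<^sub>F h)"
      by (rule nat_isomorphic_agree[OF is_functor_comp[OF q(1) GH]])
        (use Hq Hq0 GQ GQ0 functor_arr(1)[OF h(2)] in simp_all)
    then have "nat_isomorphic T B ((G \<circ>\<^sub>F H) \<circ>\<^sub>F ?q) (h' \<circ>\<^sub>F ?q)"
      using nat_isomorphic_trans[OF is_functor_comp[OF q(1) GH] FhF hq] assms(8) by blast
    then have "nat_isomorphic ?VL B (G \<circ>\<^sub>F H) h'"
      using T.nat_isomorphic_localisation[OF GH h'(2)] unfolding verdier_quotient_functor_def by blast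
    then have "nat_isomorphic ?VL B (G \<circ>\<^sub>F (E \<circ>\<^sub>F h')) h'"
      using nat_isomorphic_trans[OF is_functor_comp[OF Eh G] GH h'(2) nat_isomorphic_post[OF Eh H EH G]] by blast
    then show "nat_isomorphic ?V B ((G \<circ>\<^sub>F E) \<circ>\<^sub>F h') (id_fctr \<circ>\<^sub>F h')"
      unfolding verdier_quotient_nat_isomorphic fcomp_assoc fcomp_id .
  qed

  \<comment> \<open>The composites agree on \<open>T\<close>:
    \<open>E \<circ> G \<circ> Q \<circ> h\<close> is \<open>E \<circ> F \<circ> h\<close>, which is
    carried to \<open>E \<circ> h'\<close> on the quotient, then to \<open>H\<close>, which
    restricts to \<open>Q \<circ> h\<close>. Universality of \<open>h\<close> cancels
    \<open>h\<close>, as both sides are exact on \<open>A\<close>; uniqueness for the localisation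
    then cancels \<open>Q\<close>.\<close>
  have EG: "nat_isomorphic L L (E \<circ>\<^sub>F G) id_fctr"
  proof -
    have EGQ: "exact_functor A L ((E \<circ>\<^sub>F G) \<circ>\<^sub>F Q)"
      using exact_functor_comp[OF L.Q_exact exact_functor_comp[OF Gex E(1)]] .
    have f: "is_functor T L (((E \<circ>\<^sub>F G) \<circ>\<^sub>F Q) \<circ>\<^sub>F h)" "is_functor T L (E \<circ>\<^sub>F (F \<circ>\<^sub>F h))"
      "is_functor T L ((E \<circ>\<^sub>F h') \<circ>\<^sub>F ?q)" "is_functor T L (H \<circ>\<^sub>F ?q)" "is_functor T L (Q \<circ>\<^sub>F h)"
      using is_functor_comp[OF h(2) exact_functorD(1)[OF EGQ]] is_functor_comp[OF FhF E']
        is_functor_comp[OF q(1) Eh] is_functor_comp[OF q(1) H] T.cohomologicalD(1)[OF Qh] by blast+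
    have n1: "nat_isomorphic T L (((E \<circ>\<^sub>F G) \<circ>\<^sub>F Q) \<circ>\<^sub>F h) (E \<circ>\<^sub>F (F \<circ>\<^sub>F h))"
      by (rule nat_isomorphic_agree[OF f(1)]) (use GQ GQ0 functor_arr(1)[OF h(2)] in simp_all)
    have n2: "nat_isomorphic T L (E \<circ>\<^sub>F (F \<circ>\<^sub>F h)) ((E \<circ>\<^sub>F h') \<circ>\<^sub>F ?q)"
      using nat_isomorphic_post[OF FhF hq assms(8) E'] unfolding fcomp_assoc .
    have n3: "nat_isomorphic T L ((E \<circ>\<^sub>F h') \<circ>\<^sub>F ?q) (H \<circ>\<^sub>F ?q)"
      by (rule nat_isomorphic_pre[OF EH q(1)])
    have n4: "nat_isomorphic T L (H \<circ>\<^sub>F ?q) (Q \<circ>\<^sub>F h)"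
      by (rule nat_isomorphic_agree[OF f(4)]) (use Hq Hq0 in simp_all)
    have "nat_isomorphic T L (((E \<circ>\<^sub>F G) \<circ>\<^sub>F Q) \<circ>\<^sub>F h) (Q \<circ>\<^sub>F h)"
      using nat_isomorphic_trans[OF f(1,2,3) n1 n2] nat_isomorphic_trans[OF f(1,3,4) _ n3]
        nat_isomorphic_trans[OF f(1,4,5) _ n4] by blast
    then have "nat_isomorphic A L ((E \<circ>\<^sub>F G) \<circ>\<^sub>F Q) (id_fctr \<circ>\<^sub>F Q)"
      using precomp_reflects_nat_isomorphic[OF eqB(3) EGQ L.Q_exact] by simp
    then show ?thesis
      using A.nat_isomorphic_localisation[of "serre_arrows A K" L "E \<circ>\<^sub>F G" id_fctr]
        is_functor_comp[OF G E'] is_functor_id[OF L.L.category_axioms]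
      unfolding Q_def L_def serre_quotient_def serre_quotient_functor_def by blast
  qed

  have "is_equivalence L B G"
    unfolding is_equivalence_def using G E' EG GE by blast
  then show ?thesis
    using GQ GQ0 unfolding L_def Q_def K_def by blast
qed

end
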